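(* Let $a\ge 0$, put $a'=a+\tfrac12$, and let $Y_{a'}$ be the nonnegative random variable whose law is uniquely determined by its moments $$\mathbb{E}(Y_{a'}^s)=\frac{s!}{2^{s/2}}\prod_{k=1}^{s}\frac{\Gamma(ka')}{\Gamma(ka'+\frac12)},\qquad s\in\{1,2,3,\dots\}.$$ Let $d=1$, $\alpha=1-\frac d2=\frac12$ and $p=\frac12-\frac{1}{4a'}$, and for $t>0$ let $$\kappa(p,t)=\frac{(2t)^{\alpha}\,\Gamma(1+\alpha)}{(1-2p)^{\alpha}\,\Gamma(1-\alpha)}.$$ Let $\hat L_t$ denote the local time at level $0$, up to time $t$, of the noise reinforced Bessel process of dimension $d=1$ with reinforcement parameter $p$. Then the following hold. (1) For every $t>0$, $$Y_{a'}\ \overset{\mathcal L}{=}\ \frac{1}{\sqrt2}\cdot \mathrm{tilt}_1\!\left(\frac{\hat L_t}{\kappa(p,t)}\right),$$ where $\mathrm{tilt}_1$ denotes the size-biased (moment-shifted) version of a random variable. (2) Moreover, $$Y_{a'}\ \overset{\mathcal L}{=}\ \frac{1}{\kappa(p,1)\sqrt2}\cdot \hat I,\qquad \hat I=\int_0^\infty \exp\!\left(-\tfrac12\hat\xi_t\right)dt,$$ where $(\hat\xi_t)_{t\ge0}$ is the subordinator with Laplace exponent $$\hat\Phi(r)=2^{-\frac12}\left(\frac{1}{2a'}\right)^{\frac12}\frac{\Gamma(\frac12)}{\frac12\,B(\frac12,2a'r)},\qquad r>0.$$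
   Context: $\overset{\mathcal L}{=}$ denotes equality in distribution, $\Gamma$ is the Gamma function and $B(x,y)=\Gamma(x)\Gamma(y)/\Gamma(x+y)$ is the Beta function. Background: $Y_{a'}$ is the limit in distribution of the normalized cost $Y_n/(\sigma n^{a'})$, for a parameter $\sigma>0$, of one-sided destruction (root isolation) of random very simple trees with toll function $t_n=n^a$. For the present purpose its law is defined by the moment sequence given in the claim, which determines it uniquely. Size bias: for a nonnegative random variable $X$ with $0<\mathbb{E}(X)<\infty$, $\mathrm{tilt}_1(X)$ denotes a random variable whose law is given by $\mathbb{E}\big(f(\mathrm{tilt}_1(X))\big)=\mathbb{E}\big(Xf(X)\big)/\mathbb{E}(X)$ for all bounded measurable $f$. In particular $\mathbb{E}(\mathrm{tilt}_1(X)^s)=\mathbb{E}(X^{s+1})/\mathbb{E}(X)$ for integers $s\ge 1$ whenever these moments are finite. Noise reinforced Bessel process of dimension $1$: for a reinforcement parameter $p<\frac12$, let $(B_s)_{s\ge0}$ be a standard real Brownian motion and let $\hat B_t=t^{p}\int_0^t s^{-p}\,dB_s$ for $t>0$, $\hat B_0=0$ (noise reinforced Brownian motion). The noise reinforced Bessel process of dimension $1$ with parameter $p$ is $\hat R_t=|\hat B_t|$. Its local time at $0$ is normalized as $$\hat L_t=\lim_{\varepsilon\to0+}\frac{1}{2\varepsilon}\int_0^t \mathbf 1_{\{\hat R_s\le\varepsilon\}}\,ds ,$$ so that $\mathbb{E}(\hat L_1)=\frac{2^{\alpha}(1-2p)^{1-\alpha}}{\Gamma(1-\alpha)}$ with $\alpha=\frac12$.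 Laplace exponent: a subordinator $(\hat\xi_t)_{t\ge0}$ (a nondecreasing Lévy process started at $0$) has Laplace exponent $\hat\Phi$ if $\mathbb{E}\big(e^{-r\hat\xi_t}\big)=e^{-t\hat\Phi(r)}$ for all $r>0$, $t\ge0$. *)

theory Defs
  imports "HOL-Probability.Probability"
begin

text \<open>Stochastic processes are functions \<open>X :: real \<Rightarrow> 'a \<Rightarrow> real\<close>, used only at times
  \<open>t \<ge> 0\<close>. Path properties are required almost surely.\<close>

definition process :: "'a measure \<Rightarrow> (real \<Rightarrow> 'a \<Rightarrow> real) \<Rightarrow> bool" where
  "process M X \<longleftrightarrow> prob_space M \<and> (\<forall>t\<ge>0. X t \<in> borel_measurable M)"

definition indep_increments :: "'a measure \<Rightarrow> (real \<Rightarrow> 'a \<Rightarrow> real) \<Rightarrow> bool" where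
  "indep_increments M X \<longleftrightarrow>
    (\<forall>(n::nat) (u::nat \<Rightarrow> real). 0 \<le> u 0 \<longrightarrow> mono u \<longrightarrow>
       prob_space.indep_vars M (\<lambda>_. borel) (\<lambda>i \<omega>. X (u (Suc i)) \<omega> - X (u i) \<omega>) {..<n})"

definition standard_brownian_motion :: "'a measure \<Rightarrow> (real \<Rightarrow> 'a \<Rightarrow> real) \<Rightarrow> bool" where
  "standard_brownian_motion M B \<longleftrightarrow>
     process M B \<and>
     (AE \<omega> in M. B 0 \<omega> = 0) \<and>
     indep_increments M B \<and>
     (\<forall>s t. 0 \<le> s \<longrightarrow> s < t \<longrightarrow>
        distributed M lborel (\<lambda>\<omega>. B t \<omega> - B s \<omega>) (normal_density 0 (sqrt (t - s)))) \<and>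
     (AE \<omega> in M. continuous_on {0..} (\<lambda>t. B t \<omega>))"

text \<open>The stochastic integral \<open>J = \<integral>\<^sub>0\<^sup>t f(s) dB\<^sub>s\<close> of a deterministic \<open>f\<close>, as the
  \<open>L\<^sup>2\<close>-limit of the integrals of step functions that approximate \<open>f\<close> in \<open>L\<^sup>2(0,t)\<close>. By the
  isometry the limit does not depend on the approximating sequence.\<close>

definition step_fun :: "nat \<Rightarrow> (nat \<Rightarrow> real) \<Rightarrow> (nat \<Rightarrow> real) \<Rightarrow> real \<Rightarrow> real" where
  "step_fun n u c s = (\<Sum>i<n. c i * indicator {u i<..u (Suc i)} s)"

definition step_integral ::
    "(real \<Rightarrow> 'a \<Rightarrow> real) \<Rightarrow> nat \<Rightarrow> (nat \<Rightarrow> real) \<Rightarrow> (nat \<Rightarrow> real) \<Rightarrow> 'a \<Rightarrow> real" where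
  "step_integral B n u c \<omega> = (\<Sum>i<n. c i * (B (u (Suc i)) \<omega> - B (u i) \<omega>))"

definition has_wiener_integral ::
    "'a measure \<Rightarrow> (real \<Rightarrow> 'a \<Rightarrow> real) \<Rightarrow> (real \<Rightarrow> real) \<Rightarrow> real \<Rightarrow> ('a \<Rightarrow> real) \<Rightarrow> bool" where
  "has_wiener_integral M B f t J \<longleftrightarrow>
     J \<in> borel_measurable M \<and>
     (\<exists>(n :: nat \<Rightarrow> nat) (u :: nat \<Rightarrow> nat \<Rightarrow> real) (c :: nat \<Rightarrow> nat \<Rightarrow> real).
        (\<forall>k. 0 \<le> u k 0 \<and> mono (u k) \<and> u k (n k) \<le> t) \<and>
        (\<lambda>k. \<integral>\<^sup>+s\<in>{0..t}. ennreal ((f s - step_fun (n k) (u k) (c k) s)\<^sup>2) \<partial>lborel)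
          \<longlonglongrightarrow> 0 \<and>
        (\<lambda>k. \<integral>\<^sup>+\<omega>. ennreal ((J \<omega> - step_integral B (n k) (u k) (c k) \<omega>)\<^sup>2) \<partial>M)
          \<longlonglongrightarrow> 0)"

definition noise_reinforced_brownian_motion ::
    "'a measure \<Rightarrow> (real \<Rightarrow> 'a \<Rightarrow> real) \<Rightarrow> real \<Rightarrow> (real \<Rightarrow> 'a \<Rightarrow> real) \<Rightarrow> bool" where
  "noise_reinforced_brownian_motion M B p Bh \<longleftrightarrow>
     process M Bh \<and>
     (AE \<omega> in M. Bh 0 \<omega> = 0) \<and>
     (\<forall>t>0. \<exists>J. has_wiener_integral M B (\<lambda>s. s powr (- p)) t J \<and>
        (AE \<omega> in M. Bh t \<omega> = t powr p * J \<omega>)) \<and>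
     (AE \<omega> in M. continuous_on {0..} (\<lambda>t. Bh t \<omega>))"

definition noise_reinforced_bessel1 ::
    "'a measure \<Rightarrow> real \<Rightarrow> (real \<Rightarrow> 'a \<Rightarrow> real) \<Rightarrow> bool" where
  "noise_reinforced_bessel1 M p R \<longleftrightarrow>
     (\<exists>B Bh. standard_brownian_motion M B \<and> noise_reinforced_brownian_motion M B p Bh \<and>
        (\<forall>t\<ge>0. \<forall>\<omega>\<in>space M. R t \<omega> = \<bar>Bh t \<omega>\<bar>))"

text \<open>\<open>L\<close> is the random variable \<open>L\<^sub>t\<close> for one fixed \<open>t\<close>; the limit is almost sure.\<close>

definition local_time_at_0 ::
    "'a measure \<Rightarrow> (real \<Rightarrow> 'a \<Rightarrow> real) \<Rightarrow> real \<Rightarrow> ('a \<Rightarrow> real) \<Rightarrow> bool" where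
  "local_time_at_0 M R t L \<longleftrightarrow>
     L \<in> borel_measurable M \<and>
     (AE \<omega> in M. ((\<lambda>\<epsilon>. 1 / (2 * \<epsilon>) * (LBINT s:{0..t}. indicator {..\<epsilon>} (R s \<omega>))) \<longlongrightarrow> L \<omega>)
        (at_right 0))"

definition kappa :: "real \<Rightarrow> real \<Rightarrow> real \<Rightarrow> real" where
  "kappa \<alpha> p t =
     (2 * t) powr \<alpha> * Gamma (1 + \<alpha>) / ((1 - 2 * p) powr \<alpha> * Gamma (1 - \<alpha>))"

text \<open>The law of \<open>tilt\<^sub>1(X)\<close> when \<open>\<mu>\<close> is the law of \<open>X\<close>. If the mean of \<open>X\<close> is zero or infinite,
  this is the null measure, so an equation with a probability law also says that
  the tilt is well defined.\<close>

definition tilt1 :: "real measure \<Rightarrow> real measure" where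
  "tilt1 \<mu> = density \<mu> (\<lambda>x. ennreal (x / (\<integral>x. x \<partial>\<mu>)))"

lemma integral_tilt1:
  fixes X :: "'a \<Rightarrow> real" and f :: "real \<Rightarrow> real"
  assumes [measurable]: "X \<in> borel_measurable M" "f \<in> borel_measurable borel"
    and nonneg: "AE \<omega> in M. 0 \<le> X \<omega>"
  shows "(\<integral>x. f x \<partial>tilt1 (distr M borel X)) = (\<integral>\<omega>. X \<omega> * f (X \<omega>) \<partial>M) / (\<integral>\<omega>. X \<omega> \<partial>M)"
proof -
  have m: "(\<integral>x. x \<partial>distr M borel X) = (\<integral>\<omega>. X \<omega> \<partial>M)"
    by (rule integral_distr) simp_all
  have "0 \<le> (\<integral>\<omega>. X \<omega> \<partial>M)"
    using nonneg by (rule integral_nonneg_AE)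
  then have "AE x in distr M borel X. 0 \<le> x / (\<integral>\<omega>. X \<omega> \<partial>M)"
    using nonneg by (subst AE_distr_iff) (auto elim!: eventually_mono)
  then have "(\<integral>x. f x \<partial>tilt1 (distr M borel X)) =
      (\<integral>x. x / (\<integral>\<omega>. X \<omega> \<partial>M) * f x \<partial>distr M borel X)"
    unfolding tilt1_def m by (subst integral_density) simp_all
  also have "\<dots> = (\<integral>\<omega>. X \<omega> / (\<integral>\<omega>. X \<omega> \<partial>M) * f (X \<omega>) \<partial>M)"
    by (rule integral_distr) simp_all
  also have "\<dots> = (\<integral>\<omega>. X \<omega> * f (X \<omega>) \<partial>M) / (\<integral>\<omega>. X \<omega> \<partial>M)"
    by simp
  finally show ?thesis .
qed

definition levy_process :: "'a measure \<Rightarrow> (real \<Rightarrow> 'a \<Rightarrow> real) \<Rightarrow> bool" where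
  "levy_process M X \<longleftrightarrow>
     process M X \<and>
     (AE \<omega> in M. X 0 \<omega> = 0) \<and>
     indep_increments M X \<and>
     (\<forall>s\<ge>0. \<forall>t\<ge>0. distr M borel (\<lambda>\<omega>. X (s + t) \<omega> - X s \<omega>) = distr M borel (X t)) \<and>
     (AE \<omega> in M. (\<forall>t\<ge>0. ((\<lambda>s. X s \<omega>) \<longlongrightarrow> X t \<omega>) (at_right t)) \<and>
        (\<forall>t>0. \<exists>l. ((\<lambda>s. X s \<omega>) \<longlongrightarrow> l) (at_left t)))"

definition subordinator :: "'a measure \<Rightarrow> (real \<Rightarrow> 'a \<Rightarrow> real) \<Rightarrow> bool" where
  "subordinator M \<xi> \<longleftrightarrow> levy_process M \<xi> \<and> (AE \<omega> in M. mono_on {0..} (\<lambda>t. \<xi> t \<omega>))"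

definition has_laplace_exponent ::
    "'a measure \<Rightarrow> (real \<Rightarrow> 'a \<Rightarrow> real) \<Rightarrow> (real \<Rightarrow> real) \<Rightarrow> bool" where
  "has_laplace_exponent M \<xi> \<Phi> \<longleftrightarrow>
     (\<forall>r>0. \<forall>t\<ge>0. (\<integral>\<omega>. exp (- r * \<xi> t \<omega>) \<partial>M) = exp (- t * \<Phi> r))"

definition Phi_hat :: "real \<Rightarrow> real \<Rightarrow> real" where
  "Phi_hat a' r = 2 powr (- 1 / 2) * (1 / (2 * a')) powr (1 / 2) *
     (Gamma (1 / 2) / (1 / 2 * Beta (1 / 2) (2 * a' * r)))"

end

theory Submission
  imports Defs
begin

text \<open>All three laws have the same moments, and since \<open>Gamma x / Gamma (x + 1 / 2)\<close> tends to \<open>0\<close> at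
  infinity these moments are small enough to determine the characteristic function.

  The \<open>n\<close>-th power of an integral over time is \<open>n!\<close> times the integral over ordered times. For the
  exponential functional, independence and stationarity of the increments then produce the factors
  \<open>1 / \<Phi> (k / 2)\<close> one after the other. For the local time, the occupation kernel is first replaced by
  a Gaussian kernel, which is itself a Fourier integral. The mixed moments of the smoothed local time
  thus only involve \<open>E (exp (i X))\<close> for linear combinations \<open>X\<close> of values of the noise reinforced
  Brownian motion. These are limits of linear combinations of values of \<open>B\<close>, hence Gaussian. When the
  smoothing is removed, the Gaussian integrals decouple and what remains are Beta integrals.\<close>

subsection \<open>Determination by moments\<close>

text \<open>The local-time moments are computable because of a hidden martingale: the value at time
  \<open>u\<close> is \<open>u powr p\<close> times a Gaussian martingale with variance
  \<open>clock p u\<close>. For \<open>s <= u\<close> the covariance therefore factors as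
  \<open>s powr p * u powr p * clock p s\<close>, and a combination of values after \<open>s\<close>
  splits into a part independent of the past and a multiple of the martingale at \<open>s\<close>.
  This is why the times run downwards for the local time: each new time lies below all earlier ones,
  and their only trace is the number \<open>y\<close> in \<open>kac\<close>. The Gaussian kernel
  serves two ends: its Fourier weight is integrable, so that Fubini applies, and the weight grows as
  the width shrinks, so that the limit is monotone. In the limit the weight is constant, a
  translation of the Fourier variable removes \<open>y\<close>, and a recursion in \<open>t\<close>
  alone remains. At the latest time \<open>y = 0\<close> and a plain power takes the place of the
  Beta integral, so \<open>n + 1\<close> times produce only \<open>n\<close> Beta factors; the
  moment shift of \<open>tilt1\<close> makes up for this. With
  \<open>1 - 2 * p = 1 / (2 * a)\<close> the Beta arguments are \<open>k * a\<close>.\<close>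

abbreviation Gamma_half_ratio :: "real \<Rightarrow> real" where
  "Gamma_half_ratio x \<equiv> Gamma x / Gamma (x + 1 / 2)"

text \<open>Log-convexity of Gamma at \<open>x\<close>, the midpoint of \<open>x - 1 / 2\<close> and
  \<open>x + 1 / 2\<close>, bounds the square of \<open>Gamma x\<close> by the product of the end
  values; the functional equation turns the left one into
  \<open>Gamma (x + 1 / 2) / (x - 1 / 2)\<close>.\<close>

lemma Gamma_half_ratio_square_le:
  fixes x :: real
  assumes "x > 1 / 2"
  shows "(Gamma_half_ratio x)\<^sup>2 \<le> 1 / (x - 1 / 2)"
proof -
  have pos: "Gamma (x - 1/2) > 0" "Gamma x > 0" "Gamma (x + 1/2) > 0"
    using assms by (auto intro!: Gamma_real_pos)
  have "(ln \<circ> Gamma) ((1 - 1/2) *\<^sub>R (x - 1/2) + (1/2) *\<^sub>R (x + 1/2))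
      \<le> (1 - 1/2) * (ln \<circ> Gamma) (x - 1/2) + (1/2) * (ln \<circ> Gamma) (x + 1/2)"
    using assms by (intro convex_onD[OF log_convex_Gamma_real]) auto
  moreover have "(1 - 1/2) *\<^sub>R (x - 1/2) + (1/2) *\<^sub>R (x + 1/2) = x"
    by (simp add: field_simps)
  ultimately have "2 * ln (Gamma x) \<le> ln (Gamma (x - 1/2)) + ln (Gamma (x + 1/2))"
    by simp
  then have "ln ((Gamma x)\<^sup>2) \<le> ln (Gamma (x - 1/2) * Gamma (x + 1/2))"
    using pos by (simp add: ln_mult ln_realpow)
  then have *: "(Gamma x)\<^sup>2 \<le> Gamma (x - 1/2) * Gamma (x + 1/2)"
    using pos by simp
  have "Gamma (x + 1/2) = (x - 1/2) * Gamma (x - 1/2)"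
    using Gamma_plus1[of "x - 1/2"] assms pos by (auto simp: nonpos_Ints_def algebra_simps)
  with * have "(x - 1/2) * (Gamma x)\<^sup>2 \<le> (Gamma (x + 1/2))\<^sup>2"
    using assms pos by (simp add: power2_eq_square mult_left_mono mult.assoc[symmetric])
  then have "(Gamma x)\<^sup>2 / (Gamma (x + 1/2))\<^sup>2 \<le> (Gamma x)\<^sup>2 / ((x - 1/2) * (Gamma x)\<^sup>2)"
    using assms pos by (intro divide_left_mono mult_pos_pos zero_less_power) auto
  also have "\<dots> = 1 / (x - 1/2)"
    using pos by simp
  finally show ?thesis by (simp add: power_divide)
qed

lemma Gamma_half_ratio_tendsto_0:
  "((\<lambda>x::real. Gamma_half_ratio x) \<longlongrightarrow> 0) at_top"
proof -
  have lim: "((\<lambda>x::real. 1 / (x - 1 / 2)) \<longlongrightarrow> 0) at_top" by real_asymp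
  have "((\<lambda>x::real. (Gamma_half_ratio x)\<^sup>2) \<longlongrightarrow> 0) at_top"
    using eventually_gt_at_top[of "1/2::real"]
    by (intro tendsto_sandwich[OF _ _ tendsto_const lim])
      (auto elim!: eventually_mono intro: Gamma_half_ratio_square_le)
  from tendsto_real_sqrt[OF this] show ?thesis
    by (simp add: tendsto_rabs_zero_iff flip: abs_divide)
qed

lemma powr_half_real_of_nat: "0 < x \<Longrightarrow> x powr (real n / 2) = sqrt x ^ n"
  by (simp add: powr_half_sqrt[symmetric] powr_powr flip: powr_realpow)

text \<open>The ratio of consecutive products is \<open>b (Suc n)\<close>, eventually at most
  \<open>1 / 2\<close> in absolute value, so the products are even summable.\<close>

lemma prod_null_seq_tendsto_0:
  fixes b :: "nat \<Rightarrow> real"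
  assumes "b \<longlonglongrightarrow> 0"
  shows "(\<lambda>n. \<Prod>k=1..n. b k) \<longlonglongrightarrow> 0"
proof (rule summable_LIMSEQ_zero)
  obtain N where N: "\<And>n. n \<ge> N \<Longrightarrow> \<bar>b n\<bar> < 1/2"
    using LIMSEQ_D[OF assms, of "1/2"] by auto
  show "summable (\<lambda>n. \<Prod>k=1..n. b k)"
  proof (rule summable_ratio_test[of "1/2" N])
    fix n assume "n \<ge> N"
    then have "\<bar>b (Suc n)\<bar> \<le> 1/2" using N[of "Suc n"] by simp
    then show "norm (\<Prod>k=1..Suc n. b k) \<le> 1/2 * norm (\<Prod>k=1..n. b k)"
      using mult_right_mono[of "\<bar>b (Suc n)\<bar>" "1/2" "norm (\<Prod>k=1..n. b k)"]
      by (simp add: abs_mult mult.commute)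
  qed simp
qed

text \<open>The Taylor remainder of a characteristic function is at most
  \<open>2 * |t|^n / n!\<close> times the absolute \<open>n\<close>-th moment, and on the half line
  that is the moment itself. \<open>growth\<close> at every \<open>t\<close> thus makes both
  characteristic functions the sum of the same power series.\<close>

lemma real_distribution_eqI_moments:
  fixes \<mu> \<nu> :: "real measure" and m :: "nat \<Rightarrow> real"
  assumes "real_distribution \<mu>" "real_distribution \<nu>"
    and nonneg: "AE x in \<mu>. 0 \<le> x" "AE x in \<nu>. 0 \<le> x"
    and mu: "\<And>n. has_bochner_integral \<mu> (\<lambda>x. x ^ n) (m n)"
    and nu: "\<And>n. has_bochner_integral \<nu> (\<lambda>x. x ^ n) (m n)"
    and growth: "\<And>t. (\<lambda>n. t ^ n * m n / fact n) \<longlonglongrightarrow> 0"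
  shows "\<mu> = \<nu>"
proof (rule Levy_uniqueness[OF assms(1,2)], rule ext)
  fix t
  have approx: "(\<lambda>n. \<Sum>k\<le>n. ((\<i> * t) ^ k / fact k) * m k) \<longlonglongrightarrow> char M t"
    if "real_distribution M" and nn: "AE x in M. 0 \<le> x"
      and M: "\<And>n. has_bochner_integral M (\<lambda>x. x ^ n) (m n)" for M
  proof -
    interpret real_distribution M by fact
    have abs: "(\<integral>x. \<bar>x\<bar> ^ n \<partial>M) = m n" for n
    proof -
      have "(\<integral>x. \<bar>x\<bar> ^ n \<partial>M) = (\<integral>x. x ^ n \<partial>M)"
        using nn by (intro integral_cong_AE) auto
      then show ?thesis using has_bochner_integral_integral_eq[OF M[of n]] by simp
    qed
    have "(\<lambda>n. char M t - (\<Sum>k\<le>n. ((\<i> * t) ^ k / fact k) * m k)) \<longlonglongrightarrow> 0"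
    proof (rule Lim_null_comparison)
      show "\<forall>\<^sub>F n in sequentially. cmod (char M t - (\<Sum>k\<le>n. ((\<i> * t) ^ k / fact k) * m k))
          \<le> 2 * (\<bar>t\<bar> ^ n * m n / fact n)"
      proof (intro always_eventually allI)
        fix n
        have "(\<integral>x. x ^ k \<partial>M) = m k" for k
          using has_bochner_integral_integral_eq[OF M[of k]] .
        then show "cmod (char M t - (\<Sum>k\<le>n. ((\<i> * t) ^ k / fact k) * m k))
          \<le> 2 * (\<bar>t\<bar> ^ n * m n / fact n)"
          using char_approx1[of n t] M abs[of n]
          by (simp add: has_bochner_integral_iff)
      qed
      show "(\<lambda>n. 2 * (\<bar>t\<bar> ^ n * m n / fact n)) \<longlonglongrightarrow> 0"
        using tendsto_mult_right_zero[OF growth] .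
    qed
    then show ?thesis
      using tendsto_diff[OF tendsto_const[of "char M t"]] by fastforce
  qed
  show "char \<mu> t = char \<nu> t"
    using LIMSEQ_unique[OF approx[OF assms(1) nonneg(1) mu] approx[OF assms(2) nonneg(2) nu]] .
qed

subsection \<open>Integrals over ordered times\<close>

text \<open>For \<open>c > 0\<close> the integration runs over \<open>t < s\<^sub>1 < s\<^sub>2 < \<dots>\<close>, for \<open>c < 0\<close> over
  \<open>t > s\<^sub>1 > s\<^sub>2 > \<dots>\<close>.\<close>

primrec ordered_integral ::
    "real \<Rightarrow> (real \<Rightarrow> ennreal) \<Rightarrow> nat \<Rightarrow> real \<Rightarrow> ennreal" where
  "ordered_integral c f 0 t = 1"
| "ordered_integral c f (Suc n) t =
     (\<integral>\<^sup>+s. (if c * t < c * s then 1 else 0) * (f s * ordered_integral c f n s) \<partial>lborel)"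

lemma measurable_ordered_integral_param:
  assumes f: "(\<lambda>(\<omega>, s). f \<omega> s) \<in> borel_measurable (M \<Otimes>\<^sub>M borel)"
  shows "(\<lambda>(\<omega>, t). ordered_integral c (f \<omega>) n t) \<in> borel_measurable (M \<Otimes>\<^sub>M borel)"
proof (induction n)
  case (Suc n)
  note f[measurable] Suc[measurable]
  show ?case
    unfolding ordered_integral.simps by measurable
qed simp

lemma measurable_ordered_integral [measurable]:
  assumes [measurable]: "f \<in> borel_measurable borel"
  shows "ordered_integral c f n \<in> borel_measurable borel"
  by (induction n) simp_all

text \<open>A free time is inserted into a chain of \<open>n\<close> ordered ones. It comes either
  before the first of them or after it, and the second case is the same problem for the chain that
  starts at that first time. This yields \<open>n + 1\<close> positions.\<close>

lemma ordered_integral_shuffle: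
  assumes f [measurable]: "f \<in> borel_measurable borel" and c: "c \<noteq> 0"
  shows "ordered_integral c f 1 t * ordered_integral c f n t
    = of_nat (Suc n) * ordered_integral c f (Suc n) t"
proof (induction n arbitrary: t)
  case 0
  then show ?case by simp
next
  case (Suc n)
  let ?i = "\<lambda>s t. (if c * s < c * t then 1 else 0 :: ennreal)"
  let ?J = "ordered_integral c f"
  \<comment> \<open>In \<open>A\<close> the free time \<open>s\<close> precedes the first chain time
    \<open>s'\<close>, in \<open>B\<close> it follows it; ties are null sets.\<close>
  define A where "A = (\<lambda>s s'. ?i t s * f s * (?i s s' * (f s' * ?J n s')))"
  define B where "B = (\<lambda>s s'. ?i t s' * (f s' * ?J n s') * (?i s' s * f s))"
  have [measurable]: "(\<lambda>(s, s'). A s s') \<in> borel_measurable (borel \<Otimes>\<^sub>M borel)"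
    "(\<lambda>(s, s'). B s s') \<in> borel_measurable (borel \<Otimes>\<^sub>M borel)"
    unfolding A_def B_def by measurable
  have "?J 1 t * ?J (Suc n) t
      = (\<integral>\<^sup>+s. (\<integral>\<^sup>+s'. ?i t s * f s * (?i t s' * (f s' * ?J n s')) \<partial>lborel) \<partial>lborel)"
    by (simp add: nn_integral_multc nn_integral_cmult)
  also have "\<dots> = (\<integral>\<^sup>+s. (\<integral>\<^sup>+s'. A s s' + B s s' \<partial>lborel) \<partial>lborel)"
  proof (rule nn_integral_cong, rule nn_integral_cong_AE)
    fix s
    show "AE s' in lborel. ?i t s * f s * (?i t s' * (f s' * ?J n s')) = A s s' + B s s'"
      using AE_lborel_singleton[of s]
    proof eventually_elim
      case (elim s')
      then have "c * s \<noteq> c * s'" using c by simp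
      then show ?case
        by (auto simp: A_def B_def ac_simps)
    qed
  qed
  also have "\<dots> = (\<integral>\<^sup>+s. (\<integral>\<^sup>+s'. A s s' \<partial>lborel) \<partial>lborel) + (\<integral>\<^sup>+s. (\<integral>\<^sup>+s'. B s s' \<partial>lborel) \<partial>lborel)"
    by (simp add: nn_integral_add)
  also have "(\<integral>\<^sup>+s. (\<integral>\<^sup>+s'. A s s' \<partial>lborel) \<partial>lborel) = ?J (Suc (Suc n)) t"
    unfolding A_def by (simp add: nn_integral_cmult mult.assoc)
  also have "(\<integral>\<^sup>+s. (\<integral>\<^sup>+s'. B s s' \<partial>lborel) \<partial>lborel)
      = (\<integral>\<^sup>+s'. (\<integral>\<^sup>+s. B s s' \<partial>lborel) \<partial>lborel)"
    by (rule lborel_pair.Fubini') measurable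
  also have "\<dots> = (\<integral>\<^sup>+s'. ?i t s' * (f s' * (?J 1 s' * ?J n s')) \<partial>lborel)"
    unfolding B_def by (intro nn_integral_cong) (simp add: nn_integral_cmult; simp add: ac_simps)
  also have "\<dots> = of_nat (Suc n) * ?J (Suc (Suc n)) t"
  proof -
    have "(\<integral>\<^sup>+s'. ?i t s' * (f s' * (?J 1 s' * ?J n s')) \<partial>lborel)
      = (\<integral>\<^sup>+s'. of_nat (Suc n) * (?i t s' * (f s' * ?J (Suc n) s')) \<partial>lborel)"
      unfolding Suc.IH by (intro nn_integral_cong) (simp only: ac_simps)
    then show ?thesis
      by (simp add: nn_integral_cmult del: of_nat_Suc)
  qed
  finally show ?case
    by (simp add: distrib_right del: ordered_integral.simps(2))
qed

lemma ordered_integral_power: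
  assumes "f \<in> borel_measurable borel" and "c \<noteq> 0"
  shows "(\<integral>\<^sup>+s. (if c * t < c * s then 1 else 0) * f s \<partial>lborel) ^ n
    = fact n * ordered_integral c f n t"
proof (induction n)
  case (Suc n)
  have "(\<integral>\<^sup>+s. (if c * t < c * s then 1 else 0) * f s \<partial>lborel) = ordered_integral c f 1 t"
    by simp
  then show ?case
    using ordered_integral_shuffle[OF assms, of t n] Suc
    by (simp add: ac_simps del: ordered_integral.simps(2))
qed simp

subsection \<open>Processes with independent increments\<close>

text \<open>Evaluation on a grid of mesh \<open>1 / Suc k\<close> is a countable case split in the
  time variable, hence jointly measurable; right continuity carries this to the limit.\<close>

lemma borel_measurable_right_continuous_process:
  fixes X :: "real \<Rightarrow> 'a \<Rightarrow> real"
  assumes X [measurable]: "\<And>t. X t \<in> borel_measurable M"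
    and rc: "\<And>\<omega> t. \<omega> \<in> space M \<Longrightarrow> ((\<lambda>s. X s \<omega>) \<longlongrightarrow> X t \<omega>) (at_right t)"
  shows "(\<lambda>(\<omega>, t). X t \<omega>) \<in> borel_measurable (M \<Otimes>\<^sub>M borel)"
proof (rule borel_measurable_LIMSEQ_real)
  \<comment> \<open>The \<open>+ 1\<close> places the grid point strictly to the right of
    \<open>t\<close>, as the filter \<open>at_right t\<close> demands.\<close>
  let ?d = "\<lambda>k t. (of_int \<lfloor>real (Suc k) * t\<rfloor> + 1) / real (Suc k)"
  show "(\<lambda>k. (\<lambda>(\<omega>, t). X (?d k t) \<omega>) x) \<longlonglongrightarrow> (\<lambda>(\<omega>, t). X t \<omega>) x"
    if xs: "x \<in> space (M \<Otimes>\<^sub>M borel)" for x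
  proof -
    obtain \<omega> t where x: "x = (\<omega>, t)" "\<omega> \<in> space M"
      using xs by (cases x) (auto simp: space_pair_measure)
    have gt: "?d k t > t" and le: "?d k t \<le> t + 1 / of_nat (Suc k)" for k
    proof -
      have "of_nat (Suc k) * t < of_int \<lfloor>of_nat (Suc k) * t\<rfloor> + 1" by linarith
      then show "?d k t > t" by (simp add: field_simps del: of_nat_Suc)
      have "of_int \<lfloor>of_nat (Suc k) * t\<rfloor> + 1 \<le> of_nat (Suc k) * t + 1" by linarith
      then have "?d k t \<le> (of_nat (Suc k) * t + 1) / of_nat (Suc k)"
        by (intro divide_right_mono) auto
      also have "\<dots> = t + 1 / of_nat (Suc k)" by (simp add: field_simps del: of_nat_Suc)
      finally show "?d k t \<le> t + 1 / of_nat (Suc k)" .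
    qed
    have "(\<lambda>k. t + 1 / of_nat (Suc k)) \<longlonglongrightarrow> t + 0"
      by (intro tendsto_add tendsto_const LIMSEQ_inverse_real_of_nat[unfolded inverse_eq_divide])
    then have "(\<lambda>k. ?d k t) \<longlonglongrightarrow> t"
      using gt le
      by (intro tendsto_sandwich[of "\<lambda>_. t" "\<lambda>k. ?d k t" sequentially "\<lambda>k. t + 1 / of_nat (Suc k)"])
        (auto intro!: always_eventually less_imp_le simp del: of_nat_Suc)
    then have "filterlim (\<lambda>k. ?d k t) (at_right t) sequentially"
      using gt gt[THEN less_imp_neq, symmetric]
        by (auto simp: filterlim_at intro!: always_eventually simp del: of_nat_Suc)
    from filterlim_compose[OF rc[OF x(2)] this] show ?thesis by (simp add: x)
  qed
  show "(\<lambda>(\<omega>, t). X (?d k t) \<omega>) \<in> borel_measurable (M \<Otimes>\<^sub>M borel)" for k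
  proof -
    have "(\<lambda>x. X ((of_int \<lfloor>real (Suc k) * snd x\<rfloor> + 1) / of_nat (Suc k)) (fst x))
      \<in> borel_measurable (M \<Otimes>\<^sub>M borel)"
      by (rule measurable_compose_countable[where
        f="\<lambda>(i::int) x. X ((of_int i + 1) / of_nat (Suc k)) (fst x)"])
        measurable
    then show ?thesis by (simp add: case_prod_beta' del: of_nat_Suc)
  qed
qed

text \<open>Fubini needs jointly measurable paths, whereas path regularity holds only almost surely
  and for \<open>t >= 0\<close>. Setting the paths to 0 on the exceptional null set and freezing
  them before time 0 makes them right continuous everywhere.\<close>

lemma right_continuous_modification:
  fixes X :: "real \<Rightarrow> 'a \<Rightarrow> real"
  assumes X: "\<And>t. t \<ge> 0 \<Longrightarrow> X t \<in> borel_measurable M"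
    and rc: "AE \<omega> in M. \<forall>t\<ge>0. ((\<lambda>s. X s \<omega>) \<longlongrightarrow> X t \<omega>) (at_right t)"
  obtains X' where "(\<lambda>(\<omega>, t). X' t \<omega>) \<in> borel_measurable (M \<Otimes>\<^sub>M borel)"
    and "AE \<omega> in M. \<forall>t\<ge>0. X' t \<omega> = X t \<omega>"
proof -
  from rc obtain N where N: "N \<in> null_sets M"
    "{\<omega>\<in>space M. \<not> (\<forall>t\<ge>0. ((\<lambda>s. X s \<omega>) \<longlongrightarrow> X t \<omega>) (at_right t))} \<subseteq> N"
    by (auto simp: eventually_ae_filter)
  have [measurable]: "N \<in> sets M" using N by auto
  let ?X' = "\<lambda>t \<omega>. if \<omega> \<in> N then 0 else X (max 0 t) \<omega>"
  have [measurable]: "X (max 0 t) \<in> borel_measurable M" for t by (rule X) simp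
  have "(\<lambda>(\<omega>, t). ?X' t \<omega>) \<in> borel_measurable (M \<Otimes>\<^sub>M borel)"
  proof (rule borel_measurable_right_continuous_process)
    fix \<omega> t assume "\<omega> \<in> space M"
    show "((\<lambda>s. ?X' s \<omega>) \<longlongrightarrow> ?X' t \<omega>) (at_right t)"
    proof (cases "\<omega> \<in> N")
      case False
      then have *: "((\<lambda>s. X s \<omega>) \<longlongrightarrow> X t \<omega>) (at_right t)" if "t \<ge> 0" for t
        using N that \<open>\<omega> \<in> space M\<close> by blast
      have "((\<lambda>s. X (max 0 s) \<omega>) \<longlongrightarrow> X (max 0 t) \<omega>) (at_right t)"
      proof (cases "t \<ge> 0")
        case True
        have "\<forall>\<^sub>F s in at_right t. X (max 0 s) \<omega> = X s \<omega>"
          using True by (auto simp: eventually_at_filter max_def intro!: always_eventually)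
        with *[OF True] True show ?thesis
          by (simp add: tendsto_cong)
      next
        case False
        then have "\<forall>\<^sub>F s in at_right t. X (max 0 s) \<omega> = X (max 0 t) \<omega>"
          by (auto simp: eventually_at_right_field intro!: exI[of _ 0])
        then show ?thesis by (rule tendsto_eventually)
      qed
      with False show ?thesis by simp
    qed simp
  qed measurable
  moreover have "AE \<omega> in M. \<forall>t\<ge>0. ?X' t \<omega> = X t \<omega>"
    using AE_not_in[OF N(1)] by eventually_elim auto
  ultimately show ?thesis using that[of ?X'] by blast
qed

section \<open>Linear combinations of path values and their quadratic forms\<close>

definition lincomb :: "('b \<Rightarrow> real) \<Rightarrow> (real \<times> 'b) list \<Rightarrow> real" where
  "lincomb f l = (\<Sum>(c, u)\<leftarrow>l. c * f u)"

text \<open>If \<open>k\<close> is the covariance of a centred process, this is the variance of the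
  combination \<open>l\<close> of its values. A list admits repeated times, so a new time can be put
  in front without comparing it with the others.\<close>

definition quadform :: "('b \<Rightarrow> 'b \<Rightarrow> real) \<Rightarrow> (real \<times> 'b) list \<Rightarrow> real" where
  "quadform k l = (\<Sum>(c, u)\<leftarrow>l. c * lincomb (k u) l)"

lemma lincomb_simps [simp]:
  "lincomb f [] = 0" "lincomb f ((c, u) # l) = c * f u + lincomb f l"
  by (simp_all add: lincomb_def)

lemma lincomb_append [simp]: "lincomb f (l @ l') = lincomb f l + lincomb f l'"
  by (simp add: lincomb_def)

lemma lincomb_diff: "lincomb (\<lambda>u. f u - g u) l = lincomb f l - lincomb g l"
  by (induction l) (auto simp: algebra_simps)

lemma lincomb_cmult: "lincomb (\<lambda>u. c * f u) l = c * lincomb f l"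
  by (induction l) (auto simp: algebra_simps)

lemma lincomb_cong: "(\<And>x. x \<in> set l \<Longrightarrow> f (snd x) = g (snd x)) \<Longrightarrow> lincomb f l = lincomb g l"
  by (simp add: lincomb_def case_prod_beta' cong: map_cong)

lemma measurable_lincomb [measurable (raw)]:
  assumes "\<And>x. x \<in> set l \<Longrightarrow> (\<lambda>\<omega>. f (snd x) \<omega>) \<in> borel_measurable M"
  shows "(\<lambda>\<omega>. lincomb (\<lambda>u. f u \<omega>) l) \<in> borel_measurable M"
  using assms
proof (induction l)
  case (Cons a l)
  then show ?case by (cases a) (use Cons.prems[of a] in simp)
qed simp

lemma quadform_Nil [simp]: "quadform k [] = 0"
  by (simp add: quadform_def)

lemma quadform_Cons:
  assumes "\<And>u v. k u v = k v u"
  shows "quadform k ((c, u) # l) = c\<^sup>2 * k u u + 2 * c * lincomb (k u) l + quadform k l"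
proof -
  have "(\<Sum>(c', u')\<leftarrow>l'. c' * (c * k u' u + lincomb (k u') l))
      = c * lincomb (k u) l' + (\<Sum>(c', u')\<leftarrow>l'. c' * lincomb (k u') l)" for l'
    unfolding lincomb_def by (induction l') (auto simp: algebra_simps assms[of _ u])
  then show ?thesis
    by (simp add: quadform_def algebra_simps power2_eq_square)
qed

lemma lincomb_mset_cong:
  assumes "mset l = mset l'"
  shows "lincomb f l = lincomb f l'"
proof -
  have "lincomb f l = sum_mset (image_mset (\<lambda>(c, u). c * f u) (mset l))" for l
    unfolding lincomb_def by (subst mset_map[symmetric], subst sum_mset_sum_list) (rule refl)
  with assms show ?thesis by simp
qed

lemma quadform_mset_cong:
  assumes "mset l = mset l'"
  shows "quadform k l = quadform k l'"
proof -
  have "quadform k l = (\<Sum>(c, u)\<leftarrow>l. c * lincomb (k u) l')"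
    unfolding quadform_def lincomb_mset_cong[OF assms] ..
  also have "\<dots> = quadform k l'"
    unfolding quadform_def using lincomb_mset_cong[OF assms, of "\<lambda>u. lincomb (k u) l'"]
    by (simp add: lincomb_def)
  finally show ?thesis .
qed

lemma has_bochner_integral_lincomb_mult:
  assumes "\<And>c u. (c, u) \<in> set l \<Longrightarrow> has_bochner_integral M (\<lambda>x. g x * f u x) (k u)"
  shows "has_bochner_integral M (\<lambda>x. g x * lincomb (\<lambda>u. f u x) l) (lincomb k l)"
  using assms
proof (induction l)
  case (Cons a l)
  obtain c u where a: "a = (c, u)" by (cases a)
  have "has_bochner_integral M (\<lambda>x. c * (g x * f u x) + g x * lincomb (\<lambda>u. f u x) l) (c * k u
    + lincomb k l)"
    using Cons by (intro has_bochner_integral_add has_bochner_integral_mult_right) (auto simp: a)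
  then show ?case by (simp add: a algebra_simps)
qed (simp_all only: lincomb_simps quadform_Nil mult_zero_right power_zero_numeral
  has_bochner_integral_zero)

lemma has_bochner_integral_lincomb_square:
  fixes k :: "'b \<Rightarrow> 'b \<Rightarrow> real"
  assumes "\<And>c u c' v. (c, u) \<in> set l \<Longrightarrow> (c', v) \<in> set l \<Longrightarrow>
      has_bochner_integral M (\<lambda>x. f u x * f v x) (k u v)"
    and sym: "\<And>u v. k u v = k v u"
  shows "has_bochner_integral M (\<lambda>x. (lincomb (\<lambda>u. f u x) l)\<^sup>2) (quadform k l)"
  using assms(1)
proof (induction l)
  case (Cons a l)
  obtain c u where a: "a = (c, u)" by (cases a)
  have "has_bochner_integral M (\<lambda>x. c\<^sup>2 * (f u x * f u x) + 2 * c * (f u x * lincomb (\<lambda>u. f u x) l)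
      + (lincomb (\<lambda>u. f u x) l)\<^sup>2) (c\<^sup>2 * k u u + 2 * c * lincomb (k u) l + quadform k l)"
    using Cons
    by (intro has_bochner_integral_add has_bochner_integral_mult_right
      has_bochner_integral_lincomb_mult)
      (auto simp: a)
  then show ?case
    by (simp add: a quadform_Cons[OF sym] power2_eq_square algebra_simps)
qed (simp_all only: lincomb_simps quadform_Nil mult_zero_right power_zero_numeral
  has_bochner_integral_zero)

text \<open>Sorting the times in \<open>l\<close> writes the combination as a weighted sum of
  increments over disjoint intervals up to \<open>t\<close>; the increment from \<open>t\<close> to
  \<open>s\<close> is the next one on the same grid. Differences from \<open>X 0\<close> appear
  because in the applications \<open>X 0\<close> vanishes only almost surely.\<close>

lemma indep_var_increment_past:
  fixes X :: "real \<Rightarrow> 'a \<Rightarrow> real"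
  assumes X: "process M X" and indep: "indep_increments M X"
    and l: "\<And>c u. (c, u) \<in> set l \<Longrightarrow> 0 \<le> u \<and> u \<le> t" and t: "0 \<le> t" "t \<le> s"
  shows "prob_space.indep_var M borel (\<lambda>\<omega>. X s \<omega> - X t \<omega>)
    borel (\<lambda>\<omega>. lincomb (\<lambda>u. X u \<omega> - X 0 \<omega>) l)"
proof -
  interpret prob_space M using X by (simp add: process_def)
  define ts where "ts = 0 # sort (map snd l) @ [t]"
  define m where "m = length l"
  have len: "length ts = m + 2" by (simp add: ts_def m_def)
  have ts: "sorted ts" "\<And>v. v \<in> set ts \<Longrightarrow> v \<le> s"
    using l t by (fastforce simp: ts_def sorted_append)+
  \<comment> \<open>The grid is 0, the sorted times, \<open>t\<close>, and then \<open>s\<close>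
    forever: \<open>indep_increments\<close> asks for a monotone sequence on all of
    \<open>nat\<close>.\<close>
  define u where "u i = (if i < m + 2 then ts ! i else s)" for i
  have u: "u 0 = 0" "u (Suc m) = t" "u (Suc (Suc m)) = s"
    by (auto simp: u_def ts_def m_def nth_append)
  have "mono u"
  proof (rule monoI)
    fix i j :: nat assume "i \<le> j"
    then show "u i \<le> u j"
      using ts len by (auto simp: u_def intro: sorted_nth_mono ts(2))
  qed
  define D where "D i \<omega> = X (u (Suc i)) \<omega> - X (u i) \<omega>" for i \<omega>
  have D: "indep_vars (\<lambda>_. borel) D {..<m + 2}"
    using indep \<open>mono u\<close> u(1) unfolding indep_increments_def D_def by auto
  have "\<exists>k\<le>Suc m. u k = v" if "(c, v) \<in> set l" for c v
  proof -
    have "v \<in> set ts" using that by (force simp: ts_def)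
    then obtain k where "k < m + 2" "ts ! k = v"
      by (auto simp: in_set_conv_nth len)
    then show ?thesis by (auto simp: u_def intro!: exI[of _ k])
  qed
  then have "\<forall>v\<in>snd ` set l. \<exists>k. k \<le> Suc m \<and> u k = v" by auto
  from bchoice[OF this] obtain k where k: "\<And>c v. (c, v) \<in> set l \<Longrightarrow> k v \<le> Suc m \<and> u (k v) = v"
    by force
  \<comment> \<open>A point with grid index \<open>k v\<close> is the sum of the increments before
    \<open>k v\<close>, so \<open>D i\<close> is weighted by the coefficients of all points with
    index above \<open>i\<close>. The entry at \<open>Suc m\<close> belongs to the future
    increment.\<close>
  define b where "b i = (if i = Suc m then 1 else lincomb (\<lambda>v. if i < k v then 1 else 0) l)" for i
  have incr: "X v \<omega> - X 0 \<omega> = (\<Sum>i<Suc m. (if i < k v then 1 else 0) * D i \<omega>)" if "(c, v) \<in> set l"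
    for c v \<omega>
  proof -
    have "X v \<omega> - X 0 \<omega> = (\<Sum>i<k v. D i \<omega>)"
      using sum_lessThan_telescope[of "\<lambda>i. X (u i) \<omega>" "k v"] k[OF that] u(1)
      by (simp add: D_def)
    also have "\<dots> = (\<Sum>i<Suc m. (if i < k v then 1 else 0) * D i \<omega>)"
      using k[OF that] by (intro sum.mono_neutral_cong_left) auto
    finally show ?thesis .
  qed
  have past: "lincomb (\<lambda>u. X u \<omega> - X 0 \<omega>) l = (\<Sum>i<Suc m. b i * D i \<omega>)" for \<omega>
  proof -
    have "lincomb (\<lambda>u. X u \<omega> - X 0 \<omega>) l
      = lincomb (\<lambda>v. \<Sum>i<Suc m. (if i < k v then 1 else 0) * D i \<omega>) l"
      using incr by (intro lincomb_cong) (metis prod.collapse)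
    also have "\<dots> = (\<Sum>i<Suc m. lincomb (\<lambda>v. if i < k v then 1 else 0) l * D i \<omega>)"
    proof (induction l)
      case (Cons a l)
      then show ?case
        by (cases a) (simp add: sum.distrib sum_distrib_left distrib_right mult.assoc del:
          sum.lessThan_Suc)
    qed simp
    finally show ?thesis by (simp add: b_def)
  qed
  have "indep_vars (\<lambda>_. borel) (\<lambda>i \<omega>. b i * D i \<omega>) {..<m + 2}"
    using indep_vars_compose2[OF D, where Y = "\<lambda>i x. b i * x" and N = "\<lambda>_. borel"] by simp
  moreover have "{..<m + 2} = insert (Suc m) {..<Suc m}" by auto
  ultimately have "indep_var borel (\<lambda>\<omega>. b (Suc m) * D (Suc m) \<omega>) borel (\<lambda>\<omega>. \<Sum>i<Suc m. b i * D i \<omega>)"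
    by (intro indep_vars_sum) auto
  then show ?thesis
    unfolding past by (simp add: b_def D_def u del: sum.lessThan_Suc)
qed

section \<open>Characteristic function of linear combinations of Brownian values\<close>

context
  fixes M :: "'a measure" and B :: "real \<Rightarrow> 'a \<Rightarrow> real"
  assumes BM: "standard_brownian_motion M B"
begin

interpretation prob_space M
  using BM by (simp add: standard_brownian_motion_def process_def)

lemma brownian_measurable: "t \<ge> 0 \<Longrightarrow> B t \<in> borel_measurable M"
  using BM by (simp add: standard_brownian_motion_def process_def)

lemma char_brownian_increment:
  assumes "0 \<le> t" "t \<le> s"
  shows "char (distr M borel (\<lambda>\<omega>. B s \<omega> - B t \<omega>)) c = exp (- c\<^sup>2 * (s - t) / 2)"
\<comment> \<open>The normal law of an increment is given for distinct times only; for equal times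
  the increment is 0.\<close>
proof (cases "t = s")
  case True
  have "char (distr M borel (\<lambda>\<omega>. 0)) c = 1"
    by (simp add: char_def integral_distr prob_space del: distr_const)
  with True show ?thesis by simp
next
  case False
  with assms have st: "t < s" by simp
  have "distributed M lborel (\<lambda>\<omega>. B s \<omega> - B t \<omega>) (normal_density 0 (sqrt (s - t)))"
    using BM assms st by (simp add: standard_brownian_motion_def)
  then have "distributed M lborel (\<lambda>\<omega>. (B s \<omega> - B t \<omega>) / sqrt (s - t)) std_normal_density"
    using st by (subst (asm) normal_standard_normal_convert) simp_all
  then have d: "distr M lborel (\<lambda>\<omega>. (B s \<omega> - B t \<omega>) / sqrt (s - t)) = std_normal_distribution"
    by (simp add: distributed_def)
  have [measurable]: "B s \<in> borel_measurable M" "B t \<in> borel_measurable M"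
    using assms by (auto intro: brownian_measurable)
  have "char (distr M borel (\<lambda>\<omega>. B s \<omega> - B t \<omega>)) c
      = char (distr M lborel (\<lambda>\<omega>. (B s \<omega> - B t \<omega>) / sqrt (s - t))) (c * sqrt (s - t))"
    using st by (simp add: char_def integral_distr)
  also have "\<dots> = exp (- (c * sqrt (s - t))\<^sup>2 / 2)"
    unfolding d char_std_normal_distribution ..
  finally show ?thesis using st by (simp add: power_mult_distrib)
qed

text \<open>Since \<open>B s\<close> is \<open>B t\<close> plus an increment independent of the
  values up to \<open>t\<close>, lowering the largest time from \<open>s\<close> to \<open>t\<close>
  costs exactly the characteristic function of that increment.\<close>

lemma brownian_fourier_step:
  assumes l: "\<And>c u. (c, u) \<in> set l \<Longrightarrow> 0 \<le> u \<and> u \<le> t" and t: "0 \<le> t" "t \<le> s"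
  shows "(CLINT \<omega>|M. iexp (lincomb (\<lambda>u. B u \<omega>) ((c, s) # l)))
    = complex_of_real (exp (- c\<^sup>2 * (s - t) / 2))
      * (CLINT \<omega>|M. iexp (lincomb (\<lambda>u. B u \<omega>) ((c, t) # l)))"
proof -
  have B0: "AE \<omega> in M. B 0 \<omega> = 0"
    using BM by (simp add: standard_brownian_motion_def)
  let ?l = "(c, t) # l"
  have [measurable]: "B s \<in> borel_measurable M" "B t \<in> borel_measurable M" "B 0
    \<in> borel_measurable M"
    using t by (auto intro: brownian_measurable)
  have ml [measurable]: "(\<lambda>\<omega>. lincomb (\<lambda>u. B u \<omega>) l) \<in> borel_measurable M"
    "(\<lambda>\<omega>. lincomb (\<lambda>u. B u \<omega> - B 0 \<omega>) l) \<in> borel_measurable M"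
    using l by (auto intro!: measurable_lincomb borel_measurable_diff brownian_measurable)
  have "indep_var borel (\<lambda>\<omega>. B s \<omega> - B t \<omega>) borel (\<lambda>\<omega>. lincomb (\<lambda>u. B u \<omega> - B 0 \<omega>) ?l)"
    using l t BM by (intro indep_var_increment_past) (auto simp: standard_brownian_motion_def)
  then have "indep_var borel ((\<lambda>x. c * x) \<circ> (\<lambda>\<omega>. B s \<omega>
    - B t \<omega>)) borel ((\<lambda>x. x) \<circ> (\<lambda>\<omega>. lincomb (\<lambda>u. B u \<omega> - B 0 \<omega>) ?l))"
    by (rule indep_var_compose) auto
  then have "indep_var borel (\<lambda>\<omega>. c * (B s \<omega> - B t \<omega>)) borel (\<lambda>\<omega>. lincomb (\<lambda>u. B u \<omega> - B 0 \<omega>) ?l)"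
    by (simp add: comp_def)
  from char_distr_add[OF this, of 1]
  have "(CLINT \<omega>|M. iexp (c * (B s \<omega> - B t \<omega>) + lincomb (\<lambda>u. B u \<omega> - B 0 \<omega>) ?l))
      = (CLINT \<omega>|M. iexp (c * (B s \<omega> - B t \<omega>)))
        * (CLINT \<omega>|M. iexp (lincomb (\<lambda>u. B u \<omega> - B 0 \<omega>) ?l))"
    by (simp add: char_def integral_distr)
  also have "(CLINT \<omega>|M. iexp (c * (B s \<omega> - B t \<omega>))) = exp (- c\<^sup>2 * (s - t) / 2)"
    using char_brownian_increment[OF t, of c] by (simp add: char_def integral_distr)
  also have "(CLINT \<omega>|M. iexp (lincomb (\<lambda>u. B u \<omega> - B 0 \<omega>) ?l))
    = (CLINT \<omega>|M. iexp (lincomb (\<lambda>u. B u \<omega>) ?l))"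
    using B0 by (intro integral_cong_AE) auto
  also have "(CLINT \<omega>|M. iexp (c * (B s \<omega> - B t \<omega>) + lincomb (\<lambda>u. B u \<omega> - B 0 \<omega>) ?l))
      = (CLINT \<omega>|M. iexp (lincomb (\<lambda>u. B u \<omega>) ((c, s) # l)))"
    using B0 by (intro integral_cong_AE) (auto simp: algebra_simps)
  finally show ?thesis .
qed

text \<open>The largest time is lowered to the second largest and the two coefficients are merged,
  which shortens the list. The variance changes in step, because \<open>min s u = min t u\<close>
  for every remaining \<open>u <= t\<close>.\<close>

lemma brownian_fourier_sorted:
  assumes "\<And>c u. (c, u) \<in> set l \<Longrightarrow> 0 \<le> u" "sorted_wrt (\<lambda>x y. snd y \<le> snd x) l"
  shows "(CLINT \<omega>|M. iexp (lincomb (\<lambda>u. B u \<omega>) l)) = exp (- quadform min l / 2)"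
  using assms
proof (induction l rule: length_induct)
  case (1 l)
  have sym: "min u v = min v (u::real)" for u v by simp
  consider "l = []" | c s where "l = [(c, s)]" | c s c' t l' where "l = (c, s) # (c', t) # l'"
    by (cases l rule: remdups_adj.cases) force+
  then show ?case
  proof cases
    case 1
    then show ?thesis by (simp add: prob_space)
  next
    case (2 c s)
    have "AE \<omega> in M. B 0 \<omega> = 0"
      using BM by (simp add: standard_brownian_motion_def)
    moreover have [measurable]: "B 0 \<in> borel_measurable M"
      by (simp add: brownian_measurable)
    ultimately have "(CLINT \<omega>|M. iexp (c * B 0 \<omega>)) = (CLINT \<omega>|M. 1)"
      by (intro integral_cong_AE) auto
    then show ?thesis
      using brownian_fourier_step[of "[]" 0 s c] "1.prems"
      by (simp add: 2 quadform_Cons[OF sym] prob_space flip: exp_of_real)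
  next
    case (3 c s c' t l')
    let ?l = "(c + c', t) # l'"
    have t: "0 \<le> t" "t \<le> s" and l': "\<And>d u. (d, u) \<in> set l' \<Longrightarrow> 0 \<le> u \<and> u \<le> t"
      using "1.prems" by (fastforce simp: 3)+
    have "(CLINT \<omega>|M. iexp (lincomb (\<lambda>u. B u \<omega>) ?l)) = exp (- quadform min ?l / 2)"
      using "1.IH"[rule_format, of ?l] "1.prems" by (auto simp: 3)
    moreover have "(CLINT \<omega>|M. iexp (lincomb (\<lambda>u. B u \<omega>) l))
        = complex_of_real (exp (- c\<^sup>2 * (s - t) / 2)) * (CLINT \<omega>|M. iexp (lincomb (\<lambda>u. B u \<omega>) ?l))"
      using brownian_fourier_step[of "(c', t) # l'" t s c] t l' by (auto simp: 3 algebra_simps)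
    moreover have "lincomb (min s) l' = lincomb (min t) l'"
      using l' t by (intro lincomb_cong) fastforce
    then have "quadform min l = c\<^sup>2 * (s - t) + quadform min ?l"
      using t by (simp add: 3 quadform_Cons[OF sym] algebra_simps power2_eq_square)
    ultimately show ?thesis
      by (simp add: exp_add[symmetric] field_simps flip: of_real_mult)
  qed
qed

lemma brownian_fourier:
  assumes "\<And>c u. (c, u) \<in> set l \<Longrightarrow> 0 \<le> u"
  shows "(CLINT \<omega>|M. iexp (lincomb (\<lambda>u. B u \<omega>) l)) = exp (- quadform min l / 2)"
proof -
  let ?l = "rev (sort_key snd l)"
  have m: "mset ?l = mset l" by simp
  have "sorted_wrt (\<lambda>x y. snd y \<le> snd x) ?l"
    using sorted_sort_key[of snd l] by (simp add: sorted_wrt_rev sorted_map)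
  then have "(CLINT \<omega>|M. iexp (lincomb (\<lambda>u. B u \<omega>) ?l)) = exp (- quadform min ?l / 2)"
    using assms by (intro brownian_fourier_sorted) auto
  then show ?thesis
    by (simp only: quadform_mset_cong[OF m] lincomb_mset_cong[OF m])
qed

end

subsection \<open>Fourier transform of noise reinforced Brownian motion\<close>

lemma cmod_iexp_diff_le: "cmod (iexp x - iexp y) \<le> \<bar>x - y\<bar>"
proof -
  have "iexp x - iexp y = iexp y * (iexp (x - y) - 1)"
    by (simp add: algebra_simps flip: exp_add)
  then have "cmod (iexp x - iexp y) = cmod (iexp (x - y) - 1)"
    by (simp add: norm_mult)
  also have "\<dots> \<le> \<bar>x - y\<bar>"
    using iexp_approx1[of "x - y" 0] by simp
  finally show ?thesis .
qed

lemma Cauchy_Schwarz_integral: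
  fixes f g :: "'a \<Rightarrow> real"
  assumes [measurable]: "f \<in> borel_measurable M" "g \<in> borel_measurable M"
    and f: "integrable M (\<lambda>x. (f x)\<^sup>2)" and g: "integrable M (\<lambda>x. (g x)\<^sup>2)"
  shows "integrable M (\<lambda>x. f x * g x)"
    and "(\<integral>x. \<bar>f x * g x\<bar> \<partial>M)\<^sup>2 \<le> (\<integral>x. (f x)\<^sup>2 \<partial>M) * (\<integral>x. (g x)\<^sup>2 \<partial>M)"
proof -
  show int: "integrable M (\<lambda>x. f x * g x)"
  proof (rule Bochner_Integration.integrable_bound)
    show "integrable M (\<lambda>x. (f x)\<^sup>2 + (g x)\<^sup>2)" using f g by simp
    have "\<bar>f x * g x\<bar> \<le> (f x)\<^sup>2 + (g x)\<^sup>2" for x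
      using sum_squares_bound[of "\<bar>f x\<bar>" "\<bar>g x\<bar>"]
        mult_nonneg_nonneg[OF abs_ge_zero abs_ge_zero, of "f x" "g x"]
      unfolding abs_mult power2_abs mult.assoc by linarith
    then show "AE x in M. norm (f x * g x) \<le> norm ((f x)\<^sup>2 + (g x)\<^sup>2)"
      by (intro AE_I2) simp
  qed measurable
  have "(\<integral>\<^sup>+x. ennreal \<bar>f x\<bar> * ennreal \<bar>g x\<bar> \<partial>M)\<^sup>2
      \<le> (\<integral>\<^sup>+x. (ennreal \<bar>f x\<bar>)\<^sup>2 \<partial>M) * (\<integral>\<^sup>+x. (ennreal \<bar>g x\<bar>)\<^sup>2 \<partial>M)"
    by (intro Cauchy_Schwarz_nn_integral) measurable
  moreover have "(\<integral>\<^sup>+x. ennreal \<bar>f x\<bar> * ennreal \<bar>g x\<bar> \<partial>M) = ennreal (\<integral>x. \<bar>f x * g x\<bar> \<partial>M)"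
    using integrable_abs[OF int]
      by (subst nn_integral_eq_integral[symmetric]) (auto simp: abs_mult ennreal_mult)
  moreover have "(\<integral>\<^sup>+x. (ennreal \<bar>h x\<bar>)\<^sup>2 \<partial>M) = ennreal (\<integral>x. (h x)\<^sup>2 \<partial>M)"
    if "integrable M (\<lambda>x. (h x)\<^sup>2)" for h :: "'a \<Rightarrow> real"
    using that by (subst nn_integral_eq_integral[symmetric]) (auto simp: ennreal_power)
  ultimately show "(\<integral>x. \<bar>f x * g x\<bar> \<partial>M)\<^sup>2 \<le> (\<integral>x. (f x)\<^sup>2 \<partial>M) * (\<integral>x. (g x)\<^sup>2 \<partial>M)"
    using f g by (simp add: ennreal_power flip: ennreal_mult)
qed

text \<open>With \<open>D = F k - f\<close> and L2 norms, the two square integrals differ by at most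
  \<open>||D||^2 + 2 ||D|| ||f||\<close>.\<close>

lemma tendsto_integral_square:
  fixes F :: "nat \<Rightarrow> 'a \<Rightarrow> real"
  assumes [measurable]: "\<And>k. F k \<in> borel_measurable M" "f \<in> borel_measurable M"
    and F: "\<And>k. integrable M (\<lambda>x. (F k x)\<^sup>2)" and f: "integrable M (\<lambda>x. (f x)\<^sup>2)"
    and lim: "(\<lambda>k. \<integral>\<^sup>+x. ennreal ((F k x - f x)\<^sup>2) \<partial>M) \<longlonglongrightarrow> 0"
  shows "(\<lambda>k. \<integral>x. (F k x)\<^sup>2 \<partial>M) \<longlonglongrightarrow> (\<integral>x. (f x)\<^sup>2 \<partial>M)"
proof -
  define D where "D k x = F k x - f x" for k x
  have [measurable]: "D k \<in> borel_measurable M" for k unfolding D_def by measurable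
  have D: "integrable M (\<lambda>x. (D k x)\<^sup>2)" for k
    using F[of k] f Cauchy_Schwarz_integral(1)[of "F k" M f]
      by (simp add: D_def power2_diff mult.assoc)
  define a where "a k = (\<integral>x. (D k x)\<^sup>2 \<partial>M)" for k
  define b where "b = (\<integral>x. (f x)\<^sup>2 \<partial>M)"
  have nonneg: "0 \<le> a k" "0 \<le> b" for k by (simp_all add: a_def b_def)
  have "(\<integral>\<^sup>+x. ennreal ((F k x - f x)\<^sup>2) \<partial>M) = ennreal (a k)" for k
    using D[of k] unfolding a_def D_def by (intro nn_integral_eq_integral) auto
  then have "(\<lambda>k. ennreal (a k)) \<longlonglongrightarrow> ennreal 0"
    using lim by simp
  then have a: "a \<longlonglongrightarrow> 0"
    using nonneg by (subst (asm) tendsto_ennreal_iff) auto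
  have "\<bar>(\<integral>x. (F k x)\<^sup>2 \<partial>M) - b\<bar> \<le> a k + 2 * sqrt (a k * b)" for k
  proof -
    have int: "integrable M (\<lambda>x. D k x * f x)"
      using D f by (intro Cauchy_Schwarz_integral(1)) auto
    have "(\<integral>x. (F k x)\<^sup>2 \<partial>M) = (\<integral>x. (D k x)\<^sup>2 + 2 * (D k x * f x) + (f x)\<^sup>2 \<partial>M)"
      by (intro Bochner_Integration.integral_cong) (auto simp: D_def power2_eq_square algebra_simps)
    also have "\<dots> = a k + 2 * (\<integral>x. D k x * f x \<partial>M) + b"
      using D[of k] f int by (simp add: a_def b_def)
    finally have "\<bar>(\<integral>x. (F k x)\<^sup>2 \<partial>M) - b\<bar> \<le> a k + 2 * \<bar>\<integral>x. D k x * f x \<partial>M\<bar>"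
      using nonneg(1)[of k] by simp
    also have "\<bar>\<integral>x. D k x * f x \<partial>M\<bar> \<le> (\<integral>x. \<bar>D k x * f x\<bar> \<partial>M)"
      by (rule integral_abs_bound)
    also have "\<dots> \<le> sqrt (a k * b)"
      using Cauchy_Schwarz_integral(2)[OF _ _ D[of k] f]
      by (intro real_le_rsqrt) (simp add: a_def b_def)
    finally show ?thesis by simp
  qed
  moreover have "(\<lambda>k. a k + 2 * sqrt (a k * b)) \<longlonglongrightarrow> 0 + 2 * sqrt (0 * b)"
    by (intro tendsto_intros a)
  then have g: "(\<lambda>k. a k + 2 * sqrt (a k * b)) \<longlonglongrightarrow> 0" by simp
  ultimately have "(\<lambda>k. (\<integral>x. (F k x)\<^sup>2 \<partial>M) - b) \<longlonglongrightarrow> 0"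
    by (intro Lim_null_comparison[OF _ g] always_eventually) simp
  then show ?thesis
    unfolding b_def by (rule LIM_zero_cancel)
qed

text \<open>Cauchy-Schwarz against the constant 1, whose square integral is the total mass
  1.\<close>

lemma tendsto_nn_integral_abs_of_square:
  fixes d :: "nat \<Rightarrow> 'a \<Rightarrow> real"
  assumes "prob_space M" and [measurable]: "\<And>k. d k \<in> borel_measurable M"
    and lim: "(\<lambda>k. \<integral>\<^sup>+\<omega>. ennreal ((d k \<omega>)\<^sup>2) \<partial>M) \<longlonglongrightarrow> 0"
  shows "(\<lambda>k. \<integral>\<^sup>+\<omega>. ennreal \<bar>d k \<omega>\<bar> \<partial>M) \<longlonglongrightarrow> 0"
proof -
  interpret prob_space M by fact
  let ?a = "\<lambda>k. \<integral>\<^sup>+\<omega>. ennreal \<bar>d k \<omega>\<bar> \<partial>M" and ?b = "\<lambda>k. \<integral>\<^sup>+\<omega>. ennreal ((d k \<omega>)\<^sup>2) \<partial>M"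
  have ab: "(?a k)\<^sup>2 \<le> ?b k" for k
  proof -
    have "(\<integral>\<^sup>+\<omega>. ennreal \<bar>d k \<omega>\<bar> * 1 \<partial>M)\<^sup>2
        \<le> (\<integral>\<^sup>+\<omega>. (ennreal \<bar>d k \<omega>\<bar>)\<^sup>2 \<partial>M) * (\<integral>\<^sup>+\<omega>. 1\<^sup>2 \<partial>M)"
      by (intro Cauchy_Schwarz_nn_integral) measurable
    then show ?thesis
      by (simp add: emeasure_space_1 ennreal_power)
  qed
  show ?thesis
  proof (rule order_tendstoI)
    fix e :: ennreal assume "0 < e"
    have "\<forall>\<^sub>F k in sequentially. ?b k < e\<^sup>2"
      using \<open>0 < e\<close> lim by (intro order_tendstoD)
        (auto simp: power2_eq_square ennreal_zero_less_mult_iff)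
    then show "\<forall>\<^sub>F k in sequentially. ?a k < e"
    proof eventually_elim
      case (elim k)
      show ?case
      proof (rule ccontr)
        assume "\<not> ?a k < e"
        then have "e\<^sup>2 \<le> (?a k)\<^sup>2" by (intro power_mono) auto
        with ab[of k] elim show False by (meson leD order_trans)
      qed
    qed
  qed simp
qed

lemma tendsto_nn_integral_lincomb_square:
  fixes d :: "nat \<Rightarrow> 'b \<Rightarrow> 'a \<Rightarrow> real"
  assumes "\<And>k x. x \<in> set l \<Longrightarrow> d k (snd x) \<in> borel_measurable M"
    and "\<And>x. x \<in> set l \<Longrightarrow> (\<lambda>k. \<integral>\<^sup>+\<omega>. ennreal ((d k (snd x) \<omega>)\<^sup>2) \<partial>M) \<longlonglongrightarrow> 0"
  shows "(\<lambda>k. \<integral>\<^sup>+\<omega>. ennreal ((lincomb (\<lambda>u. d k u \<omega>) l)\<^sup>2) \<partial>M) \<longlonglongrightarrow> 0"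
  using assms
proof (induction l)
  case (Cons a l)
  obtain z u where a: "a = (z, u)" by (cases a)
  have [measurable]: "d k u \<in> borel_measurable M" for k
    using Cons.prems(1)[of a] by (simp add: a)
  have [measurable]: "(\<lambda>\<omega>. lincomb (\<lambda>u. d k u \<omega>) l) \<in> borel_measurable M" for k
    using Cons.prems(1) by (intro measurable_lincomb) auto
  let ?L = "\<lambda>k \<omega>. lincomb (\<lambda>u. d k u \<omega>) l"
  have sq: "(z * d k u \<omega> + ?L k \<omega>)\<^sup>2 \<le> 2 * z\<^sup>2 * (d k u \<omega>)\<^sup>2 + 2 * (?L k \<omega>)\<^sup>2" for k \<omega>
    using zero_le_power2[of "z * d k u \<omega> - ?L k \<omega>"] by (simp add: power2_eq_square algebra_simps)
  have le: "(\<integral>\<^sup>+\<omega>. ennreal ((lincomb (\<lambda>u. d k u \<omega>) (a # l))\<^sup>2) \<partial>M)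
      \<le> (\<integral>\<^sup>+\<omega>. ennreal (2 * z\<^sup>2) * ennreal ((d k u \<omega>)\<^sup>2) + ennreal 2
        * ennreal ((?L k \<omega>)\<^sup>2) \<partial>M)" for k
  proof (intro nn_integral_mono)
    fix \<omega>
    have eq: "ennreal (2 * z\<^sup>2) * ennreal ((d k u \<omega>)\<^sup>2) + ennreal 2 * ennreal ((?L k \<omega>)\<^sup>2)
        = ennreal (2 * z\<^sup>2 * (d k u \<omega>)\<^sup>2 + 2 * (?L k \<omega>)\<^sup>2)"
      by (subst ennreal_plus) (simp_all only: ennreal_mult zero_le_power2 mult_nonneg_nonneg
        zero_le_numeral)
    show "ennreal ((lincomb (\<lambda>u. d k u \<omega>) (a # l))\<^sup>2)
        \<le> ennreal (2 * z\<^sup>2) * ennreal ((d k u \<omega>)\<^sup>2) + ennreal 2 * ennreal ((?L k \<omega>)\<^sup>2)"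
      unfolding eq a lincomb_simps by (intro ennreal_leI sq)
  qed
  have "(\<lambda>k. ennreal (2 * z\<^sup>2) * (\<integral>\<^sup>+\<omega>. ennreal ((d k u \<omega>)\<^sup>2) \<partial>M) + ennreal 2
    * (\<integral>\<^sup>+\<omega>. ennreal ((?L k \<omega>)\<^sup>2) \<partial>M))
      \<longlonglongrightarrow> ennreal (2 * z\<^sup>2) * 0 + ennreal 2 * 0"
    using Cons.IH Cons.prems Cons.prems(2)[of a]
    by (intro tendsto_add tendsto_mult_ennreal tendsto_const) (auto simp: a)
  then have lim: "(\<lambda>k. \<integral>\<^sup>+\<omega>. ennreal (2 * z\<^sup>2) * ennreal ((d k u \<omega>)\<^sup>2) + ennreal 2
    * ennreal ((?L k \<omega>)\<^sup>2) \<partial>M)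
      \<longlonglongrightarrow> 0"
    by (simp add: nn_integral_add nn_integral_cmult)
  show ?case
    by (rule tendsto_sandwich[OF _ always_eventually[OF allI[OF le]] tendsto_const lim]) simp
qed simp

text \<open>The step integral and the step function are the same linear combination, of the values
  \<open>B v\<close> and of the indicators of \<open>(0, v]\<close> respectively.\<close>

definition step_points :: "nat \<Rightarrow> (nat \<Rightarrow> real) \<Rightarrow> (nat \<Rightarrow> real) \<Rightarrow> (real \<times> real) list" where
  "step_points n u c = concat (map (\<lambda>i. [(c i, u (Suc i)), (- c i, u i)]) [0..<n])"

lemma lincomb_step_points:
  "lincomb f (step_points n u c) = (\<Sum>i<n. c i * (f (u (Suc i)) - f (u i)))"
  by (induction n) (simp_all add: step_points_def algebra_simps)

lemma step_integral_eq_lincomb: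
  "step_integral B n u c \<omega> = lincomb (\<lambda>v. B v \<omega>) (step_points n u c)"
  by (simp add: step_integral_def lincomb_step_points)

lemma step_fun_eq_lincomb:
  assumes "0 \<le> u 0" "mono u"
  shows "step_fun n u c s = lincomb (\<lambda>v. indicator {0<..v} s) (step_points n u c)"
proof -
  have u: "0 \<le> u i" "u i \<le> u (Suc i)" for i
    using assms monoD[OF assms(2), of 0 i] monoD[OF assms(2), of i "Suc i"] by simp_all
  have "indicator {u i<..u (Suc i)} s
    = (indicator {0<..u (Suc i)} s - indicator {0<..u i} s :: real)" for i
    using u[of i] by (auto simp: indicator_def)
  then show ?thesis
    by (simp add: step_fun_def lincomb_step_points)
qed

lemma step_points_nonneg:
  assumes "0 \<le> u 0" "mono u" "x \<in> set (step_points n u c)"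
  shows "0 \<le> snd x"
  using assms monoD[OF assms(2), of 0] by (auto simp: step_points_def intro: order_trans)

text \<open>Turns a combination of values of the noise reinforced process into one of values of
  \<open>B\<close>: \<open>w u\<close> will be \<open>u powr p\<close>, and \<open>L u\<close> the
  step points that approximate the Wiener integral up to \<open>u\<close>.\<close>

definition substitute_points ::
    "('b \<Rightarrow> real) \<Rightarrow> ('b \<Rightarrow> (real \<times> 'c) list) \<Rightarrow> (real \<times> 'b) list \<Rightarrow> (real \<times> 'c) list" where
  "substitute_points w L l = concat (map (\<lambda>(z, u). map (\<lambda>(c, v). (z * w u * c, v)) (L u)) l)"

lemma lincomb_substitute_points:
  "lincomb f (substitute_points w L l) = lincomb (\<lambda>u. w u * lincomb f (L u)) l"
proof (induction l)
  case (Cons a l)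
  have "lincomb f (map (\<lambda>(c, v). (z * (y * c), v)) m) = z * (y * lincomb f m)" for z y m
    by (induction m) (auto simp: algebra_simps)
  with Cons show ?case
    by (cases a) (simp add: substitute_points_def mult.assoc)
qed (simp add: substitute_points_def)

text \<open>The covariance of noise reinforced Brownian motion: by the isometry, the Wiener
  integrals up to \<open>u\<close> and \<open>v\<close> have as covariance the integral of
  \<open>r powr (- 2 * p)\<close> over \<open>{0..min u v}\<close>.\<close>

definition nrbm_cov :: "real \<Rightarrow> real \<Rightarrow> real \<Rightarrow> real" where
  "nrbm_cov p u v = (u * v) powr p * (min u v powr (1 - 2 * p) / (1 - 2 * p))"

lemma nrbm_cov_sym: "nrbm_cov p u v = nrbm_cov p v u"
  by (simp add: nrbm_cov_def mult.commute min.commute)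

lemma has_bochner_integral_powr_initial:
  fixes p :: real
  assumes "p < 1 / 2" "m > 0"
  shows "has_bochner_integral lborel (\<lambda>s. indicator {0..m} s
    * s powr (- (2 * p))) (m powr (1 - 2 * p) / (1 - 2 * p))"
proof (rule has_bochner_integral_nn_integral)
  have "((\<lambda>s. s powr (- (2 * p))) has_integral (m powr (- (2 * p) + 1) / (- (2 * p) + 1))) {0..m}"
    using assms by (intro has_integral_powr_from_0) auto
  from nn_integral_has_integral_lebesgue[OF _ this]
  show "(\<integral>\<^sup>+s. ennreal (indicator {0..m} s * s powr (- (2 * p))) \<partial>lborel)
    = ennreal (m powr (1 - 2 * p) / (1 - 2 * p))"
    by (simp add: algebra_simps)
qed (use assms in auto)

text \<open>The same coefficients \<open>A k\<close> are read in two spaces. As combinations of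
  values of \<open>B\<close> they converge in mean square to the combination of values of
  \<open>Bh\<close>, which gives the left side; as combinations of indicators they converge in mean
  square to \<open>f\<close>, which gives the variance. The readings match because the indicators of
  \<open>(0, v]\<close> and \<open>(0, v']\<close> have inner product
  \<open>min v v'\<close>.\<close>

lemma nrbm_fourier:
  fixes M :: "'a measure"
  assumes BM: "standard_brownian_motion M B" and Bh: "noise_reinforced_brownian_motion M B p Bh"
    and p: "p < 1 / 2" and l: "\<And>x. x \<in> set l \<Longrightarrow> 0 < snd x"
  shows "(CLINT \<omega>|M. iexp (lincomb (\<lambda>u. Bh u \<omega>) l)) = exp (- quadform (nrbm_cov p) l / 2)"
proof -
  interpret prob_space M
    using BM by (simp add: standard_brownian_motion_def process_def)
  have B_meas: "B v \<in> borel_measurable M" if "v \<ge> 0" for v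
    using BM that by (simp add: standard_brownian_motion_def process_def)
  have Bh_meas: "Bh v \<in> borel_measurable M" if "v \<ge> 0" for v
    using Bh that by (simp add: noise_reinforced_brownian_motion_def process_def)
  \<comment> \<open>One tuple per time, so that the approximating sequences can be chosen for all
    times at once.\<close>
  define W where "W t x \<longleftrightarrow> (case x of (J, n, u, c) \<Rightarrow> J \<in> borel_measurable M \<and>
      (AE \<omega> in M. Bh t \<omega> = t powr p * J \<omega>) \<and>
      (\<forall>k. 0 \<le> u k 0 \<and> mono (u k) \<and> u k (n k) \<le> t) \<and>
      (\<lambda>k. \<integral>\<^sup>+s\<in>{0..t}. ennreal ((s powr (- p) - step_fun (n k) (u k) (c k) s)\<^sup>2) \<partial>lborel) \<longlonglongrightarrow> 0 \<and>
      (\<lambda>k. \<integral>\<^sup>+\<omega>. ennreal ((J \<omega> - step_integral B (n k) (u k) (c k) \<omega>)\<^sup>2) \<partial>M) \<longlonglongrightarrow> 0)" for t x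
  have "\<forall>t. \<exists>x. 0 < t \<longrightarrow> W t x"
  proof
    fix t
    show "\<exists>x. 0 < t \<longrightarrow> W t x"
    proof (cases "0 < t")
      case True
      then obtain J where "has_wiener_integral M B (\<lambda>s. s powr (- p)) t J"
        and AE: "AE \<omega> in M. Bh t \<omega> = t powr p * J \<omega>"
        using Bh unfolding noise_reinforced_brownian_motion_def by blast
      then obtain n u c where "W t (J, n, u, c)"
        unfolding W_def has_wiener_integral_def by (simp only: prod.case) blast
      then show ?thesis by blast
    qed blast
  qed
  from choice[OF this] obtain w where w: "\<And>t. 0 < t \<Longrightarrow> W t (w t)" by blast
  define J where "J t = fst (w t)" for t
  define n where "n t = fst (snd (w t))" for t
  define u where "u t = fst (snd (snd (w t)))" for t
  define c where "c t = snd (snd (snd (w t)))" for t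
  have W: "W t (J t, n t, u t, c t)" if "0 < t" for t
    using w[OF that] by (simp add: J_def n_def u_def c_def)
  define L where "L k t = step_points (n t k) (u t k) (c t k)" for k t
  define A where "A k = substitute_points (\<lambda>t. t powr p) (L k) l" for k
  have J: "J t \<in> borel_measurable M" "AE \<omega> in M. Bh t \<omega> = t powr p * J t \<omega>" if "0 < t" for t
    using W[OF that] by (simp_all add: W_def)
  have grid: "0 \<le> u t k 0" "mono (u t k)" "u t k (n t k) \<le> t" if "0 < t" for t k
    using W[OF that] by (simp_all add: W_def)
  have L_pos: "0 \<le> snd x" if "x \<in> set (L k t)" "0 < t" for k t x
    using that grid[of t k] unfolding L_def by (intro step_points_nonneg)
  have A_pos: "0 \<le> snd x" if "x \<in> set (A k)" for k x
    using that l by (fastforce simp: A_def substitute_points_def dest: L_pos)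
  define X where "X k \<omega> = lincomb (\<lambda>v. B v \<omega>) (A k)" for k \<omega>
  define Xh where "Xh \<omega> = lincomb (\<lambda>v. Bh v \<omega>) l" for \<omega>
  have [measurable]: "X k \<in> borel_measurable M" for k
    unfolding X_def using A_pos by (intro measurable_lincomb B_meas)
  have [measurable]: "Xh \<in> borel_measurable M"
    unfolding Xh_def using l by (intro measurable_lincomb Bh_meas) force
  define F where "F k s = lincomb (\<lambda>v. indicator {0<..v} s) (A k)" for k and s :: real
  define f where "f s = lincomb (\<lambda>t. t powr p * (s powr (- p) * indicator {0..t} s)) l"
    for s :: real
  have [measurable]: "F k \<in> borel_measurable borel" "f \<in> borel_measurable borel" for k
    unfolding F_def f_def by (auto intro!: measurable_lincomb)

  have "(\<lambda>k. \<integral>\<^sup>+\<omega>. ennreal ((X k \<omega> - Xh \<omega>)\<^sup>2) \<partial>M) \<longlonglongrightarrow> 0"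
  proof -
    let ?d = "\<lambda>k t \<omega>. t powr p * (lincomb (\<lambda>v. B v \<omega>) (L k t) - J t \<omega>)"
    have meas: "?d k t \<in> borel_measurable M" if "0 < t" for k t
      using that L_pos[of _ k t] J(1)[of t]
      by (intro borel_measurable_times borel_measurable_diff measurable_lincomb B_meas) auto
    have "(\<lambda>k. \<integral>\<^sup>+\<omega>. ennreal ((lincomb (\<lambda>t. ?d k t \<omega>) l)\<^sup>2) \<partial>M) \<longlonglongrightarrow> 0"
    proof (rule tendsto_nn_integral_lincomb_square)
      fix x assume "x \<in> set l"
      then have t: "0 < snd x" by (rule l)
      let ?t = "snd x"
      let ?e = "\<lambda>k. \<integral>\<^sup>+\<omega>. ennreal ((J ?t \<omega> - step_integral B (n ?t k) (u ?t k) (c ?t k) \<omega>)\<^sup>2) \<partial>M"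
      show "?d k ?t \<in> borel_measurable M" for k using meas[OF t] .
      have "(\<integral>\<^sup>+\<omega>. ennreal ((?d k ?t \<omega>)\<^sup>2) \<partial>M)
          = ennreal ((?t powr p)\<^sup>2) * ?e k" for k
      proof -
        have [measurable]: "(\<lambda>\<omega>. lincomb (\<lambda>v. B v \<omega>) (step_points (n ?t k) (u ?t k) (c ?t k)))
          \<in> borel_measurable M"
          using L_pos[OF _ t, of _ k]
          by (intro measurable_lincomb B_meas) (simp add: L_def)
        have [measurable]: "J ?t \<in> borel_measurable M" using J t by auto
        show ?thesis
          unfolding step_integral_eq_lincomb
          by (subst nn_integral_cmult[symmetric])
            (auto simp: power_mult_distrib L_def power2_commute simp flip: ennreal_mult intro!:
              nn_integral_cong)
      qed
      moreover have "(\<lambda>k. ennreal ((?t powr p)\<^sup>2) * ?e k)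
          \<longlonglongrightarrow> ennreal ((?t powr p)\<^sup>2) * 0"
        using W[OF t] by (intro tendsto_mult_ennreal tendsto_const) (auto simp: W_def)
      ultimately show "(\<lambda>k. \<integral>\<^sup>+\<omega>. ennreal ((?d k ?t \<omega>)\<^sup>2) \<partial>M) \<longlonglongrightarrow> 0" by simp
    qed
    moreover have "(\<integral>\<^sup>+\<omega>. ennreal ((lincomb (\<lambda>t. ?d k t \<omega>) l)\<^sup>2) \<partial>M)
      = (\<integral>\<^sup>+\<omega>. ennreal ((X k \<omega> - Xh \<omega>)\<^sup>2) \<partial>M)" for k
    proof (rule nn_integral_cong_AE)
      have "AE \<omega> in M. \<forall>x\<in>set l. Bh (snd x) \<omega> = snd x powr p * J (snd x) \<omega>"
        using J(2) l by (intro AE_finite_allI) auto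
      then show "AE \<omega> in M. ennreal ((lincomb (\<lambda>t. ?d k t \<omega>) l)\<^sup>2) = ennreal ((X k \<omega> - Xh \<omega>)\<^sup>2)"
      proof eventually_elim
        case (elim \<omega>)
        then have "Xh \<omega> = lincomb (\<lambda>t. t powr p * J t \<omega>) l"
          unfolding Xh_def by (intro lincomb_cong) auto
        then show ?case
          by (simp add: X_def A_def lincomb_substitute_points right_diff_distrib lincomb_diff)
      qed
    qed
    ultimately show ?thesis by simp
  qed
  then have L1: "(\<lambda>k. \<integral>\<^sup>+\<omega>. ennreal \<bar>X k \<omega> - Xh \<omega>\<bar> \<partial>M) \<longlonglongrightarrow> 0"
    using tendsto_nn_integral_abs_of_square[OF prob_space_axioms, of "\<lambda>k \<omega>. X k \<omega> - Xh \<omega>"] by simp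
  have lim1: "(\<lambda>k. CLINT \<omega>|M. iexp (X k \<omega>)) \<longlonglongrightarrow> (CLINT \<omega>|M. iexp (Xh \<omega>))"
  proof -
    have int: "integrable M (\<lambda>\<omega>. iexp (g \<omega>))" if "g \<in> borel_measurable M" for g :: "'a \<Rightarrow> real"
      using that by (intro integrable_iexp) auto
    have "(\<lambda>k. \<integral>\<^sup>+\<omega>. ennreal (cmod (iexp (X k \<omega>) - iexp (Xh \<omega>))) \<partial>M) \<longlonglongrightarrow> 0"
      by (rule tendsto_sandwich[OF _ _ tendsto_const L1])
        (auto intro!: always_eventually nn_integral_mono ennreal_leI cmod_iexp_diff_le)
    then show ?thesis
      by (intro tendsto_L1_int) (auto intro!: int)
  qed

  have "(\<lambda>k. \<integral>\<^sup>+s. ennreal ((F k s - f s)\<^sup>2) \<partial>lborel) \<longlonglongrightarrow> 0"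
  proof -
    let ?d = "\<lambda>k t s. t powr p
      * (lincomb (\<lambda>v. indicator {0<..v} s) (L k t) - s powr (- p) * indicator {0..t} s)"
    have "(\<lambda>k. \<integral>\<^sup>+s. ennreal ((lincomb (\<lambda>t. ?d k t s) l)\<^sup>2) \<partial>lborel) \<longlonglongrightarrow> 0"
    proof (rule tendsto_nn_integral_lincomb_square)
      fix x assume "x \<in> set l"
      then have t: "0 < snd x" by (rule l)
      let ?t = "snd x"
      let ?\<phi> = "\<lambda>k. step_fun (n ?t k) (u ?t k) (c ?t k)"
      let ?e = "\<lambda>k. \<integral>\<^sup>+s\<in>{0..?t}. ennreal ((s powr (- p) - ?\<phi> k s)\<^sup>2) \<partial>lborel"
      show "?d k ?t \<in> borel_measurable lborel" for k
        by (auto intro!: borel_measurable_times borel_measurable_diff measurable_lincomb)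
      have "(\<integral>\<^sup>+s. ennreal ((?d k ?t s)\<^sup>2) \<partial>lborel)
          = ennreal ((?t powr p)\<^sup>2) * ?e k" for k
      proof -
        have eq: "lincomb (\<lambda>v. indicator {0<..v} s) (L k ?t) = ?\<phi> k s" for s
          using grid[OF t] by (simp add: L_def step_fun_eq_lincomb)
        \<comment> \<open>The approximation error is controlled only on \<open>{0..t}\<close> for
          the time \<open>t\<close> at hand. The grid stays in that interval, so outside it both
          functions vanish and the error is that over the whole line.\<close>
        have zero: "?\<phi> k s = 0" if "s \<notin> {0..?t}" for s
        proof -
          have "u ?t k i \<ge> 0 \<and> (i < n ?t k \<longrightarrow> u ?t k (Suc i) \<le> ?t)" for i
            using grid[OF t, of k] monoD[OF grid(2)[OF t], of 0 i k]
              monoD[OF grid(2)[OF t], of "Suc i" "n ?t k" k] by auto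
          then show ?thesis
            using that by (force simp: step_fun_def indicator_def intro!: sum.neutral)
        qed
        have [measurable]: "(\<lambda>s. ?\<phi> k s) \<in> borel_measurable borel"
          unfolding step_fun_def by measurable
        show ?thesis
          unfolding eq
          by (subst nn_integral_cmult[symmetric])
            (auto simp: zero power_mult_distrib power2_commute indicator_def simp flip: ennreal_mult
              intro!: nn_integral_cong)
      qed
      moreover have "(\<lambda>k. ennreal ((?t powr p)\<^sup>2) * ?e k)
          \<longlonglongrightarrow> ennreal ((?t powr p)\<^sup>2) * 0"
        using W[OF t] by (intro tendsto_mult_ennreal tendsto_const) (auto simp: W_def)
      ultimately show "(\<lambda>k. \<integral>\<^sup>+s. ennreal ((?d k ?t s)\<^sup>2) \<partial>lborel) \<longlonglongrightarrow> 0" by simp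
    qed
    then show ?thesis
      by (simp add: F_def f_def A_def lincomb_substitute_points right_diff_distrib lincomb_diff)
  qed
  moreover have F_int: "has_bochner_integral lborel (\<lambda>s. (F k s)\<^sup>2) (quadform min (A k))" for k
    unfolding F_def
  proof (rule has_bochner_integral_lincomb_square)
    fix c v c' v' assume "(c, v) \<in> set (A k)" "(c', v') \<in> set (A k)"
    then have "0 \<le> v" "0 \<le> v'" using A_pos by force+
    then have "has_bochner_integral lborel (indicator {0<..min v v'}) (min v v')"
      using has_bochner_integral_real_indicator[of "{0<..min v v'}" lborel]
        by (simp add: emeasure_lborel_Ioc)
    then show "has_bochner_integral lborel (\<lambda>s. indicator {0<..v} s
      * indicator {0<..v'} s) (min v v')"
      by (rule has_bochner_integral_cong[THEN iffD1, rotated 3]) (auto simp: indicator_def)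
  qed simp
  moreover have f_int: "has_bochner_integral lborel (\<lambda>s. (f s)\<^sup>2) (quadform (nrbm_cov p) l)"
    unfolding f_def
  proof (rule has_bochner_integral_lincomb_square)
    fix c v c' v' assume "(c, v) \<in> set l" "(c', v') \<in> set l"
    then have pos: "0 < v" "0 < v'" using l by force+
    then have "has_bochner_integral lborel (\<lambda>s. (v * v') powr p
      * (indicator {0..min v v'} s * s powr (- (2 * p)))) (nrbm_cov p v v')"
      unfolding nrbm_cov_def
      by (intro has_bochner_integral_mult_right has_bochner_integral_powr_initial p) simp
    then show "has_bochner_integral lborel (\<lambda>s. v powr p * (s powr (- p) * indicator {0..v} s)
      * (v' powr p * (s powr (- p) * indicator {0..v'} s))) (nrbm_cov p v v')"
      by (rule has_bochner_integral_cong[THEN iffD1, rotated 3])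
        (use pos in \<open>auto simp: indicator_def powr_mult simp flip: powr_add\<close>)
  qed (rule nrbm_cov_sym)
  ultimately have "(\<lambda>k. \<integral>s. (F k s)\<^sup>2 \<partial>lborel) \<longlonglongrightarrow> (\<integral>s. (f s)\<^sup>2 \<partial>lborel)"
    by (intro tendsto_integral_square) (auto simp: has_bochner_integral_iff)
  then have "(\<lambda>k. quadform min (A k)) \<longlonglongrightarrow> quadform (nrbm_cov p) l"
    using F_int f_int by (simp add: has_bochner_integral_iff)
  then have "(\<lambda>k. complex_of_real (exp (- quadform min (A k) / 2)))
    \<longlonglongrightarrow> exp (- quadform (nrbm_cov p) l / 2)"
    by (intro tendsto_intros) simp_all
  moreover have "(CLINT \<omega>|M. iexp (X k \<omega>)) = complex_of_real (exp (- quadform min (A k) / 2))" for k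
    unfolding X_def using A_pos by (intro brownian_fourier[OF BM]) force
  ultimately show ?thesis
    using LIMSEQ_unique[OF lim1] by (simp add: Xh_def)
qed

subsection \<open>Moments of the smoothed local time\<close>

lemma ennreal_enn2real_le_ennreal: "x \<le> ennreal c \<Longrightarrow> ennreal (enn2real x) = x"
  by (cases x) (auto simp: top_unique)

lemma normal_density_le_mean: "normal_density \<mu> \<sigma> x \<le> normal_density \<mu> \<sigma> \<mu>"
  by (simp add: normal_density_def divide_right_mono)

lemma Fubini_integral_dominated:
  fixes h :: "'a \<Rightarrow> real \<Rightarrow> real" and g :: "real \<Rightarrow> real"
  assumes "prob_space M" and h: "case_prod h \<in> borel_measurable (M \<Otimes>\<^sub>M lborel)"
    and g: "integrable lborel g"
    and bound: "\<And>\<omega> z. \<omega> \<in> space M \<Longrightarrow> \<bar>h \<omega> z\<bar> \<le> g z"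
  shows "(\<integral>\<omega>. (\<integral>z. h \<omega> z \<partial>lborel) \<partial>M) = (\<integral>z. (\<integral>\<omega>. h \<omega> z \<partial>M) \<partial>lborel)"
proof -
  interpret prob_space M by fact
  interpret P: pair_sigma_finite M lborel ..
  have [measurable]: "g \<in> borel_measurable borel" using g by auto
  have "integrable (M \<Otimes>\<^sub>M lborel) (\<lambda>x. g (snd x))"
    using g by (intro P.Fubini_integrable) auto
  then have "integrable (M \<Otimes>\<^sub>M lborel) (case_prod h)"
    by (rule Bochner_Integration.integrable_bound[OF _ h])
      (use bound in \<open>auto intro!: AE_I2 order_trans[OF _ abs_ge_self] simp: space_pair_measure\<close>)
  then show ?thesis
    by (rule P.Fubini_integral[symmetric])
qed

text \<open>The density at \<open>z\<close> in \<open>normal_density 0 \<epsilon> x = \<integral> gauss_weight \<epsilon> z * cos (z * x) dz\<close>; for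
  \<open>\<epsilon> = 0\<close> it formally represents the Dirac delta.\<close>

definition gauss_weight :: "real \<Rightarrow> real \<Rightarrow> real" where
  "gauss_weight \<epsilon> z = exp (- (\<epsilon> * z)\<^sup>2 / 2) / (2 * pi)"

lemma gauss_weight_pos: "0 < gauss_weight \<epsilon> z"
  by (simp add: gauss_weight_def)

lemma measurable_gauss_weight [measurable]: "gauss_weight \<epsilon> \<in> borel_measurable borel"
  unfolding gauss_weight_def by measurable

lemma gauss_weight_eq_normal_density:
  assumes "\<epsilon> > 0"
  shows "gauss_weight \<epsilon> z = normal_density 0 \<epsilon> 0 * normal_density 0 (1 / \<epsilon>) z"
proof -
  have "sqrt (2 * pi * \<epsilon>\<^sup>2) * sqrt (2 * pi * (1 / \<epsilon>)\<^sup>2) = sqrt ((2 * pi)\<^sup>2)"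
    using assms by (simp add: power_divide power2_eq_square flip: real_sqrt_mult)
  also have "\<dots> = 2 * pi" by (simp only: real_sqrt_abs) simp
  finally have "sqrt (2 * pi * \<epsilon>\<^sup>2) * sqrt (2 * pi * (1 / \<epsilon>)\<^sup>2) = 2 * pi" .
  then show ?thesis
    using assms by (simp add: gauss_weight_def normal_density_def power_mult_distrib power_divide
      mult.commute)
qed

lemma integrable_gauss_weight:
  assumes "\<epsilon> > 0"
  shows "integrable lborel (gauss_weight \<epsilon>)" "(\<integral>z. gauss_weight \<epsilon> z \<partial>lborel) = normal_density 0 \<epsilon> 0"
  using assms unfolding gauss_weight_eq_normal_density[OF assms] by simp_all

lemma integrable_bounded_gauss_weight:
  assumes "\<epsilon> > 0" "f \<in> borel_measurable borel" "\<And>z. \<bar>f z\<bar> \<le> B"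
  shows "integrable lborel (\<lambda>z. gauss_weight \<epsilon> z * f z)"
proof (rule Bochner_Integration.integrable_bound)
  show "integrable lborel (\<lambda>z. B * gauss_weight \<epsilon> z)"
    using integrable_gauss_weight[OF assms(1)] by simp
  have "\<bar>f z\<bar> \<le> \<bar>B\<bar>" for z using assms(3)[of z] by linarith
  then show "AE z in lborel. norm (gauss_weight \<epsilon> z * f z) \<le> norm (B * gauss_weight \<epsilon> z)"
    by (intro AE_I2) (simp add: abs_mult mult.commute mult_right_mono)
qed (use assms in measurable)

text \<open>A Gaussian is its own Fourier transform, and the sine part integrates to 0 because the
  characteristic function is real. The phase \<open>x\<close> is kept because in the moments the
  kernel is multiplied by the cosine of a combination already built up; the product becomes an
  integral of cosines of that combination extended by \<open>z * b\<close>.\<close>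

lemma fourier_normal_density:
  assumes "\<epsilon> > 0"
  shows "(\<integral>z. gauss_weight \<epsilon> z * cos (x + z * b) \<partial>lborel) = cos x * normal_density 0 \<epsilon> b"
proof -
  have char: "(CLINT z|lborel. std_normal_density z *\<^sub>R iexp (b / \<epsilon> * z))
    = complex_of_real (exp (- (b / \<epsilon>)\<^sup>2 / 2))"
    using fun_cong[OF char_std_normal_distribution, of "b / \<epsilon>"]
    by (simp add: char_def integral_density)
  have int: "integrable lborel (\<lambda>z. std_normal_density z *\<^sub>R iexp (b / \<epsilon> * z))"
    by (rule Bochner_Integration.integrable_bound[OF integrable_normal_density[of 1 0]]) auto
  have re: "(\<integral>z. std_normal_density z * cos (b / \<epsilon> * z) \<partial>lborel) = exp (- (b / \<epsilon>)\<^sup>2 / 2)"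
    using integral_Re[OF int] unfolding char by (simp add: Re_exp)
  have im: "(\<integral>z. std_normal_density z * sin (b / \<epsilon> * z) \<partial>lborel) = 0"
    using integral_Im[OF int] unfolding char by (simp add: Im_exp)
  have intc: "integrable lborel (\<lambda>z. std_normal_density z * cos (b / \<epsilon> * z))"
    using integrable_Re[OF int] by (simp add: Re_exp)
  have ints: "integrable lborel (\<lambda>z. std_normal_density z * sin (b / \<epsilon> * z))"
    using integrable_Im[OF int] by (simp add: Im_exp)
  have "(\<integral>z. gauss_weight \<epsilon> z * cos (x + z * b) \<partial>lborel)
      = (1 / \<epsilon>) * (\<integral>z. gauss_weight \<epsilon> (z / \<epsilon>) * cos (x + z / \<epsilon> * b) \<partial>lborel)"
    using lborel_integral_real_affine[of "1 / \<epsilon>" "\<lambda>z. gauss_weight \<epsilon> z * cos (x + z * b)" 0] assms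
      by simp
  also have "\<dots> = (1 / \<epsilon>) * (\<integral>z. (1 / sqrt (2 * pi))
    * (cos x * (std_normal_density z * cos (b / \<epsilon> * z)) - sin x
    * (std_normal_density z * sin (b / \<epsilon> * z))) \<partial>lborel)"
  proof -
    have "gauss_weight \<epsilon> (z / \<epsilon>) = (1 / sqrt (2 * pi)) * std_normal_density z" for z
      using assms by (simp add: gauss_weight_def std_normal_density_def)
    then show ?thesis
      by (simp add: cos_add algebra_simps)
  qed
  also have "\<dots> = (1 / \<epsilon>) * (1 / sqrt (2 * pi)) * (cos x * exp (- (b / \<epsilon>)\<^sup>2 / 2))"
    using re im intc ints by simp
  also have "\<dots> = cos x * normal_density 0 \<epsilon> b"
    using assms by (simp add: normal_density_def real_sqrt_mult power_divide ac_simps)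
  finally show ?thesis .
qed

text \<open>The variance at time \<open>t\<close> of the Gaussian martingale \<open>t \<mapsto> \<integral>\<^sub>0\<^sup>t s\<^sup>-\<^sup>p dB\<^sub>s\<close>.\<close>

definition clock :: "real \<Rightarrow> real \<Rightarrow> real" where
  "clock p t = t powr (1 - 2 * p) / (1 - 2 * p)"

lemma clock_mono: "p < 1 / 2 \<Longrightarrow> 0 \<le> s \<Longrightarrow> s \<le> t \<Longrightarrow> clock p s \<le> clock p t"
  unfolding clock_def by (intro divide_right_mono powr_mono2) auto

lemma measurable_clock [measurable]: "clock p \<in> borel_measurable borel"
  unfolding clock_def by measurable

text \<open>Moments of the \<open>\<epsilon>\<close>-smoothed local time as iterated integrals over the times \<open>s\<close> at which
  the path is close to \<open>0\<close> and over a Fourier variable \<open>z\<close> for each of them; the sum of \<open>z * s\<^sup>p\<close>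
  over the later times is carried along as \<open>y\<close>.\<close>

primrec kac :: "real \<Rightarrow> real \<Rightarrow> nat \<Rightarrow> real \<Rightarrow> real \<Rightarrow> ennreal" where
  "kac \<epsilon> p 0 t y = ennreal (exp (- (y\<^sup>2 * clock p t) / 2))"
| "kac \<epsilon> p (Suc n) t y = (\<integral>\<^sup>+s. indicator {0<..<t} s * (\<integral>\<^sup>+z. ennreal (gauss_weight \<epsilon> z *
     exp (- (y\<^sup>2 * (clock p t - clock p s)) / 2)) * kac \<epsilon> p n s (y + z * s powr p) \<partial>lborel)
       \<partial>lborel)"

lemma indicator_open_real: "indicator {a<..<b} s = (if a < s \<and> s < b then 1 else 0)"
  by (simp add: indicator_def)

lemma measurable_kac [measurable]: "(\<lambda>(t, y). kac \<epsilon> p n t y) \<in> borel_measurable (borel \<Otimes>\<^sub>M borel)"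
proof (induction n)
  case (Suc n)
  note [measurable] = Suc
  show ?case unfolding kac.simps indicator_open_real by measurable
qed simp

text \<open>\<open>gauss_weight\<close> grows as its width parameter shrinks, so every level of the
  recursion increases along \<open>1 / Suc k\<close> and monotone convergence passes through both
  integrals. Monotonicity and limit are proved together because each level uses both for the
  previous one.\<close>

lemma kac_tendsto_0:
  "incseq (\<lambda>k. kac (1 / Suc k) p n t y)" "(\<lambda>k. kac (1 / Suc k) p n t y) \<longlonglongrightarrow> kac 0 p n t y"
proof -
  have "incseq (\<lambda>k. kac (1 / Suc k) p n t y) \<and> (\<lambda>k. kac (1 / Suc k) p n t y) \<longlonglongrightarrow> kac 0 p n t y"
  proof (induction n arbitrary: t y)
    case (Suc n)
    let ?w = "\<lambda>k s z. ennreal (gauss_weight (1 / Suc k) z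
      * exp (- (y\<^sup>2 * (clock p t - clock p s)) / 2))"
    let ?h = "\<lambda>k s z. ?w k s z * kac (1 / Suc k) p n s (y + z * s powr p)"
    let ?g = "\<lambda>s z. ennreal (gauss_weight 0 z * exp (- (y\<^sup>2 * (clock p t - clock p s)) / 2))
      * kac 0 p n s (y + z * s powr p)"
    have w_le: "gauss_weight (1 / Suc j) z \<le> gauss_weight (1 / Suc k) z" if "j \<le> k" for j k z
    proof -
      have "(1 / Suc k)\<^sup>2 * z\<^sup>2 \<le> (1 / Suc j)\<^sup>2 * z\<^sup>2"
        using that by (intro mult_right_mono power_mono) (auto simp: frac_le)
      then show ?thesis
        by (auto simp: gauss_weight_def power_mult_distrib power_divide intro!: divide_right_mono)
    qed
    have inc: "?h j s z \<le> ?h k s z" if "j \<le> k" for j k s z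
      using Suc[of s "y + z * s powr p"] w_le[OF that] that
      by (intro mult_mono ennreal_leI mult_right_mono) (auto simp: incseq_def)
    have lim: "(\<lambda>k. ?h k s z) \<longlonglongrightarrow> ?g s z" for s z
    proof (intro tendsto_mult_ennreal tendsto_ennrealI tendsto_mult tendsto_const)
      have "(\<lambda>k. 1 / real (Suc k)) \<longlonglongrightarrow> 0"
        by (rule LIMSEQ_Suc[OF lim_1_over_n])
      then have "(\<lambda>k. exp (- (1 / real (Suc k) * z)\<^sup>2 / 2) / (2 * pi))
        \<longlonglongrightarrow> exp (- (0 * z)\<^sup>2 / 2) / (2 * pi)"
        by (intro tendsto_intros) auto
      then show "(\<lambda>k. gauss_weight (1 / real (Suc k)) z) \<longlonglongrightarrow> gauss_weight 0 z"
        by (simp add: gauss_weight_def)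
      show "(\<lambda>k. kac (1 / real (Suc k)) p n s (y + z * s powr p)) \<longlonglongrightarrow> kac 0 p n s (y + z * s powr p)"
        using Suc by blast
    qed (use gauss_weight_pos[of 0 z] in \<open>auto simp: ennreal_eq_0_iff not_le\<close>)
    have inner_inc: "(\<integral>\<^sup>+z. ?h j s z \<partial>lborel) \<le> (\<integral>\<^sup>+z. ?h k s z \<partial>lborel)" if "j \<le> k" for j k s
      using inc[OF that] by (intro nn_integral_mono)
    have inner_lim: "(\<lambda>k. \<integral>\<^sup>+z. ?h k s z \<partial>lborel) \<longlonglongrightarrow> (\<integral>\<^sup>+z. ?g s z \<partial>lborel)" for s
    proof (rule nn_integral_LIMSEQ[OF _ _ lim])
      show "incseq (\<lambda>k z. ?h k s z)"
        unfolding incseq_def le_fun_def using inc by blast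
    qed measurable
    have "kac (1 / Suc j) p (Suc n) t y \<le> kac (1 / Suc k) p (Suc n) t y" if "j \<le> k" for j k
      unfolding kac.simps by (rule nn_integral_mono, rule mult_left_mono[OF inner_inc[OF that]])
        simp
    moreover have "(\<lambda>k. kac (1 / Suc k) p (Suc n) t y) \<longlonglongrightarrow> kac 0 p (Suc n) t y"
      unfolding kac.simps
    proof (rule nn_integral_LIMSEQ)
      show "incseq (\<lambda>k s. indicator {0<..<t} s * (\<integral>\<^sup>+z. ?h k s z \<partial>lborel))"
        unfolding incseq_def le_fun_def using inner_inc by (intro allI impI mult_left_mono) auto
      show "(\<lambda>k. indicator {0<..<t} s * (\<integral>\<^sup>+z. ?h k s z \<partial>lborel)) \<longlonglongrightarrow>
         indicator {0<..<t} s * (\<integral>\<^sup>+z. ?g s z \<partial>lborel)" for s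
        using inner_lim[of s] by (cases "s \<in> {0<..<t}") simp_all
    qed measurable
    ultimately show ?case
      unfolding incseq_def by blast
  qed simp
  then show "incseq (\<lambda>k. kac (1 / Suc k) p n t y)" "(\<lambda>k. kac (1 / Suc k) p n t y) \<longlonglongrightarrow> kac 0 p n t y"
    by blast+
qed

text \<open>Each level contributes at most the mass \<open>normal_density 0 \<epsilon> 0\<close> of
  the Fourier weight and a time interval of length at most \<open>T\<close>. For positive
  \<open>\<epsilon>\<close> all values are hence finite, and real integrals may be used.\<close>

lemma kac_bound:
  assumes "\<epsilon> > 0" "p < 1 / 2" "0 \<le> T" "t \<le> T"
  shows "kac \<epsilon> p n t y \<le> ennreal ((normal_density 0 \<epsilon> 0 * T) ^ n)"
  using assms(4)
proof (induction n arbitrary: t y)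
  case 0
  have "0 \<le> clock p t" using assms(2) by (simp add: clock_def)
  then show ?case by (simp add: ennreal_le_1)
next
  case (Suc n)
  let ?C = "normal_density 0 \<epsilon> 0"
  let ?e = "\<lambda>s. exp (- (y\<^sup>2 * (clock p t - clock p s)) / 2)"
  have "kac \<epsilon> p (Suc n) t y \<le> (\<integral>\<^sup>+s. indicator {0<..<T} s * ennreal (?C * (?C * T) ^ n) \<partial>lborel)"
    unfolding kac.simps
  proof (intro nn_integral_mono)
    fix s :: real
    show "indicator {0<..<t} s * (\<integral>\<^sup>+z. ennreal (gauss_weight \<epsilon> z * ?e s)
         * kac \<epsilon> p n s (y + z * s powr p) \<partial>lborel)
           \<le> indicator {0<..<T} s * ennreal (?C * (?C * T) ^ n)"
    proof (cases "s \<in> {0<..<t}")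
      case True
      then have "clock p s \<le> clock p t" using assms(2) by (intro clock_mono) auto
      then have "?e s \<le> 1" by simp
      then have "gauss_weight \<epsilon> z * ?e s \<le> gauss_weight \<epsilon> z" for z
        using gauss_weight_pos[of \<epsilon> z] by (simp add: mult_left_le)
      then have "(\<integral>\<^sup>+z. ennreal (gauss_weight \<epsilon> z * ?e s) * kac \<epsilon> p n s (y + z * s powr p) \<partial>lborel)
          \<le> (\<integral>\<^sup>+z. ennreal (gauss_weight \<epsilon> z) * ennreal ((?C * T) ^ n) \<partial>lborel)"
        using True Suc by (intro nn_integral_mono mult_mono ennreal_leI) auto
      also have "\<dots> = ennreal ?C * ennreal ((?C * T) ^ n)"
        using integrable_gauss_weight[OF assms(1)] gauss_weight_pos[of \<epsilon>]
        by (simp add: nn_integral_multc nn_integral_eq_integral less_imp_le)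
      finally show ?thesis
        using True Suc.prems assms by (simp add: ennreal_mult)
    qed simp
  qed
  also have "\<dots> = ennreal ((?C * T) ^ Suc n)"
    using assms by (simp add: nn_integral_multc ac_simps flip: ennreal_mult)
  finally show ?case .
qed

text \<open>Path-side counterpart of \<open>kac_bound\<close>, applied with \<open>C\<close> the
  maximum of the Gaussian kernel; it supplies the dominating functions for Fubini.\<close>

lemma ordered_integral_bound:
  assumes "0 \<le> C" "0 \<le> T" "t \<le> T" and f: "\<And>s. f s \<le> indicator {0<..} s * ennreal C"
  shows "ordered_integral (- 1) f n t \<le> ennreal ((C * T) ^ n)"
  using assms(3)
proof (induction n arbitrary: t)
  case (Suc n)
  have "ordered_integral (- 1) f (Suc n) t
    \<le> (\<integral>\<^sup>+s. indicator {0<..<T} s * ennreal (C * (C * T) ^ n) \<partial>lborel)"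
    unfolding ordered_integral.simps
  proof (intro nn_integral_mono)
    fix s
    have "f s * ordered_integral (- 1) f n s \<le> ennreal (C * (C * T) ^ n)" if "0 < s" "s < t"
      using that f[of s] Suc.IH[of s] Suc.prems assms by (simp add: ennreal_mult mult_mono)
    moreover have "f s = 0" if "\<not> 0 < s" using f[of s] that by simp
    ultimately show "(if - 1 * t < - 1 * s then 1 else 0) * (f s * ordered_integral (- 1) f n s)
        \<le> indicator {0<..<T} s * ennreal (C * (C * T) ^ n)"
      using Suc.prems by (auto simp: indicator_def)
  qed
  also have "\<dots> = ennreal ((C * T) ^ Suc n)"
    using assms by (simp add: nn_integral_multc ac_simps flip: ennreal_mult)
  finally show ?case .
qed simp

text \<open>Both sides are the variance of the part of the combination that is independent of the
  past up to \<open>s\<close>: splitting the underlying martingale at \<open>s\<close> leaves, for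
  the common past, \<open>clock p s\<close> times the square of the total weight. The value at
  \<open>s\<close> itself belongs to that past.\<close>

lemma quadform_nrbm_cov_Cons:
  fixes p :: real
  assumes l: "\<And>x. x \<in> set l \<Longrightarrow> s \<le> snd x" and s: "0 < s"
  defines "Y \<equiv> lincomb (\<lambda>u. u powr p) l"
  shows "quadform (nrbm_cov p) ((z, s) # l) - clock p s * (lincomb (\<lambda>u. u powr p) ((z, s) # l))\<^sup>2
    = quadform (nrbm_cov p) l - clock p s * Y\<^sup>2"
proof -
  have "lincomb (nrbm_cov p s) l = lincomb (\<lambda>u. (s powr p * clock p s) * u powr p) l"
    using l s by (intro lincomb_cong) (force simp: nrbm_cov_def clock_def min_absorb1 powr_mult)
  also have "\<dots> = s powr p * clock p s * Y"
    unfolding lincomb_cmult Y_def ..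
  finally have "lincomb (nrbm_cov p s) l = s powr p * clock p s * Y" .
  moreover have "nrbm_cov p s s = (s powr p)\<^sup>2 * clock p s"
    using s by (simp add: nrbm_cov_def clock_def powr_mult power2_eq_square)
  ultimately show ?thesis
    by (simp add: quadform_Cons[OF nrbm_cov_sym] Y_def power2_eq_square algebra_simps)
qed

lemma measurable_smoothed_path:
  fixes X :: "real \<Rightarrow> 'a \<Rightarrow> real"
  assumes [measurable]: "(\<lambda>(\<omega>, t). X t \<omega>) \<in> borel_measurable (M \<Otimes>\<^sub>M borel)"
  shows "(\<lambda>(\<omega>, s). indicator {0<..} s * ennreal (normal_density 0 \<epsilon> (X s \<omega>)))
    \<in> borel_measurable (M \<Otimes>\<^sub>M borel)"
proof -
  have "(\<lambda>(\<omega>, s). (if 0 < s then 1 else 0) * ennreal (normal_density 0 \<epsilon> (X s \<omega>)))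
      \<in> borel_measurable (M \<Otimes>\<^sub>M borel)"
    by measurable
  then show ?thesis
    by (simp add: indicator_def of_bool_def)
qed

text \<open>Induction, peeling off the latest of the \<open>n\<close> times. Its kernel becomes a
  Fourier integral, which adds \<open>(z, s)\<close> to the list \<open>l\<close> of larger times;
  by \<open>quadform_nrbm_cov_Cons\<close> the variance after \<open>s\<close> ignores this entry.
  So the factor in front of \<open>kac\<close> depends on \<open>l\<close> and \<open>t\<close>
  alone, and \<open>kac\<close> sees \<open>l\<close> only through the sum of its coefficients
  weighted by \<open>u powr p\<close>.\<close>

lemma fourier_ordered_integral:
  fixes X :: "real \<Rightarrow> 'a \<Rightarrow> real" and p \<epsilon> :: real
  assumes M: "prob_space M" and X: "(\<lambda>(\<omega>, t). X t \<omega>) \<in> borel_measurable (M \<Otimes>\<^sub>M borel)"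
    and fourier: "\<And>l. (\<And>x. x \<in> set l \<Longrightarrow> 0 < snd x) \<Longrightarrow>
      (\<integral>\<omega>. cos (lincomb (\<lambda>u. X u \<omega>) l) \<partial>M) = exp (- quadform (nrbm_cov p) l / 2)"
    and p: "p < 1 / 2" and \<epsilon>: "\<epsilon> > 0"
  defines "f \<equiv> \<lambda>\<omega> s. indicator {0<..} s * ennreal (normal_density 0 \<epsilon> (X s \<omega>))"
  assumes "0 < t" and "\<And>x. x \<in> set l \<Longrightarrow> t \<le> snd x"
  shows "(\<integral>\<omega>. cos (lincomb (\<lambda>u. X u \<omega>) l) * enn2real (ordered_integral (- 1) (f \<omega>) n t) \<partial>M)
    = exp (- (quadform (nrbm_cov p) l - clock p t * (lincomb (\<lambda>u. u powr p) l)\<^sup>2) / 2)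
      * enn2real (kac \<epsilon> p n t (lincomb (\<lambda>u. u powr p) l))"
  using assms(7,8)
proof (induction n arbitrary: t l)
  case 0
  have "(\<integral>\<omega>. cos (lincomb (\<lambda>u. X u \<omega>) l) \<partial>M) = exp (- quadform (nrbm_cov p) l / 2)"
    using 0 by (intro fourier) force
  then show ?case
    by (simp add: mult.commute flip: exp_add) (simp add: field_simps)
next
  case (Suc n)
  interpret prob_space M by fact
  let ?C = "normal_density 0 \<epsilon> 0"
  let ?J = "\<lambda>s \<omega>. enn2real (ordered_integral (- 1) (f \<omega>) n s)"
  let ?V = "\<lambda>s y. enn2real (kac \<epsilon> p n s y)"
  let ?Y = "lincomb (\<lambda>u. u powr p) l" and ?Q = "quadform (nrbm_cov p) l"
  let ?S = "\<lambda>\<omega>. lincomb (\<lambda>u. X u \<omega>) l"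
  let ?e = "\<lambda>s. exp (- (?Y\<^sup>2 * (clock p t - clock p s)) / 2)"
  let ?k = "\<lambda>s \<omega>. normal_density 0 \<epsilon> (X s \<omega>)"
  let ?G = "\<lambda>s. \<integral>z. gauss_weight \<epsilon> z * ?e s * ?V s (?Y + z * s powr p) \<partial>lborel"
  let ?H = "\<lambda>s. \<integral>\<^sup>+z. ennreal (gauss_weight \<epsilon> z * ?e s) * kac \<epsilon> p n s (?Y + z * s powr p) \<partial>lborel"
  let ?R = "exp (- (?Q - clock p t * ?Y\<^sup>2) / 2)"
  \<comment> \<open>Common bound for the ordered integral and for \<open>kac\<close> below time
    \<open>t\<close>; it makes \<open>enn2real\<close> harmless and dominates the
    integrands.\<close>
  define K where "K = (?C * t) ^ n"
  have K: "0 \<le> K" using \<open>0 < t\<close> by (simp add: K_def)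
  note X [measurable]
  have Xt [measurable]: "X s \<in> borel_measurable M" for s
    using measurable_compose[OF measurable_Pair2'[of s borel M] X] by simp
  have f [measurable]: "(\<lambda>(\<omega>, s). f \<omega> s) \<in> borel_measurable (M \<Otimes>\<^sub>M borel)"
    unfolding f_def by (rule measurable_smoothed_path[OF X])
  have [measurable]: "(\<lambda>(\<omega>, s). ordered_integral (- 1) (f \<omega>) n s) \<in> borel_measurable (M \<Otimes>\<^sub>M borel)"
    by (rule measurable_ordered_integral_param[OF f])
  have [measurable]: "?S \<in> borel_measurable M"
    by (intro measurable_lincomb Xt)
  note dens = normal_density_le_mean[of 0 \<epsilon>]
  have J_le: "ordered_integral (- 1) (f \<omega>) n s \<le> ennreal K" if "s < t" for s \<omega>
    unfolding K_def using that \<open>0 < t\<close> dens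
    by (intro ordered_integral_bound) (auto simp: f_def indicator_def intro: ennreal_leI)
  note fin = ennreal_enn2real_le_ennreal[symmetric]
  have J_fin: "ordered_integral (- 1) (f \<omega>) n s = ennreal (?J s \<omega>)" if "s < t" for s \<omega>
    by (rule fin[OF J_le[OF that]])
  have J_real: "?J s \<omega> \<le> K" if "s < t" for s \<omega>
    using J_le[OF that] K by (simp add: enn2real_leI)
  have V_le: "kac \<epsilon> p n s y \<le> ennreal K" if "s < t" for s y
    unfolding K_def using that \<open>0 < t\<close> \<epsilon> p by (intro kac_bound) auto
  have V_fin: "kac \<epsilon> p n s y = ennreal (?V s y)" if "s < t" for s y
    by (rule fin[OF V_le[OF that]])
  have V_real: "?V s y \<le> K" if "s < t" for s y
    using V_le[OF that] K by (simp add: enn2real_leI)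

  have J_Suc: "enn2real (ordered_integral (- 1) (f \<omega>) (Suc n) t)
      = (\<integral>s. indicator {0<..<t} s * (?k s \<omega> * ?J s \<omega>) \<partial>lborel)" if "\<omega> \<in> space M" for \<omega>
    unfolding ordered_integral.simps
  proof (rule enn2real_nn_integral_eq_integral)
    have "(if - 1 * t < - 1 * s then 1 else 0) * (f \<omega> s * ordered_integral (- 1) (f \<omega>) n s)
        = ennreal (indicator {0<..<t} s * (?k s \<omega> * ?J s \<omega>))" for s
      using J_fin[of s \<omega>] by (auto simp: f_def indicator_def ennreal_mult'')
    then show "AE s in lborel. (if - 1 * t < - 1 * s then 1 else 0)
      * (f \<omega> s * ordered_integral (- 1) (f \<omega>) n s)
        = ennreal (indicator {0<..<t} s * (?k s \<omega> * ?J s \<omega>))" by simp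
    have [measurable]: "(\<lambda>s. X s \<omega>) \<in> borel_measurable borel"
      using measurable_compose[OF measurable_Pair1'[OF that] X] by simp
    have "f \<omega> \<in> borel_measurable borel"
      using measurable_compose[OF measurable_Pair1'[OF that] f] by simp
    from measurable_ordered_integral[OF this]
    show "(\<lambda>s. indicator {0<..<t} s * (?k s \<omega> * ?J s \<omega>)) \<in> borel_measurable lborel"
      by measurable
  qed simp

  have step: "(\<integral>\<omega>. cos (?S \<omega>) * (?k s \<omega> * ?J s \<omega>) \<partial>M)
      = ?R * ?G s"
    if s: "0 < s" "s < t" for s
  proof -
    have "(\<integral>\<omega>. cos (?S \<omega>) * (?k s \<omega> * ?J s \<omega>) \<partial>M)
        = (\<integral>\<omega>. (\<integral>z. gauss_weight \<epsilon> z * cos (?S \<omega> + z * X s \<omega>) * ?J s \<omega> \<partial>lborel) \<partial>M)"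
      by (simp add: fourier_normal_density[OF \<epsilon>] mult.assoc[symmetric])
    also have "\<dots> = (\<integral>z. (\<integral>\<omega>. gauss_weight \<epsilon> z * cos (?S \<omega> + z * X s \<omega>) * ?J s \<omega> \<partial>M) \<partial>lborel)"
    proof (rule Fubini_integral_dominated[OF M])
      show "(\<lambda>(\<omega>, z). gauss_weight \<epsilon> z * cos (?S \<omega> + z * X s \<omega>) * ?J s \<omega>)
        \<in> borel_measurable (M \<Otimes>\<^sub>M lborel)"
      proof -
        have [measurable]: "?J s \<in> borel_measurable M"
          by measurable
        show ?thesis by measurable
      qed
      show "integrable lborel (\<lambda>z. K * gauss_weight \<epsilon> z)"
        using integrable_gauss_weight[OF \<epsilon>] by simp
      show "\<bar>gauss_weight \<epsilon> z * cos (?S \<omega> + z * X s \<omega>) * ?J s \<omega>\<bar> \<le> K * gauss_weight \<epsilon> z" for \<omega> z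
      proof -
        have "\<bar>cos (?S \<omega> + z * X s \<omega>)\<bar> * ?J s \<omega> \<le> 1 * K"
          using J_real[OF s(2)] K by (intro mult_mono) auto
        then show ?thesis
          using gauss_weight_pos[of \<epsilon> z] by (simp add: abs_mult ac_simps mult_left_mono)
      qed
    qed
    also have "\<dots> = (\<integral>z. ?R * (gauss_weight \<epsilon> z * ?e s * ?V s (?Y + z * s powr p)) \<partial>lborel)"
    proof (intro Bochner_Integration.integral_cong refl)
      fix z
      have "(\<integral>\<omega>. cos (?S \<omega> + z * X s \<omega>) * ?J s \<omega> \<partial>M)
          = (\<integral>\<omega>. cos (lincomb (\<lambda>u. X u \<omega>) ((z, s) # l)) * ?J s \<omega> \<partial>M)"
        by (simp add: add.commute)
      also have "\<dots> = exp (- (quadform (nrbm_cov p) ((z, s) # l) - clock p s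
        * (lincomb (\<lambda>u. u powr p) ((z, s) # l))\<^sup>2) / 2)
          * ?V s (lincomb (\<lambda>u. u powr p) ((z, s) # l))"
        using s Suc.prems by (intro Suc.IH) (auto intro: order_trans[OF less_imp_le])
      also have "quadform (nrbm_cov p) ((z, s) # l) - clock p s
        * (lincomb (\<lambda>u. u powr p) ((z, s) # l))\<^sup>2
          = ?Q - clock p s * ?Y\<^sup>2"
        using s Suc.prems by (intro quadform_nrbm_cov_Cons)
          (auto intro: order_trans[OF less_imp_le])
      \<comment> \<open>The variance after \<open>s\<close> is the variance after \<open>t\<close>
        plus what is gathered between \<open>s\<close> and \<open>t\<close>.\<close>
      also have "exp (- (?Q - clock p s * ?Y\<^sup>2) / 2) = ?R * ?e s"
        by (simp add: exp_add[symmetric] field_simps)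
      finally show "(\<integral>\<omega>. gauss_weight \<epsilon> z * cos (?S \<omega> + z * X s \<omega>) * ?J s \<omega> \<partial>M)
          = ?R * (gauss_weight \<epsilon> z * ?e s * ?V s (?Y + z * s powr p))"
        by (simp add: mult.assoc add.commute)
    qed
    finally show ?thesis by simp
  qed

  have "(\<integral>\<omega>. cos (?S \<omega>) * enn2real (ordered_integral (- 1) (f \<omega>) (Suc n) t) \<partial>M)
      = (\<integral>\<omega>. (\<integral>s. indicator {0<..<t} s * (cos (?S \<omega>) * (?k s \<omega> * ?J s \<omega>)) \<partial>lborel) \<partial>M)"
  proof (intro Bochner_Integration.integral_cong refl)
    fix \<omega> assume \<omega>: "\<omega> \<in> space M"
    have "cos (?S \<omega>) * enn2real (ordered_integral (- 1) (f \<omega>) (Suc n) t)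
        = (\<integral>s. cos (?S \<omega>) * (indicator {0<..<t} s * (?k s \<omega> * ?J s \<omega>)) \<partial>lborel)"
      unfolding J_Suc[OF \<omega>] by simp
    then show "cos (?S \<omega>) * enn2real (ordered_integral (- 1) (f \<omega>) (Suc n) t)
        = (\<integral>s. indicator {0<..<t} s * (cos (?S \<omega>) * (?k s \<omega> * ?J s \<omega>)) \<partial>lborel)"
      by (simp only: ac_simps)
  qed
  also have "\<dots> = (\<integral>s. (\<integral>\<omega>. indicator {0<..<t} s * (cos (?S \<omega>) * (?k s \<omega> * ?J s \<omega>)) \<partial>M) \<partial>lborel)"
  proof (rule Fubini_integral_dominated[OF M])
    show "(\<lambda>(\<omega>, s). indicator {0<..<t} s * (cos (?S \<omega>) * (?k s \<omega> * ?J s \<omega>)))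
      \<in> borel_measurable (M \<Otimes>\<^sub>M lborel)"
      unfolding indicator_open_real by measurable
    have "integrable lborel (indicator {0<..<t} :: real \<Rightarrow> real)"
      using \<open>0 < t\<close> by (intro integrable_real_indicator) auto
    then show "integrable lborel (\<lambda>s. indicator {0<..<t} s * (?C * K))" by simp
    show "\<bar>indicator {0<..<t} s * (cos (?S \<omega>) * (?k s \<omega> * ?J s \<omega>))\<bar>
      \<le> indicator {0<..<t} s * (?C * K)" for \<omega> s
    proof (cases "s < t")
      case True
      have "\<bar>cos (?S \<omega>)\<bar> * (?k s \<omega> * ?J s \<omega>) \<le> 1 * (?C * K)"
        using J_real[OF True, of \<omega>] dens[of "X s \<omega>"] K by (intro mult_mono) auto
      then show ?thesis by (simp add: abs_mult mult_left_mono)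
    qed simp
  qed
  also have "\<dots> = (\<integral>s. ?R * (indicator {0<..<t} s * ?G s) \<partial>lborel)"
  proof (intro Bochner_Integration.integral_cong refl)
    fix s
    show "(\<integral>\<omega>. indicator {0<..<t} s * (cos (?S \<omega>) * (?k s \<omega> * ?J s \<omega>)) \<partial>M)
        = ?R * (indicator {0<..<t} s * ?G s)"
      using step[of s] by (cases "s \<in> {0<..<t}") simp_all
  qed
  also have "\<dots> = ?R * (\<integral>s. indicator {0<..<t} s * ?G s \<partial>lborel)"
    by simp
  also have "(\<integral>s. indicator {0<..<t} s * ?G s \<partial>lborel)
      = enn2real (kac \<epsilon> p (Suc n) t ?Y)"
    unfolding kac.simps
  proof (rule enn2real_nn_integral_eq_integral[symmetric])
    show "AE s in lborel. indicator {0<..<t} s * ?H s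
        = ennreal (indicator {0<..<t} s * ?G s)"
    proof (intro AE_I2)
      fix s
      have "?H s
          = ennreal (?G s)" if s: "0 < s" "s < t"
      proof -
        have e: "\<bar>?e s\<bar> \<le> 1"
          using s clock_mono[OF p, of s t] by simp
        have "integrable lborel (\<lambda>z. gauss_weight \<epsilon> z * (?e s * ?V s (?Y + z * s powr p)))"
        proof (rule integrable_bounded_gauss_weight[OF \<epsilon>])
          show "\<bar>?e s * ?V s (?Y + z * s powr p)\<bar> \<le> 1 * K" for z
            unfolding abs_mult using e V_real[OF s(2)] K by (intro mult_mono) auto
        qed measurable
        then have "ennreal (?G s)
            = (\<integral>\<^sup>+z. ennreal (gauss_weight \<epsilon> z * ?e s * ?V s (?Y + z * s powr p)) \<partial>lborel)"
          using gauss_weight_pos[of \<epsilon>]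
            by (intro nn_integral_eq_integral[symmetric]) (auto simp: mult.assoc less_imp_le)
        also have "\<dots> = ?H s"
          using V_fin[OF s(2)] gauss_weight_pos[of \<epsilon>]
            by (intro nn_integral_cong) (simp add: ennreal_mult'' less_imp_le)
        finally show ?thesis by simp
      qed
      then show "indicator {0<..<t} s * ?H s
        = ennreal (indicator {0<..<t} s * ?G s)"
        by (cases "s \<in> {0<..<t}") simp_all
    qed
    show "AE s in lborel. 0 \<le> indicator {0<..<t} s * ?G s"
      using gauss_weight_pos[of \<epsilon>]
        by (intro AE_I2 mult_nonneg_nonneg integral_nonneg_AE) (auto simp: less_imp_le)
    have "(\<lambda>s. ?G s) \<in> borel_measurable lborel"
      by measurable
    then show "(\<lambda>s. indicator {0<..<t} s * ?G s) \<in> borel_measurable lborel"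
      by measurable
  qed
  finally show ?case .
qed

subsection \<open>Removing the smoothing\<close>

lemma nn_integral_gaussian:
  assumes "c > 0"
  shows "(\<integral>\<^sup>+y. ennreal (exp (- (y\<^sup>2 * c) / 2)) \<partial>lborel) = ennreal (sqrt (2 * pi / c))"
proof -
  have "exp (- (y\<^sup>2 * c) / 2) = sqrt (2 * pi / c) * normal_density 0 (1 / sqrt c) y" for y
    using assms by (simp add: normal_density_def power_divide mult.commute)
  then have "(\<integral>\<^sup>+y. ennreal (exp (- (y\<^sup>2 * c) / 2)) \<partial>lborel)
      = ennreal (sqrt (2 * pi / c)) * (\<integral>\<^sup>+y. ennreal (normal_density 0 (1 / sqrt c) y) \<partial>lborel)"
    using assms by (simp add: ennreal_mult nn_integral_cmult)
  also have "(\<integral>\<^sup>+y. ennreal (normal_density 0 (1 / sqrt c) y) \<partial>lborel) = 1"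
    using assms by (subst nn_integral_eq_integral) auto
  finally show ?thesis by simp
qed

text \<open>The substitution \<open>s = t * v powr (1 / q)\<close> gives the Beta integrand. Its
  derivative may be unbounded at 0, so the substitution is made on \<open>{1 / Suc n..1}\<close>,
  and both sides increase to the full integrals.\<close>

lemma nn_integral_powr_Beta:
  fixes q b t :: real
  assumes q: "q > 0" and b: "b > 0" and t: "t > 0"
  shows "(\<integral>\<^sup>+s. indicator {0<..<t} s
    * ennreal ((t powr q - s powr q) powr (- 1 / 2) * s powr (b - 1)) \<partial>lborel)
    = ennreal (t powr (b - q / 2) / q * Beta (b / q) (1 / 2))"
proof -
  define f where "f s = (t powr q - s powr q) powr (- 1 / 2) * s powr (b - 1)" for s
  define h where "h v = v powr (b / q - 1) * (1 - v) powr (1 / 2 - 1)" for v :: real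
  define g where "g v = t * v powr (1 / q)" for v
  define g' where "g' v = t * (1 / q * v powr (1 / q - 1))" for v
  let ?d = "\<lambda>n. 1 / real (Suc n)"
  let ?A = "t powr (b - q / 2) / q"
  have [measurable]: "f \<in> borel_measurable borel" "h \<in> borel_measurable borel"
    unfolding f_def h_def by measurable
  have d: "0 < ?d n" "?d n \<le> 1" for n by simp_all
  have g1: "g 1 = t" by (simp add: g_def)
  have subst: "(\<integral>\<^sup>+s. ennreal (f s) * indicator {g (?d n)..t} s \<partial>lborel)
      = (\<integral>\<^sup>+v. ennreal (?A) * (ennreal (h v) * indicator {?d n..1} v) \<partial>lborel)" for n
  proof -
    have "(\<integral>\<^sup>+s. ennreal (f s * indicator {g (?d n)..g 1} s) \<partial>lborel)
        = (\<integral>\<^sup>+v. ennreal (f (g v) * g' v * indicator {?d n..1} v) \<partial>lborel)"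
    proof (rule nn_integral_substitution)
      show "set_borel_measurable borel {g (?d n)..g 1} f"
        unfolding set_borel_measurable_def by measurable
      show "(g has_real_derivative g' v) (at v)" if "v \<in> {?d n..1}" for v
        using order.strict_trans2[OF d(1)[of n], of v] that unfolding g_def g'_def
        by (auto intro!: derivative_eq_intros simp: field_simps)
      show "continuous_on {?d n..1} g'"
        unfolding g'_def using d(1)[of n] by (intro continuous_intros) auto
      show "0 \<le> g' v" for v using q t by (simp add: g'_def)
    qed (use d in auto)
    also have "\<dots> = (\<integral>\<^sup>+v. ennreal (?A) * (ennreal (h v) * indicator {?d n..1} v) \<partial>lborel)"
    proof (intro nn_integral_cong)
      fix v
      have "f (g v) * g' v = ?A * h v" if "v \<in> {?d n..1}"
      proof -
        from order.strict_trans2[OF d(1)[of n], of v] that have v: "0 < v" "v \<le> 1" by auto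
        have "(g v) powr q = t powr q * v"
          using v t q by (simp add: g_def powr_mult powr_powr)
        then have "f (g v) * g' v
          = (t powr q * (1 - v)) powr (- 1 / 2) * (t * v powr (1 / q)) powr (b - 1)
          * (t * (1 / q * v powr (1 / q - 1)))"
          by (simp add: f_def g'_def g_def right_diff_distrib)
        also have "\<dots> = (t powr (- q / 2) * t powr (b - 1) * t powr 1) / q
          * (v powr ((b - 1) / q) * v powr (1 / q - 1) * (1 - v) powr (- 1 / 2))"
          using v t q by (simp add: powr_mult powr_powr)
        also have "t powr (- q / 2) * t powr (b - 1) * t powr 1 = t powr (b - q / 2)"
          by (simp only: powr_add[symmetric]) simp
        also have "v powr ((b - 1) / q) * v powr (1 / q - 1) = v powr (b / q - 1)"
          by (simp only: powr_add[symmetric]) (simp add: diff_divide_distrib)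
        finally show ?thesis by (simp add: h_def)
      qed
      then show "ennreal (f (g v) * g' v * indicator {?d n..1} v)
          = ennreal (?A) * (ennreal (h v) * indicator {?d n..1} v)"
        using q t by (auto simp: indicator_def h_def simp flip: ennreal_mult)
    qed
    finally show ?thesis
      by (simp add: g1 ennreal_mult'' ennreal_indicator)
  qed
  have dlim: "(\<lambda>n. ?d n) \<longlonglongrightarrow> 0" by (rule LIMSEQ_Suc[OF lim_1_over_n])
  have lhs: "(\<lambda>n. \<integral>\<^sup>+s. ennreal (f s) * indicator {g (?d n)..t} s \<partial>lborel)
      \<longlonglongrightarrow> (\<integral>\<^sup>+s. ennreal (f s) * indicator {0<..t} s \<partial>lborel)"
  proof (rule nn_integral_LIMSEQ)
    have "g (?d n) \<le> g (?d m)" if "m \<le> n" for m n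
      unfolding g_def using that t q by (intro mult_left_mono powr_mono2) (auto simp: frac_le)
    then show "incseq (\<lambda>n s. ennreal (f s) * indicator {g (?d n)..t} s)"
      by (auto simp: incseq_def le_fun_def indicator_def intro: order_trans)
    show "(\<lambda>n. ennreal (f s) * indicator {g (?d n)..t} s) \<longlonglongrightarrow> ennreal (f s) * indicator {0<..t} s"
      for s
    proof (cases "0 < s")
      case True
      have "(\<lambda>n. g (?d n)) \<longlonglongrightarrow> t * 0 powr (1 / q)"
        unfolding g_def using q by (intro tendsto_intros dlim) auto
      then have "\<forall>\<^sub>F n in sequentially. g (?d n) < s"
        using True by (intro order_tendstoD) auto
      then have "\<forall>\<^sub>F n in sequentially. ennreal (f s) * indicator {g (?d n)..t} s
        = ennreal (f s) * indicator {0<..t} s"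
        by eventually_elim (use True in \<open>auto simp: indicator_def\<close>)
      then show ?thesis by (rule tendsto_eventually)
    next
      case False
      moreover have "0 < g (?d n)" for n using t by (simp add: g_def)
      ultimately have "\<not> g (?d n) \<le> s" for n by (meson not_le order.strict_trans2 le_less_trans)
      with False show ?thesis by (simp add: indicator_def)
    qed
  qed measurable
  have rhs: "(\<lambda>n. \<integral>\<^sup>+v. ennreal (?A) * (ennreal (h v) * indicator {?d n..1} v) \<partial>lborel)
      \<longlonglongrightarrow> (\<integral>\<^sup>+v. ennreal (?A) * (ennreal (h v) * indicator {0<..1} v) \<partial>lborel)"
  proof (rule nn_integral_LIMSEQ)
    have "?d n \<le> ?d m" if "m \<le> n" for m n
      using that by (auto simp: frac_le)
    then show "incseq (\<lambda>n v. ennreal (?A) * (ennreal (h v) * indicator {?d n..1} v))"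
      by (auto simp: incseq_def le_fun_def indicator_def intro: order_trans simp del: of_nat_Suc)
    show "(\<lambda>n. ennreal (?A) * (ennreal (h v) * indicator {?d n..1} v))
      \<longlonglongrightarrow> ennreal (?A) * (ennreal (h v) * indicator {0<..1} v)" for v
    proof (cases "0 < v")
      case True
      then have "\<forall>\<^sub>F n in sequentially. ?d n < v"
        using dlim by (intro order_tendstoD) auto
      then have "\<forall>\<^sub>F n in sequentially. ennreal (?A) * (ennreal (h v) * indicator {?d n..1} v)
          = ennreal (?A) * (ennreal (h v) * indicator {0<..1} v)"
        by eventually_elim (use True in \<open>auto simp: indicator_def\<close>)
      then show ?thesis by (rule tendsto_eventually)
    next
      case False
      then have "\<not> ?d n \<le> v" for n using d(1)[of n] by linarith
      with False show ?thesis by (simp add: indicator_def)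
    qed
  qed measurable
  have "(\<integral>\<^sup>+s. indicator {0<..<t} s * ennreal (f s) \<partial>lborel)
    = (\<integral>\<^sup>+s. ennreal (f s) * indicator {0<..t} s \<partial>lborel)"
    by (intro nn_integral_cong) (auto simp: indicator_def f_def)
  also have "\<dots> = (\<integral>\<^sup>+v. ennreal (?A) * (ennreal (h v) * indicator {0<..1} v) \<partial>lborel)"
    using lhs rhs unfolding subst by (rule LIMSEQ_unique)
  also have "\<dots> = ennreal (?A) * (\<integral>\<^sup>+v. ennreal (h v) * indicator {0<..1} v \<partial>lborel)"
    by (rule nn_integral_cmult) measurable
  also have "(\<integral>\<^sup>+v. ennreal (h v) * indicator {0<..1} v \<partial>lborel)
    = (\<integral>\<^sup>+v. ennreal (indicator {0..1} v * h v) \<partial>lborel)"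
    by (intro nn_integral_cong) (auto simp: indicator_def h_def)
  also have "\<dots> = ennreal (Beta (b / q) (1 / 2))"
  proof (rule nn_integral_has_integral_lebesgue)
    show "(h has_integral Beta (b / q) (1 / 2)) {0..1}"
      unfolding h_def using q b by (intro has_integral_Beta_real) auto
  qed (simp add: h_def)
  also have "ennreal (?A) * ennreal (Beta (b / q) (1 / 2))
      = ennreal (?A * Beta (b / q) (1 / 2))"
    using q by (intro ennreal_mult'[symmetric]) simp
  finally show ?thesis
    unfolding f_def .
qed

text \<open>The value at \<open>t = 1\<close> of the integral in \<open>kac_zero_integral\<close>.
  The leading factor is the density at 0 of a centred normal variable of variance
  \<open>2 * a\<close>, which is \<open>clock p 1\<close> there; every further time contributes
  \<open>sqrt a\<close> and one Gamma ratio.\<close>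

definition moment_coeff :: "real \<Rightarrow> nat \<Rightarrow> real" where
  "moment_coeff a n = sqrt (1 / (4 * pi * a)) * sqrt a ^ n
    * (\<Prod>k=1..n. Gamma_half_ratio (real k * a))"

lemma moment_coeff_pos:
  assumes "a > 0"
  shows "moment_coeff a n > 0"
proof -
  have "0 < Gamma_half_ratio (real k * a)" if "k \<in> {1..n}" for k
  proof -
    have "0 < real k * a" using that assms by simp
    then show ?thesis by (intro divide_pos_pos Gamma_real_pos) simp_all
  qed
  then have "0 < (\<Prod>k=1..n. Gamma_half_ratio (real k * a))"
    by (rule prod_pos)
  with assms show ?thesis by (simp add: moment_coeff_def)
qed

text \<open>Brings the coefficients into the shape that one more time produces: a Gaussian constant,
  the factor \<open>1 / q = 2 * a\<close> of the substitution, and a Beta value.\<close>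

lemma moment_coeff_Suc:
  assumes "a > 0"
  shows "moment_coeff a (Suc n)
    = moment_coeff a n * (sqrt (1 / (4 * pi * a)) * (2 * a) * Beta (real (Suc n) * a) (1 / 2))"
proof -
  have "sqrt (1 / (4 * pi * a)) * (2 * a) = sqrt a / sqrt pi"
    using assms real_sqrt_mult_self[of a] by (simp add: real_sqrt_divide real_sqrt_mult field_simps)
  moreover have "Beta (real (Suc n) * a) (1 / 2) = sqrt pi * Gamma_half_ratio (real (Suc n) * a)"
    by (simp add: Beta_def Gamma_one_half_real)
  ultimately show ?thesis
    by (simp add: moment_coeff_def)
qed

text \<open>Without smoothing the Fourier weight is constant, so the substitution
  \<open>Y = y + z * s powr p\<close> removes \<open>y\<close> from the inner integral, with
  Jacobian \<open>s powr (- p)\<close>: once the path sits at 0 at time \<open>s\<close>, the later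
  times are forgotten.\<close>

lemma kac_zero_Suc:
  assumes "p < 1 / 2"
  shows "kac 0 p (Suc n) t y
    = (\<integral>\<^sup>+s. indicator {0<..<t} s * (ennreal (exp (- (y\<^sup>2 * (clock p t - clock p s)) / 2)) *
      (ennreal (s powr (- p)) * (\<integral>\<^sup>+Y. ennreal (1 / (2 * pi)) * kac 0 p n s Y \<partial>lborel))) \<partial>lborel)"
  unfolding kac.simps
proof (intro nn_integral_cong)
  fix s
  let ?e = "exp (- (y\<^sup>2 * (clock p t - clock p s)) / 2)"
  let ?z = "\<integral>\<^sup>+z. ennreal (1 / (2 * pi)) * kac 0 p n s (y + z * s powr p) \<partial>lborel"
  let ?g = "\<integral>\<^sup>+z. ennreal (gauss_weight 0 z * ?e) * kac 0 p n s (y + z * s powr p) \<partial>lborel"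
  let ?v = "\<integral>\<^sup>+Y. ennreal (1 / (2 * pi)) * kac 0 p n s Y \<partial>lborel"
  have "?g
      = ennreal ?e * (ennreal (s powr (- p)) * ?v)" if "0 < s"
  proof -
    have "?v
        = ennreal (s powr p) * (\<integral>\<^sup>+z. ennreal (1 / (2 * pi))
          * kac 0 p n s (y + s powr p * z) \<partial>lborel)"
      using that by (subst nn_integral_real_affine[of _ "s powr p" y]) auto
    moreover have cancel: "ennreal (s powr (- p)) * (ennreal (s powr p) * x) = x" for x
      using that by (simp add: mult.assoc[symmetric] ennreal_mult[symmetric] powr_add[symmetric])
    ultimately have "ennreal (s powr (- p)) * ?v
        = ?z"
      by (simp only: cancel mult.commute[of "s powr p"])
    moreover have "?g
        = ennreal ?e * ?z"
    proof -
      have "ennreal (gauss_weight 0 z * ?e) = ennreal ?e * ennreal (1 / (2 * pi))" for z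
        by (subst ennreal_mult[symmetric]) (simp_all add: gauss_weight_def)
      then show ?thesis by (simp add: nn_integral_cmult mult.assoc)
    qed
    ultimately show ?thesis by simp
  qed
  then show "indicator {0<..<t} s * ?g
      = indicator {0<..<t} s * (ennreal ?e * (ennreal (s powr (- p)) * ?v))"
    by (cases "s \<in> {0<..<t}") simp_all
qed

lemma sqrt_gaussian_const:
  fixes c :: real
  assumes "c > 0"
  shows "1 / (2 * pi) * sqrt (2 * pi / c) = sqrt (1 / (2 * pi) * (1 / c))"
  using assms by (intro real_sqrt_unique[symmetric])
    (auto simp: power_mult_distrib power_divide power2_eq_square)

lemma sqrt_powr_half: "0 < x \<Longrightarrow> sqrt (x powr c) = x powr (c / 2)" for x c :: real
  by (simp add: powr_half_sqrt[symmetric] powr_powr)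

text \<open>Integrating out the Fourier variable over the gap from \<open>s\<close> to
  \<open>t\<close> leaves a multiple of \<open>(t powr q - s powr q) powr (- 1 / 2)\<close> with
  \<open>q = 1 - 2 * p\<close>, and the induction hypothesis is a power of \<open>s\<close>, so each
  step is a Beta integral. As \<open>1 / q = 2 * a\<close>, its first argument is
  \<open>Suc n * a\<close>.\<close>

lemma kac_zero_integral:
  fixes a p t :: real
  assumes a: "a > 0" and p: "1 - 2 * p = 1 / (2 * a)" and "t > 0"
  shows "(\<integral>\<^sup>+Y. ennreal (1 / (2 * pi)) * kac 0 p n t Y \<partial>lborel)
    = ennreal (moment_coeff a n * t powr ((real n - (1 - 2 * p)) / 2))"
  using \<open>t > 0\<close>
proof (induction n arbitrary: t)
  case 0
  define q where "q = 1 - 2 * p"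
  have q: "q > 0" using a p by (simp add: q_def)
  have clock: "clock p t > 0" using 0 q by (simp add: clock_def q_def)
  have "(\<integral>\<^sup>+Y. ennreal (1 / (2 * pi)) * kac 0 p 0 t Y \<partial>lborel)
    = ennreal (1 / (2 * pi)) * ennreal (sqrt (2 * pi / clock p t))"
    using nn_integral_gaussian[OF clock] by (simp add: nn_integral_cmult)
  also have "\<dots> = ennreal (1 / (2 * pi) * sqrt (2 * pi / clock p t))"
    using clock by (intro ennreal_mult[symmetric]) auto
  also have "1 / (2 * pi) * sqrt (2 * pi / clock p t) = sqrt (1 / (4 * pi * a)) * t powr (- q / 2)"
  proof -
    have "1 / (2 * pi) * sqrt (2 * pi / clock p t) = sqrt (1 / (2 * pi) * (1 / clock p t))"
      using clock by (rule sqrt_gaussian_const)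
    also have "1 / (2 * pi) * (1 / clock p t) = 1 / (4 * pi * a) * t powr (- q)"
    proof -
      have "clock p t = t powr q * (1 / q)" by (simp add: clock_def q_def)
      also have "1 / q = 2 * a" unfolding q_def p by simp
      finally show ?thesis using a by (simp add: powr_minus field_simps)
    qed
    also have "sqrt \<dots> = sqrt (1 / (4 * pi * a)) * t powr (- q / 2)"
      using 0 by (simp only: real_sqrt_mult sqrt_powr_half)
    finally show ?thesis .
  qed
  finally show ?case
    by (simp add: moment_coeff_def q_def)
next
  case (Suc n)
  define q where "q = 1 - 2 * p"
  have q: "q > 0" unfolding q_def p using a by simp
  then have p2: "p < 1 / 2" and pq: "- p = (q - 1) / 2" by (simp_all add: q_def)
  have qa: "1 / q = 2 * a" unfolding q_def p by simp
  let ?e = "\<lambda>s y. ennreal (exp (- (y\<^sup>2 * (clock p t - clock p s)) / 2))"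
  let ?b = "sqrt (1 / (4 * pi * a))"
  let ?c = "?b * moment_coeff a n"
  let ?h = "\<lambda>s. (t powr q - s powr q) powr (- 1 / 2) * s powr ((real n + 1) / 2 - 1)"
  have c: "0 \<le> ?c" using moment_coeff_pos[OF a, of n] a by simp
  define w where "w s = ennreal (s powr (- p))
    * (\<integral>\<^sup>+Y. ennreal (1 / (2 * pi)) * kac 0 p n s Y \<partial>lborel)" for s
  have [measurable]: "w \<in> borel_measurable borel"
    unfolding w_def by measurable
  have "(\<integral>\<^sup>+y. ennreal (1 / (2 * pi)) * kac 0 p (Suc n) t y \<partial>lborel)
      = (\<integral>\<^sup>+y. (\<integral>\<^sup>+s. ennreal (1 / (2 * pi)) * (indicator {0<..<t} s * (?e s y * w s)) \<partial>lborel)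
        \<partial>lborel)"
    unfolding kac_zero_Suc[OF p2] w_def[symmetric]
    by (intro nn_integral_cong nn_integral_cmult[symmetric]) measurable
  also have "\<dots> = (\<integral>\<^sup>+s. (\<integral>\<^sup>+y. ennreal (1 / (2 * pi))
    * (indicator {0<..<t} s * (?e s y * w s)) \<partial>lborel) \<partial>lborel)"
    unfolding indicator_open_real by (rule lborel_pair.Fubini') measurable
  also have "\<dots> = (\<integral>\<^sup>+s. ennreal ?c * (indicator {0<..<t} s * ennreal (?h s)) \<partial>lborel)"
  proof (intro nn_integral_cong)
    fix s
    have "(\<integral>\<^sup>+y. ennreal (1 / (2 * pi)) * (?e s y * w s) \<partial>lborel)
        = ennreal ?c * ennreal (?h s)"
      if s: "0 < s" "s < t"
    proof -
      have D: "0 < t powr q - s powr q"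
        using s q by (simp add: powr_less_mono2)
      have "clock p t - clock p s = (t powr q - s powr q) * (1 / q)"
        by (simp add: clock_def q_def diff_divide_distrib)
      then have clock: "clock p t - clock p s = (t powr q - s powr q) * (2 * a)"
        unfolding qa .
      have clock_pos: "0 < clock p t - clock p s" unfolding clock using D a by simp
      have "w s = ennreal (s powr (- p) * (moment_coeff a n * s powr ((real n - q) / 2)))"
        unfolding w_def using Suc.IH[OF s(1)] moment_coeff_pos[OF a, of n]
        by (simp add: ennreal_mult q_def)
      \<comment> \<open>Since \<open>- p = (q - 1) / 2\<close>, the Jacobian combines with
        \<open>(n - q) / 2\<close> to an exponent free of \<open>p\<close>.\<close>
      also have "s powr (- p) * (moment_coeff a n * s powr ((real n - q) / 2))
        = moment_coeff a n * s powr ((real n + 1) / 2 - 1)"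
      proof -
        have "s powr (- p) * s powr ((real n - q) / 2) = s powr ((real n + 1) / 2 - 1)"
          unfolding powr_add[symmetric] pq
            by (rule arg_cong[of _ _ "\<lambda>x. s powr x"]) (simp add: field_simps)
        then show ?thesis by simp
      qed
      finally have w: "w s = ennreal (moment_coeff a n * s powr ((real n + 1) / 2 - 1))" .
      have "(\<integral>\<^sup>+y. ennreal (1 / (2 * pi)) * (?e s y * w s) \<partial>lborel)
        = ennreal (1 / (2 * pi)) * ennreal (sqrt (2 * pi / (clock p t - clock p s))) * w s"
        using nn_integral_gaussian[OF clock_pos]
          by (simp add: nn_integral_cmult nn_integral_multc mult.assoc)
      also have "\<dots> = ennreal (1 / (2 * pi) * sqrt (2 * pi / (clock p t - clock p s))) * w s"
        using clock_pos by (subst ennreal_mult[symmetric]) auto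
      also have "1 / (2 * pi) * sqrt (2 * pi / (clock p t - clock p s))
        = ?b * (t powr q - s powr q) powr (- 1 / 2)"
      proof -
        have "1 / (2 * pi) * sqrt (2 * pi / (clock p t - clock p s))
          = sqrt (1 / (2 * pi) * (1 / (clock p t - clock p s)))"
          using clock_pos by (rule sqrt_gaussian_const)
        also have "1 / (2 * pi) * (1 / (clock p t - clock p s))
          = 1 / (4 * pi * a) * (t powr q - s powr q) powr (- 1)"
          unfolding clock using D a by (simp add: powr_minus field_simps)
        also have "sqrt \<dots> = ?b * (t powr q - s powr q) powr (- 1 / 2)"
          using D by (simp only: real_sqrt_mult sqrt_powr_half)
        finally show ?thesis .
      qed
      finally show ?thesis
        using a moment_coeff_pos[OF a, of n] unfolding w by (simp add: ac_simps flip: ennreal_mult)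
    qed
    then show "(\<integral>\<^sup>+y. ennreal (1 / (2 * pi)) * (indicator {0<..<t} s * (?e s y * w s)) \<partial>lborel)
        = ennreal ?c * (indicator {0<..<t} s * ennreal (?h s))"
      by (cases "s \<in> {0<..<t}") simp_all
  qed
  also have "\<dots> = ennreal ?c * (\<integral>\<^sup>+s. indicator {0<..<t} s * ennreal (?h s) \<partial>lborel)"
    by (rule nn_integral_cmult) measurable
  also have "(\<integral>\<^sup>+s. indicator {0<..<t} s * ennreal (?h s) \<partial>lborel)
      = ennreal (t powr ((real n + 1) / 2 - q / 2) / q * Beta ((real n + 1) / 2 / q) (1 / 2))"
    using q Suc.prems by (intro nn_integral_powr_Beta) auto
  also have "(real n + 1) / 2 / q = (real n + 1) / 2 * (1 / q)" by simp
  also have "\<dots> = real (Suc n) * a"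
    unfolding qa by (simp add: field_simps)
  also have "ennreal ?c * ennreal (t powr ((real n + 1) / 2 - q / 2) / q
    * Beta (real (Suc n) * a) (1 / 2))
      = ennreal (?c * (t powr ((real n + 1) / 2 - q / 2) / q * Beta (real (Suc n) * a) (1 / 2)))"
    using c by (rule ennreal_mult'[symmetric])
  also have "?c * (t powr ((real n + 1) / 2 - q / 2) / q * Beta (real (Suc n) * a) (1 / 2))
      = moment_coeff a (Suc n) * t powr ((real (Suc n) - (1 - 2 * p)) / 2)"
  proof -
    have "t powr ((real n + 1) / 2 - q / 2) / q
      = t powr ((real (Suc n) - (1 - 2 * p)) / 2) * (2 * a)"
    proof -
      have "t powr ((real n + 1) / 2 - q / 2) / q = t powr ((real n + 1) / 2 - q / 2) * (1 / q)"
        by simp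
      then show ?thesis
        unfolding qa q_def[symmetric] by (simp add: diff_divide_distrib add.commute)
    qed
    then show ?thesis
      unfolding moment_coeff_Suc[OF a] by simp
  qed
  finally show ?case .
qed

text \<open>At the latest time no combination has been built up: \<open>y = 0\<close>, the Gaussian
  factor is 1, and the time integral is that of a plain power. It yields \<open>2 / (n + 1)\<close>,
  which later reduces \<open>fact (Suc n)\<close> to \<open>2 * fact n\<close>.\<close>

lemma kac_zero_origin:
  fixes a p t :: real
  assumes a: "a > 0" and p: "1 - 2 * p = 1 / (2 * a)" and t: "t > 0"
  shows "kac 0 p (Suc n) t 0
    = ennreal (2 * moment_coeff a n * t powr ((real n + 1) / 2) / (real n + 1))"
proof -
  have "0 < 1 - 2 * p" unfolding p using a by simp
  then have p2: "p < 1 / 2" by simp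
  have c: "0 < moment_coeff a n" by (rule moment_coeff_pos[OF a])
  have "kac 0 p (Suc n) t 0
    = (\<integral>\<^sup>+s. ennreal (moment_coeff a n)
    * ennreal (indicator {0..t} s * s powr ((real n - 1) / 2)) \<partial>lborel)"
    unfolding kac_zero_Suc[OF p2]
  proof (intro nn_integral_cong_AE)
    show "AE s in lborel. indicator {0<..<t} s
      * (ennreal (exp (- (0\<^sup>2 * (clock p t - clock p s)) / 2)) *
        (ennreal (s powr (- p)) * (\<integral>\<^sup>+Y. ennreal (1 / (2 * pi)) * kac 0 p n s Y \<partial>lborel)))
      = ennreal (moment_coeff a n) * ennreal (indicator {0..t} s * s powr ((real n - 1) / 2))"
      using AE_lborel_singleton[of t]
    proof eventually_elim
      case (elim s)
      have "s powr (- p) * (moment_coeff a n * s powr ((real n - (1 - 2 * p)) / 2))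
        = moment_coeff a n * s powr ((real n - 1) / 2)"
      proof -
        have "s powr (- p) * s powr ((real n - (1 - 2 * p)) / 2) = s powr ((real n - 1) / 2)"
          unfolding powr_add[symmetric]
            by (rule arg_cong[of _ _ "\<lambda>x. s powr x"]) (simp add: field_simps)
        then show ?thesis by simp
      qed
      then show ?case
        using kac_zero_integral[OF a p, of s n] elim c t
        by (auto simp: indicator_def simp flip: ennreal_mult)
    qed
  qed
  also have "\<dots> = ennreal (moment_coeff a n)
    * (\<integral>\<^sup>+s. ennreal (indicator {0..t} s * s powr ((real n - 1) / 2)) \<partial>lborel)"
    by (rule nn_integral_cmult) measurable
  also have "(\<integral>\<^sup>+s. ennreal (indicator {0..t} s * s powr ((real n - 1) / 2)) \<partial>lborel)
      = ennreal (t powr ((real n - 1) / 2 + 1) / ((real n - 1) / 2 + 1))"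
    using t by (intro nn_integral_has_integral_lebesgue has_integral_powr_from_0) auto
  also have "ennreal (moment_coeff a n) * \<dots>
    = ennreal (moment_coeff a n * (t powr ((real n - 1) / 2 + 1) / ((real n - 1) / 2 + 1)))"
    using c by (intro ennreal_mult'[symmetric]) simp
  also have "(real n - 1) / 2 + 1 = (real n + 1) / 2" by (simp add: field_simps)
  also have "moment_coeff a n * (t powr ((real n + 1) / 2) / ((real n + 1) / 2))
      = 2 * moment_coeff a n * t powr ((real n + 1) / 2) / (real n + 1)" by simp
  finally show ?thesis .
qed

section \<open>From smoothed moments to moments of the limit\<close>

lemma tendsto_power_ennreal:
  fixes f :: "'a \<Rightarrow> ennreal"
  assumes "(f \<longlongrightarrow> x) F" "x < top"
  shows "((\<lambda>y. f y ^ n) \<longlongrightarrow> x ^ n) F"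
proof (induction n)
  case (Suc n)
  have "x ^ n < top" using assms(2) by (simp add: power_less_top_ennreal)
  then show ?case
    unfolding power_Suc using assms Suc by (intro tendsto_mult_ennreal) auto
qed simp

text \<open>Fatou gives one inequality. For the other the integrands are truncated at
  \<open>c\<close>: the next moment, whose limit is finite, bounds the error by
  \<open>m (Suc n) / c\<close>, and \<open>c\<close> tends to infinity.\<close>

lemma nn_integral_power_limit:
  fixes Z :: "nat \<Rightarrow> 'a \<Rightarrow> ennreal" and m :: "nat \<Rightarrow> ennreal"
  assumes "prob_space M" and [measurable]: "\<And>k. Z k \<in> borel_measurable M" "W \<in> borel_measurable M"
    and lim: "AE \<omega> in M. (\<lambda>k. Z k \<omega>) \<longlonglongrightarrow> W \<omega>" and W: "\<And>\<omega>. W \<omega> < top"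
    and m: "\<And>n. (\<lambda>k. \<integral>\<^sup>+\<omega>. Z k \<omega> ^ n \<partial>M) \<longlonglongrightarrow> m n" and fin: "\<And>n. m n < top"
  shows "(\<integral>\<^sup>+\<omega>. W \<omega> ^ n \<partial>M) = m n"
proof (rule antisym)
  interpret prob_space M by fact
  have pow: "AE \<omega> in M. (\<lambda>k. Z k \<omega> ^ n) \<longlonglongrightarrow> W \<omega> ^ n" for n
    using lim by eventually_elim (intro tendsto_power_ennreal W)
  have "(\<integral>\<^sup>+\<omega>. W \<omega> ^ n \<partial>M) = (\<integral>\<^sup>+\<omega>. liminf (\<lambda>k. Z k \<omega> ^ n) \<partial>M)"
    using pow[of n] by (intro nn_integral_cong_AE)
      (auto elim!: eventually_mono dest!: lim_imp_Liminf[rotated])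
  also have "\<dots> \<le> liminf (\<lambda>k. \<integral>\<^sup>+\<omega>. Z k \<omega> ^ n \<partial>M)"
    by (rule nn_integral_liminf) measurable
  also have "\<dots> = m n"
    using m by (intro lim_imp_Liminf) auto
  finally show "(\<integral>\<^sup>+\<omega>. W \<omega> ^ n \<partial>M) \<le> m n" .
  have trunc: "x ^ n \<le> min x (ennreal c) ^ n + ennreal (1 / c) * x ^ Suc n" if "c > 0"
    for x :: ennreal and c :: real
  proof (cases "x \<le> ennreal c")
    case True
    then show ?thesis by (simp add: min_absorb1)
  next
    case False
    then have "1 \<le> ennreal (1 / c) * x"
    proof -
      have "ennreal (1 / c) * ennreal c \<le> ennreal (1 / c) * x"
        using False by (intro mult_left_mono) auto
      then show ?thesis using that by (simp flip: ennreal_mult)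
    qed
    then have "1 * x ^ n \<le> (ennreal (1 / c) * x) * x ^ n" by (intro mult_right_mono) auto
    then show ?thesis by (simp add: mult.assoc add_increasing)
  qed
  have le: "m n \<le> (\<integral>\<^sup>+\<omega>. W \<omega> ^ n \<partial>M) + ennreal (1 / c) * m (Suc n)" if c: "c > 0" for c :: real
  proof -
    have "(\<lambda>k. \<integral>\<^sup>+\<omega>. min (Z k \<omega>) (ennreal c) ^ n \<partial>M) \<longlonglongrightarrow> (\<integral>\<^sup>+\<omega>. min (W \<omega>) (ennreal c) ^ n \<partial>M)"
    proof (rule nn_integral_dominated_convergence[where w = "\<lambda>_. ennreal c ^ n"])
      show "AE \<omega> in M. min (Z k \<omega>) (ennreal c) ^ n \<le> ennreal c ^ n" for k
        by (intro AE_I2 power_mono) auto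
      show "AE \<omega> in M. (\<lambda>k. min (Z k \<omega>) (ennreal c) ^ n) \<longlonglongrightarrow> min (W \<omega>) (ennreal c) ^ n"
        using lim by eventually_elim
          (intro tendsto_power_ennreal tendsto_min tendsto_const, auto simp: W min_less_iff_disj)
    qed (auto simp: emeasure_space_1 power_less_top_ennreal)
    then have rhs: "(\<lambda>k. (\<integral>\<^sup>+\<omega>. min (Z k \<omega>) (ennreal c) ^ n \<partial>M) + ennreal (1 / c)
      * (\<integral>\<^sup>+\<omega>. Z k \<omega> ^ Suc n \<partial>M))
        \<longlonglongrightarrow> (\<integral>\<^sup>+\<omega>. min (W \<omega>) (ennreal c) ^ n \<partial>M) + ennreal (1 / c) * m (Suc n)"
      using c fin[of "Suc n"] by (intro tendsto_add tendsto_mult_ennreal tendsto_const m) auto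
    have "(\<integral>\<^sup>+\<omega>. Z k \<omega> ^ n \<partial>M)
      \<le> (\<integral>\<^sup>+\<omega>. min (Z k \<omega>) (ennreal c) ^ n \<partial>M) + ennreal (1 / c) * (\<integral>\<^sup>+\<omega>. Z k \<omega> ^ Suc n \<partial>M)" for k
    proof -
      have "(\<integral>\<^sup>+\<omega>. Z k \<omega> ^ n \<partial>M)
        \<le> (\<integral>\<^sup>+\<omega>. min (Z k \<omega>) (ennreal c) ^ n + ennreal (1 / c) * Z k \<omega> ^ Suc n \<partial>M)"
        by (intro nn_integral_mono trunc c)
      also have "\<dots> = (\<integral>\<^sup>+\<omega>. min (Z k \<omega>) (ennreal c) ^ n \<partial>M) + ennreal (1 / c)
        * (\<integral>\<^sup>+\<omega>. Z k \<omega> ^ Suc n \<partial>M)"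
        by (simp add: nn_integral_add nn_integral_cmult)
      finally show ?thesis .
    qed
    then have "m n \<le> (\<integral>\<^sup>+\<omega>. min (W \<omega>) (ennreal c) ^ n \<partial>M) + ennreal (1 / c) * m (Suc n)"
      by (intro LIMSEQ_le[OF m rhs]) auto
    also have "\<dots> \<le> (\<integral>\<^sup>+\<omega>. W \<omega> ^ n \<partial>M) + ennreal (1 / c) * m (Suc n)"
      by (intro add_mono order_refl nn_integral_mono power_mono) auto
    finally show ?thesis .
  qed
  have "(\<lambda>k. 1 / real (Suc k)) \<longlonglongrightarrow> 0"
    by (rule LIMSEQ_Suc[OF lim_1_over_n])
  then have "(\<lambda>k. (\<integral>\<^sup>+\<omega>. W \<omega> ^ n \<partial>M) + ennreal (1 / real (Suc k)) * m (Suc n))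
    \<longlonglongrightarrow> (\<integral>\<^sup>+\<omega>. W \<omega> ^ n \<partial>M) + ennreal 0 * m (Suc n)"
    using fin[of "Suc n"] by (intro tendsto_add tendsto_mult_ennreal tendsto_const tendsto_ennrealI)
      auto
  then show "m n \<le> (\<integral>\<^sup>+\<omega>. W \<omega> ^ n \<partial>M)"
    using le[of "real (Suc k)" for k] by (intro LIMSEQ_le_const) (auto simp del: of_nat_Suc)
qed

text \<open>The derivative of the density at \<open>u\<close> is
  \<open>- u * std_normal_density u\<close>. The Gaussian kernel is thereby a superposition of
  indicators of windows, which links it to the occupation times defining the local time.\<close>

lemma nn_integral_mult_std_normal_density_tail:
  assumes "0 \<le> x"
  shows "(\<integral>\<^sup>+u. ennreal (u * std_normal_density u) * indicator {x..} u \<partial>lborel)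
    = ennreal (std_normal_density x)"
proof -
  have "(\<integral>\<^sup>+u. ennreal (u * std_normal_density u) * indicator {x..} u \<partial>lborel)
    = ennreal (0 - (- std_normal_density x))"
  proof (rule nn_integral_FTC_atLeast)
    have deriv: "((\<lambda>u. - (c * exp (- u\<^sup>2 / 2))) has_real_derivative u
      * (c * exp (- u\<^sup>2 / 2))) (at u)" for c u :: real
      by (auto intro!: derivative_eq_intros simp: power2_eq_square)
    show "((\<lambda>u. - std_normal_density u) has_real_derivative u * std_normal_density u) (at u)" for u
      unfolding std_normal_density_def by (rule deriv)
    show "((\<lambda>u. - std_normal_density u) \<longlongrightarrow> 0) at_top"
      unfolding std_normal_density_def by real_asymp
  qed (use assms in auto)
  then show ?thesis by simp
qed

text \<open>Half of the variance 1 lies on each side of 0, hence the factor 2. The mixing weights of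
  the window widths thus have total mass 1, so the mixture keeps the limit \<open>L\<close>.\<close>

lemma nn_integral_square_std_normal_density_pos:
  "(\<integral>\<^sup>+u. ennreal (2 * u\<^sup>2 * std_normal_density u) * indicator {0<..} u \<partial>lborel) = 1"
proof -
  let ?f = "\<lambda>u. ennreal (2 * u\<^sup>2 * std_normal_density u)"
  let ?T = "\<integral>\<^sup>+u. ?f u * indicator {0<..} u \<partial>lborel"
  have "has_bochner_integral lborel (\<lambda>u. 2 * (std_normal_density u * (u - 0) ^ (2 * 1))) (2
    * (fact (2 * 1) / ((2 / 1\<^sup>2) ^ 1 * fact 1)))"
    by (intro has_bochner_integral_mult_right normal_moment_even) simp
  also have "(\<lambda>u. 2 * (std_normal_density u * (u - 0) ^ (2 * 1)))
    = (\<lambda>u. 2 * u\<^sup>2 * std_normal_density u)"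
    by (simp add: fun_eq_iff)
  finally have "(\<integral>\<^sup>+u. ?f u \<partial>lborel) = ennreal 2"
    by (subst nn_integral_eq_integral) (auto simp: has_bochner_integral_iff)
  also have "(\<integral>\<^sup>+u. ?f u \<partial>lborel)
    = (\<integral>\<^sup>+u. ?f u * indicator {0<..} u + ?f u * indicator {..<0} u \<partial>lborel)"
    by (intro nn_integral_cong) (auto simp: indicator_def)
  also have "\<dots> = ?T + (\<integral>\<^sup>+u. ?f u * indicator {..<0} u \<partial>lborel)"
    by (rule nn_integral_add) auto
  also have "(\<integral>\<^sup>+u. ?f u * indicator {..<0} u \<partial>lborel)
    = ennreal \<bar>- 1\<bar> * (\<integral>\<^sup>+u. ?f (0 + (- 1) * u) * indicator {..<0} (0 + (- 1) * u) \<partial>lborel)"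
    by (rule nn_integral_real_affine) auto
  also have "\<dots> = ?T"
    by (auto simp: normal_density_def indicator_def intro!: nn_integral_cong)
  finally have "?T + ?T = 2" by simp
  then show ?thesis
    by (cases ?T) (auto simp flip: ennreal_plus ennreal_numeral)
qed

text \<open>The Gaussian kernel is a mixture of the kernels \<open>1 / (2 \<epsilon>) * indicator {-\<epsilon>..\<epsilon>}\<close>, so that
  smoothing the local time with it gives the same limit.\<close>

lemma gaussian_occupation_limit:
  fixes r :: "real \<Rightarrow> real"
  assumes [measurable]: "r \<in> borel_measurable borel" and t: "t > 0"
    and lim: "((\<lambda>\<epsilon>. 1 / (2 * \<epsilon>) * (LBINT s:{0..t}. indicator {..\<epsilon>} \<bar>r s\<bar>)) \<longlongrightarrow> L) (at_right 0)"
  shows "0 \<le> L"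
    and "(\<lambda>k. \<integral>\<^sup>+s. indicator {0<..<t} s * ennreal (normal_density 0 (1 / Suc k) (r s)) \<partial>lborel)
      \<longlonglongrightarrow> ennreal L"
proof -
  define A where "A x = (LBINT s:{0..t}. indicator {..x} \<bar>r s\<bar> :: real)" for x :: real
  define avg where "avg x = 1 / (2 * x) * A x" for x
  have A_nn: "(\<integral>\<^sup>+s. indicator {0<..<t} s * indicator {..x} \<bar>r s\<bar> \<partial>lborel) = ennreal (A x)" for x
  proof -
    have int: "integrable lborel (\<lambda>s. indicator {0..t} s * indicator {..x} \<bar>r s\<bar> :: real)"
    proof (rule Bochner_Integration.integrable_bound)
      show "integrable lborel (indicator {0..t} :: real \<Rightarrow> real)"
        using t by (intro integrable_real_indicator) auto
    qed (auto simp: indicator_def)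
    have "(\<integral>\<^sup>+s. indicator {0<..<t} s * indicator {..x} \<bar>r s\<bar> \<partial>lborel)
        = (\<integral>\<^sup>+s. ennreal (indicator {0..t} s * indicator {..x} \<bar>r s\<bar>) \<partial>lborel)"
    proof (intro nn_integral_cong_AE)
      show "AE s in lborel. indicator {0<..<t} s * indicator {..x} \<bar>r s\<bar>
        = ennreal (indicator {0..t} s * indicator {..x} \<bar>r s\<bar>)"
        using AE_lborel_singleton[of 0] AE_lborel_singleton[of t]
        by eventually_elim (auto simp: indicator_def)
    qed
    also have "\<dots> = ennreal (A x)"
      unfolding A_def set_lebesgue_integral_def using int by (subst nn_integral_eq_integral) auto
    finally show ?thesis .
  qed
  have A_nonneg: "0 \<le> A x" for x
    unfolding A_def set_lebesgue_integral_def by (intro integral_nonneg_AE) auto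
  have A_le: "A x \<le> t" for x
  proof -
    have "ennreal (A x) \<le> (\<integral>\<^sup>+s. indicator {0<..<t} s \<partial>lborel)"
      unfolding A_nn[symmetric] by (intro nn_integral_mono) (auto simp: indicator_def)
    then show ?thesis using t by simp
  qed
  have avg: "0 \<le> avg x" if "0 < x" for x using A_nonneg[of x] that by (simp add: avg_def)
  have lim': "(avg \<longlongrightarrow> L) (at_right 0)"
    using lim by (simp add: avg_def[abs_def] A_def)
  have ev_pos: "\<forall>\<^sub>F x in at_right 0. 0 < (x::real)"
    by (simp add: eventually_at_right_less)
  show L: "0 \<le> L"
    using lim' ev_pos by (intro tendsto_lowerbound) (auto elim!: eventually_mono intro: avg)
  have "\<forall>\<^sub>F x in at_right 0. avg x < L + 1"
    using lim' by (intro order_tendstoD) auto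
  then obtain \<delta> where \<delta>: "0 < \<delta>" "\<And>x. 0 < x \<Longrightarrow> x < \<delta> \<Longrightarrow> avg x < L + 1"
    by (auto simp: eventually_at_right_field)
  \<comment> \<open>Dominates \<open>avg\<close> at all widths: below \<open>\<delta>\<close>
    through the assumed limit, from \<open>\<delta>\<close> on because the occupation time never
    exceeds \<open>t\<close>.\<close>
  define K where "K = L + 1 + t / (2 * \<delta>)"
  have K: "avg x \<le> K" if "0 < x" for x
  proof (cases "x < \<delta>")
    case True
    then have "avg x < L + 1" by (rule \<delta>(2)[OF that])
    moreover have "0 \<le> t / (2 * \<delta>)" using t \<delta> by simp
    ultimately show ?thesis unfolding K_def by linarith
  next
    case False
    have "avg x = A x / (2 * x)" by (simp add: avg_def)
    also have "\<dots> \<le> t / (2 * \<delta>)"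
      using A_le[of x] A_nonneg[of x] False \<delta> that by (intro frac_le) auto
    finally show ?thesis using L unfolding K_def by linarith
  qed
  have [measurable]: "avg \<in> borel_measurable borel"
    unfolding avg_def A_def set_lebesgue_integral_def indicator_def atMost_iff atLeastAtMost_iff
      of_bool_def by measurable
  \<comment> \<open>A window of half-width \<open>\<epsilon> * u\<close> carries weight
    \<open>u * std_normal_density u / \<epsilon>\<close>; normalising it by
    \<open>2 * \<epsilon> * u\<close> produces the 2 and the second factor \<open>u\<close>.\<close>
  let ?w = "\<lambda>u. 2 * u\<^sup>2 * std_normal_density u"
  have smooth: "(\<integral>\<^sup>+s. indicator {0<..<t} s * ennreal (normal_density 0 \<epsilon> (r s)) \<partial>lborel)
      = (\<integral>\<^sup>+u. ennreal (?w u * avg (\<epsilon> * u)) * indicator {0<..} u \<partial>lborel)" if \<epsilon>: "0 < \<epsilon>" for \<epsilon>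
  proof -
    let ?v = "\<lambda>u. ennreal (1 / \<epsilon> * (u * std_normal_density u))"
    let ?b = "\<lambda>s u. indicator {0<..<t} s * indicator {..\<epsilon> * u} \<bar>r s\<bar>"
    have "(\<integral>\<^sup>+s. indicator {0<..<t} s * ennreal (normal_density 0 \<epsilon> (r s)) \<partial>lborel)
        = (\<integral>\<^sup>+s. (\<integral>\<^sup>+u. indicator {0<..<t} s * (?v u * indicator {\<bar>r s\<bar> / \<epsilon>..} u) \<partial>lborel) \<partial>lborel)"
    proof (intro nn_integral_cong)
      fix s
      have "normal_density 0 \<epsilon> (r s) = 1 / \<epsilon> * std_normal_density (\<bar>r s\<bar> / \<epsilon>)"
        using \<epsilon> by (simp add: normal_density_def power_divide real_sqrt_mult ac_simps)
      then have "ennreal (normal_density 0 \<epsilon> (r s))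
        = ennreal (1 / \<epsilon>) * ennreal (std_normal_density (\<bar>r s\<bar> / \<epsilon>))"
        using \<epsilon> by (simp only:) (intro ennreal_mult', simp)
      also have "ennreal (std_normal_density (\<bar>r s\<bar> / \<epsilon>))
        = (\<integral>\<^sup>+u. ennreal (u * std_normal_density u) * indicator {\<bar>r s\<bar> / \<epsilon>..} u \<partial>lborel)"
        using \<epsilon> nn_integral_mult_std_normal_density_tail[of "\<bar>r s\<bar> / \<epsilon>"] by simp
      also have "ennreal (1 / \<epsilon>) * \<dots> = (\<integral>\<^sup>+u. ?v u * indicator {\<bar>r s\<bar> / \<epsilon>..} u \<partial>lborel)"
      proof -
        have "?v u = ennreal (1 / \<epsilon>) * ennreal (u * std_normal_density u)" for u
          using \<epsilon> by (intro ennreal_mult') simp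
        then show ?thesis
          by (simp only: mult.assoc) (rule nn_integral_cmult[symmetric], measurable)
      qed
      finally show "indicator {0<..<t} s * ennreal (normal_density 0 \<epsilon> (r s))
          = (\<integral>\<^sup>+u. indicator {0<..<t} s * (?v u * indicator {\<bar>r s\<bar> / \<epsilon>..} u) \<partial>lborel)"
        by (simp add: nn_integral_cmult)
    qed
    also have "\<dots> = (\<integral>\<^sup>+s. (\<integral>\<^sup>+u. ?v u * indicator {0<..} u * ?b s u \<partial>lborel) \<partial>lborel)"
    proof (rule nn_integral_cong, rule nn_integral_cong_AE)
      fix s
      show "AE u in lborel. indicator {0<..<t} s * (?v u * indicator {\<bar>r s\<bar> / \<epsilon>..} u)
          = ?v u * indicator {0<..} u * ?b s u"
        using AE_lborel_singleton[of 0]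
      proof eventually_elim
        case (elim u)
        have "\<bar>r s\<bar> / \<epsilon> \<le> u \<longleftrightarrow> 0 < u \<and> \<bar>r s\<bar> \<le> \<epsilon> * u"
        proof
          assume "\<bar>r s\<bar> / \<epsilon> \<le> u"
          moreover have "0 \<le> \<bar>r s\<bar> / \<epsilon>" using \<epsilon> by simp
          ultimately have "0 < u" using elim by linarith
          with \<open>\<bar>r s\<bar> / \<epsilon> \<le> u\<close> show "0 < u \<and> \<bar>r s\<bar> \<le> \<epsilon> * u" using \<epsilon> by (simp add: field_simps)
        qed (use \<epsilon> in \<open>simp add: field_simps\<close>)
        then show ?case by (simp add: indicator_def)
      qed
    qed
    also have "\<dots> = (\<integral>\<^sup>+u. (\<integral>\<^sup>+s. ?v u * indicator {0<..} u * ?b s u \<partial>lborel) \<partial>lborel)"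
      unfolding indicator_def atMost_iff greaterThan_iff greaterThanLessThan_iff of_bool_def
      by (rule lborel_pair.Fubini') measurable
    also have "\<dots> = (\<integral>\<^sup>+u. ennreal (?w u * avg (\<epsilon> * u)) * indicator {0<..} u \<partial>lborel)"
    proof (intro nn_integral_cong)
      fix u
      have "(\<integral>\<^sup>+s. ?v u * indicator {0<..} u * ?b s u \<partial>lborel)
          = ?v u * indicator {0<..} u * ennreal (A (\<epsilon> * u))"
        unfolding A_nn[symmetric] by (rule nn_integral_cmult) measurable
      also have "\<dots> = ennreal (?w u * avg (\<epsilon> * u)) * indicator {0<..} u"
      proof (cases "0 < u")
        case True
        have "1 / \<epsilon> * (u * std_normal_density u) * A (\<epsilon> * u) = ?w u * avg (\<epsilon> * u)"
          using True \<epsilon> by (simp add: avg_def power2_eq_square)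
        then show ?thesis
          using True \<epsilon> A_nonneg[of "\<epsilon> * u"] by (simp flip: ennreal_mult)
      qed simp
      finally show "(\<integral>\<^sup>+s. ?v u * indicator {0<..} u * ?b s u \<partial>lborel)
          = ennreal (?w u * avg (\<epsilon> * u)) * indicator {0<..} u" .
    qed
    finally show ?thesis .
  qed
  have "(\<lambda>k. \<integral>\<^sup>+u. ennreal (?w u * avg (1 / Suc k * u)) * indicator {0<..} u \<partial>lborel)
      \<longlonglongrightarrow> (\<integral>\<^sup>+u. ennreal (?w u * L) * indicator {0<..} u \<partial>lborel)"
  proof (rule nn_integral_dominated_convergence[where w
    = "\<lambda>u. ennreal K * (ennreal (?w u) * indicator {0<..} u)"])
    show "AE u in lborel. ennreal (?w u * avg (1 / Suc k * u)) * indicator {0<..} u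
      \<le> ennreal K * (ennreal (?w u) * indicator {0<..} u)" for k
    proof (intro AE_I2)
      fix u
      show "ennreal (?w u * avg (1 / Suc k * u)) * indicator {0<..} u
        \<le> ennreal K * (ennreal (?w u) * indicator {0<..} u)"
      proof (cases "0 < u")
        case True
        then have pos: "0 < 1 / Suc k * u" by simp
        then have "?w u * avg (1 / Suc k * u) \<le> ?w u * K"
          using True by (intro mult_left_mono K) auto
        moreover have "0 \<le> K" using K[OF pos] avg[OF pos] by linarith
        ultimately show ?thesis
          using True by (simp add: ennreal_mult'[symmetric] ennreal_leI mult.commute)
      qed simp
    qed
    show "(\<integral>\<^sup>+u. ennreal K * (ennreal (?w u) * indicator {0<..} u) \<partial>lborel) < \<infinity>"
      by (subst nn_integral_cmult) (auto simp: nn_integral_square_std_normal_density_pos)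
    show "AE u in lborel. (\<lambda>k. ennreal (?w u * avg (1 / Suc k * u)) * indicator {0<..} u)
      \<longlonglongrightarrow> ennreal (?w u * L) * indicator {0<..} u"
    proof (intro AE_I2)
      fix u :: real
      show "(\<lambda>k. ennreal (?w u * avg (1 / Suc k * u)) * indicator {0<..} u)
        \<longlonglongrightarrow> ennreal (?w u * L) * indicator {0<..} u"
      proof (cases "0 < u")
        case True
        have "(\<lambda>k. 1 / real (Suc k) * u) \<longlonglongrightarrow> 0 * u"
          by (intro tendsto_mult tendsto_const LIMSEQ_Suc[OF lim_1_over_n])
        then have "filterlim (\<lambda>k. 1 / real (Suc k) * u) (at_right 0) sequentially"
          using True by (auto simp: filterlim_at intro!: always_eventually)
        from filterlim_compose[OF lim' this]
        have "(\<lambda>k. ?w u * avg (1 / Suc k * u)) \<longlonglongrightarrow> ?w u * L"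
          by (intro tendsto_mult tendsto_const)
        with True show ?thesis by (auto intro!: tendsto_ennrealI)
      qed simp
    qed
  qed measurable
  also have "(\<integral>\<^sup>+u. ennreal (?w u * L) * indicator {0<..} u \<partial>lborel) = ennreal L"
  proof -
    have "(\<integral>\<^sup>+u. ennreal (?w u * L) * indicator {0<..} u \<partial>lborel)
      = (\<integral>\<^sup>+u. ennreal L * (ennreal (?w u) * indicator {0<..} u) \<partial>lborel)"
      using L by (intro nn_integral_cong) (auto simp: ennreal_mult'' ac_simps)
    also have "\<dots> = ennreal L"
      by (subst nn_integral_cmult) (auto simp: nn_integral_square_std_normal_density_pos)
    finally show ?thesis .
  qed
  finally show "(\<lambda>k. \<integral>\<^sup>+s. indicator {0<..<t} s
    * ennreal (normal_density 0 (1 / Suc k) (r s)) \<partial>lborel) \<longlonglongrightarrow> ennreal L"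
    by (simp add: smooth)
qed

subsection \<open>The law of the tilted local time\<close>

definition cost_moment :: "real \<Rightarrow> nat \<Rightarrow> real" where
  "cost_moment a n = fact n / 2 powr (real n / 2) *
     (\<Prod>k=1..n. Gamma_half_ratio (real k * a))"

text \<open>Division by \<open>fact n\<close> leaves a product whose factors are multiples of Gamma
  ratios at \<open>k * a\<close> and tend to 0.\<close>

lemma cost_moment_growth:
  assumes "a > 0"
  shows "(\<lambda>n. x ^ n * cost_moment a n / fact n) \<longlonglongrightarrow> 0"
proof -
  have "filterlim (\<lambda>k. real k * a) at_top sequentially"
    using assms by (intro filterlim_at_top_mult_tendsto_pos[OF tendsto_const]
      filterlim_real_sequentially)
      (simp_all add: mult.commute)
  then have "(\<lambda>k. Gamma_half_ratio (real k * a)) \<longlonglongrightarrow> 0"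
    by (rule filterlim_compose[OF Gamma_half_ratio_tendsto_0])
  then have "(\<lambda>k. x / sqrt 2 * Gamma_half_ratio (real k * a)) \<longlonglongrightarrow> 0"
    by (rule tendsto_mult_right_zero)
  then have "(\<lambda>n. \<Prod>k=1..n. x / sqrt 2 * Gamma_half_ratio (real k * a)) \<longlonglongrightarrow> 0"
    by (rule prod_null_seq_tendsto_0)
  moreover have "2 powr (real n / 2) = sqrt 2 ^ n" for n
    by (rule powr_half_real_of_nat) simp
  then have "x ^ n * cost_moment a n / fact n
      = (\<Prod>k=1..n. x / sqrt 2 * Gamma_half_ratio (real k * a))" for n
    unfolding cost_moment_def prod.distrib by (simp add: power_divide)
  ultimately show ?thesis by simp
qed

lemma distr_eqI_cost_moment:
  assumes "a > 0" and N: "prob_space N" and [measurable]: "Y \<in> borel_measurable N"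
    and Y: "AE \<omega> in N. 0 \<le> Y \<omega>"
    and mY: "\<And>n. n \<ge> 1 \<Longrightarrow> has_bochner_integral N (\<lambda>\<omega>. Y \<omega> ^ n) (cost_moment a n)"
    and \<nu>: "real_distribution \<nu>" "AE x in \<nu>. 0 \<le> x"
    and m\<nu>: "\<And>n. n \<ge> 1 \<Longrightarrow> has_bochner_integral \<nu> (\<lambda>x. x ^ n) (cost_moment a n)"
  shows "distr N borel Y = \<nu>"
proof (rule real_distribution_eqI_moments[where m = "cost_moment a"])
  interpret N: prob_space N by fact
  interpret V: real_distribution \<nu> by fact
  show "real_distribution (distr N borel Y)" by simp
  show "AE x in distr N borel Y. 0 \<le> x"
    using Y by (subst AE_distr_iff) auto
  have one: "cost_moment a 0 = 1" by (simp add: cost_moment_def)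
  show "has_bochner_integral (distr N borel Y) (\<lambda>x. x ^ n) (cost_moment a n)" for n
  proof (rule has_bochner_integral_distr)
    show "has_bochner_integral N (\<lambda>\<omega>. Y \<omega> ^ n) (cost_moment a n)"
      using mY[of n] N.prob_space by (cases n) (simp_all add: has_bochner_integral_iff one)
  qed auto
  show "has_bochner_integral \<nu> (\<lambda>x. x ^ n) (cost_moment a n)" for n
    using m\<nu>[of n] V.prob_space by (cases n) (simp_all add: has_bochner_integral_iff one)
  show "(\<lambda>n. t ^ n * cost_moment a n / fact n) \<longlonglongrightarrow> 0" for t
    by (rule cost_moment_growth[OF \<open>a > 0\<close>])
qed (use \<nu> in auto)

text \<open>The case of an empty list of later times, where the cosine and the exponential prefactor
  are 1; the a priori bounds turn the real integrals back into nonnegative ones.\<close>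

lemma nn_integral_ordered_integral_origin:
  fixes X :: "real \<Rightarrow> 'a \<Rightarrow> real" and p \<epsilon> :: real
  assumes M: "prob_space M" and X: "(\<lambda>(\<omega>, t). X t \<omega>) \<in> borel_measurable (M \<Otimes>\<^sub>M borel)"
    and fourier: "\<And>l. (\<And>x. x \<in> set l \<Longrightarrow> 0 < snd x) \<Longrightarrow>
      (\<integral>\<omega>. cos (lincomb (\<lambda>u. X u \<omega>) l) \<partial>M) = exp (- quadform (nrbm_cov p) l / 2)"
    and p: "p < 1 / 2" and \<epsilon>: "\<epsilon> > 0" and t: "t > 0"
  defines "f \<equiv> \<lambda>\<omega> s. indicator {0<..} s * ennreal (normal_density 0 \<epsilon> (X s \<omega>))"
  shows "(\<integral>\<^sup>+\<omega>. ordered_integral (- 1) (f \<omega>) n t \<partial>M) = kac \<epsilon> p n t 0"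
proof -
  interpret prob_space M by fact
  have f: "(\<lambda>(\<omega>, s). f \<omega> s) \<in> borel_measurable (M \<Otimes>\<^sub>M borel)"
    unfolding f_def by (rule measurable_smoothed_path[OF X])
  let ?C = "normal_density 0 \<epsilon> 0" and ?J = "\<lambda>\<omega>. ordered_integral (- 1) (f \<omega>) n t"
  have [measurable]: "?J \<in> borel_measurable M"
    using measurable_compose[OF measurable_Pair2'[of t borel M]
      measurable_ordered_integral_param[OF f]] by simp
  note dens = normal_density_le_mean[of 0 \<epsilon>]
  have J_le: "?J \<omega> \<le> ennreal ((?C * t) ^ n)" for \<omega>
    using t dens by (intro ordered_integral_bound)
      (auto simp: f_def indicator_def intro: ennreal_leI)
  have V_le: "kac \<epsilon> p n t 0 \<le> ennreal ((?C * t) ^ n)"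
    using t \<epsilon> p by (intro kac_bound) auto
  note fin = ennreal_enn2real_le_ennreal
  have "integrable M (\<lambda>\<omega>. enn2real (?J \<omega>))"
  proof (rule integrable_const_bound[where B = "(?C * t) ^ n"])
    show "AE \<omega> in M. norm (enn2real (?J \<omega>)) \<le> (?C * t) ^ n"
      using J_le t by (intro AE_I2) (simp add: enn2real_leI)
  qed measurable
  then have "(\<integral>\<^sup>+\<omega>. ennreal (enn2real (?J \<omega>)) \<partial>M) = ennreal (\<integral>\<omega>. enn2real (?J \<omega>) \<partial>M)"
    by (intro nn_integral_eq_integral) auto
  also have "(\<integral>\<omega>. enn2real (?J \<omega>) \<partial>M) = enn2real (kac \<epsilon> p n t 0)"
    using fourier_ordered_integral[OF M X fourier p \<epsilon> t, of "[]" n] by (simp add: f_def)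
  finally show "(\<integral>\<^sup>+\<omega>. ?J \<omega> \<partial>M) = kac \<epsilon> p n t 0"
    by (simp add: fin[OF J_le] fin[OF V_le])
qed

text \<open>The smoothed local times \<open>Z k\<close> converge almost surely to \<open>L\<close>;
  their \<open>n\<close>-th moments are \<open>fact n\<close> times \<open>kac\<close> at width
  \<open>1 / Suc k\<close> and \<open>y = 0\<close>, and these converge to the explicit values at
  width 0. For order \<open>Suc n\<close> the latest time contributes \<open>1 / (n + 1)\<close>,
  which leaves \<open>fact n\<close>.\<close>

lemma local_time_moments:
  fixes M :: "'a measure" and a p t :: real
  assumes R: "noise_reinforced_bessel1 M p R" and t: "t > 0" and L: "local_time_at_0 M R t L"
    and a: "a > 0" and pa: "1 - 2 * p = 1 / (2 * a)"
  shows "prob_space M" and "AE \<omega> in M. 0 \<le> L \<omega>"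
    and "has_bochner_integral M (\<lambda>\<omega>. L \<omega> ^ Suc n) (2 * fact n * moment_coeff a n
      * t powr ((real n + 1) / 2))"
    (is "has_bochner_integral M _ ?m")
proof -
  from R obtain B Bh where BM: "standard_brownian_motion M B"
    and Bh: "noise_reinforced_brownian_motion M B p Bh"
    and R_eq: "\<And>s \<omega>. s \<ge> 0 \<Longrightarrow> \<omega> \<in> space M \<Longrightarrow> R s \<omega> = \<bar>Bh s \<omega>\<bar>"
    unfolding noise_reinforced_bessel1_def by blast
  interpret prob_space M
    using BM by (simp add: standard_brownian_motion_def process_def)
  show "prob_space M" by (rule prob_space_axioms)
  have "0 < 1 - 2 * p" unfolding pa using a by simp
  then have p: "p < 1 / 2" by simp
  have Lm [measurable]: "L \<in> borel_measurable M"
    using L by (simp add: local_time_at_0_def)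
  have Bhm: "Bh s \<in> borel_measurable M" if "s \<ge> 0" for s
    using Bh that by (simp add: noise_reinforced_brownian_motion_def process_def)
  have "AE \<omega> in M. continuous_on {0..} (\<lambda>t. Bh t \<omega>)"
    using Bh by (simp add: noise_reinforced_brownian_motion_def)
  then have "AE \<omega> in M. \<forall>s\<ge>0. ((\<lambda>u. Bh u \<omega>) \<longlongrightarrow> Bh s \<omega>) (at_right s)"
  proof eventually_elim
    case (elim \<omega>)
    then show ?case
      by (auto simp: continuous_on_def intro: tendsto_within_subset)
  qed
  \<comment> \<open>\<open>X\<close> replaces \<open>Bh\<close> wherever joint measurability in path
    and time is used.\<close>
  from right_continuous_modification[OF Bhm this] obtain X
    where X: "(\<lambda>(\<omega>, t). X t \<omega>) \<in> borel_measurable (M \<Otimes>\<^sub>M borel)"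
    and X_eq: "AE \<omega> in M. \<forall>t\<ge>0. X t \<omega> = Bh t \<omega>" by blast
  have [measurable]: "X s \<in> borel_measurable M" for s
    using measurable_compose[OF measurable_Pair2'[of s borel M] X] by simp
  have fourier: "(\<integral>\<omega>. cos (lincomb (\<lambda>u. X u \<omega>) l) \<partial>M) = exp (- quadform (nrbm_cov p) l / 2)"
    if l: "\<And>x. x \<in> set l \<Longrightarrow> 0 < snd x" for l
  proof -
    have [measurable]: "(\<lambda>\<omega>. lincomb (\<lambda>u. X u \<omega>) l) \<in> borel_measurable M"
      by (intro measurable_lincomb) measurable
    have [measurable]: "(\<lambda>\<omega>. lincomb (\<lambda>u. Bh u \<omega>) l) \<in> borel_measurable M"
      using l by (intro measurable_lincomb Bhm) force
    have "(\<integral>\<omega>. cos (lincomb (\<lambda>u. X u \<omega>) l) \<partial>M) = (\<integral>\<omega>. cos (lincomb (\<lambda>u. Bh u \<omega>) l) \<partial>M)"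
    proof (rule integral_cong_AE)
      show "AE \<omega> in M. cos (lincomb (\<lambda>u. X u \<omega>) l) = cos (lincomb (\<lambda>u. Bh u \<omega>) l)"
        using X_eq
      proof eventually_elim
        case (elim \<omega>)
        then have "lincomb (\<lambda>u. X u \<omega>) l = lincomb (\<lambda>u. Bh u \<omega>) l"
          using l by (intro lincomb_cong) (simp add: less_imp_le)
        then show ?case by simp
      qed
    qed measurable
    also have "\<dots> = Re (CLINT \<omega>|M. iexp (lincomb (\<lambda>u. Bh u \<omega>) l))"
    proof -
      have "integrable M (\<lambda>\<omega>. iexp (lincomb (\<lambda>u. Bh u \<omega>) l))"
        by (intro integrable_iexp) auto
      from integral_Re[OF this] show ?thesis by (simp add: Re_exp)
    qed
    also have "\<dots> = exp (- quadform (nrbm_cov p) l / 2)"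
      using nrbm_fourier[OF BM Bh p l] by simp
    finally show ?thesis .
  qed
  define f where "f k \<omega> s = indicator {0<..} s * ennreal (normal_density 0 (1 / Suc k) (X s \<omega>))"
    for k :: nat and \<omega> s
  define Z where "Z k \<omega> = (\<integral>\<^sup>+s. indicator {0<..<t} s
    * ennreal (normal_density 0 (1 / Suc k) (X s \<omega>)) \<partial>lborel)" for k :: nat and \<omega>
  have f: "(\<lambda>(\<omega>, s). f k \<omega> s) \<in> borel_measurable (M \<Otimes>\<^sub>M borel)" for k
    unfolding f_def by (rule measurable_smoothed_path[OF X])
  have J: "(\<integral>\<^sup>+\<omega>. ordered_integral (- 1) (f k \<omega>) n t \<partial>M) = kac (1 / Suc k) p n t 0" for k n
    unfolding f_def using nn_integral_ordered_integral_origin[OF prob_space_axioms X fourier p _ t,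
      of "1 / Suc k" n] by simp
  have Jm [measurable]: "(\<lambda>\<omega>. ordered_integral (- 1) (f k \<omega>) n t) \<in> borel_measurable M" for k n
    using measurable_compose[OF measurable_Pair2'[of t borel M]
      measurable_ordered_integral_param[OF f]] by simp
  have Z_pow: "Z k \<omega> ^ n = fact n * ordered_integral (- 1) (f k \<omega>) n t" if "\<omega> \<in> space M" for k n \<omega>
  proof -
    have "f k \<omega> \<in> borel_measurable borel"
      using measurable_compose[OF measurable_Pair1'[OF that] f] by simp
    moreover have "Z k \<omega> = (\<integral>\<^sup>+s. (if - 1 * t < - 1 * s then 1 else 0) * f k \<omega> s \<partial>lborel)"
      unfolding Z_def by (intro nn_integral_cong) (auto simp: f_def indicator_def)
    ultimately show ?thesis
      using ordered_integral_power[of "f k \<omega>" "- 1" t n] by simp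
  qed
  have [measurable]: "Z k \<in> borel_measurable M" for k
    using Jm[of k 1] Z_pow[of _ k 1] by (simp cong: measurable_cong)
  have Z_mom: "(\<integral>\<^sup>+\<omega>. Z k \<omega> ^ n \<partial>M) = fact n * kac (1 / Suc k) p n t 0" for k n
  proof -
    have "(\<integral>\<^sup>+\<omega>. Z k \<omega> ^ n \<partial>M) = (\<integral>\<^sup>+\<omega>. fact n * ordered_integral (- 1) (f k \<omega>) n t \<partial>M)"
      by (intro nn_integral_cong Z_pow)
    then show ?thesis by (simp add: nn_integral_cmult J)
  qed
  have occ: "AE \<omega> in M. 0 \<le> L \<omega> \<and> (\<lambda>k. Z k \<omega>) \<longlonglongrightarrow> ennreal (L \<omega>)"
  proof -
    have "AE \<omega> in M. ((\<lambda>\<epsilon>. 1 / (2 * \<epsilon>)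
      * (LBINT s:{0..t}. indicator {..\<epsilon>} (R s \<omega>))) \<longlongrightarrow> L \<omega>) (at_right 0)"
      using L by (simp add: local_time_at_0_def)
    then show ?thesis
      using X_eq AE_space
    proof eventually_elim
      case (elim \<omega>)
      have "(\<lambda>s. X s \<omega>) \<in> borel_measurable borel"
        using measurable_compose[OF measurable_Pair1'[OF elim(3)] X] by simp
      moreover have "(LBINT s:{0..t}. indicator {..\<epsilon>} (R s \<omega>))
        = (LBINT s:{0..t}. indicator {..\<epsilon>} \<bar>X s \<omega>\<bar> :: real)" for \<epsilon>
        using elim R_eq by (intro set_lebesgue_integral_cong) auto
      ultimately show ?case
        using gaussian_occupation_limit[of "\<lambda>s. X s \<omega>" t "L \<omega>"] elim(1) t by (simp add: Z_def)
    qed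
  qed
  then show nonneg: "AE \<omega> in M. 0 \<le> L \<omega>" by (auto elim: eventually_mono)
  have "(\<integral>\<^sup>+\<omega>. ennreal (L \<omega>) ^ Suc n \<partial>M) = fact (Suc n) * kac 0 p (Suc n) t 0"
  proof (rule nn_integral_power_limit[where Z = Z and m = "\<lambda>n. fact n * kac 0 p n t 0"])
    show "AE \<omega> in M. (\<lambda>k. Z k \<omega>) \<longlonglongrightarrow> ennreal (L \<omega>)"
      using occ by (auto elim: eventually_mono)
    have fin: "kac 0 p n t 0 < top" for n
      using kac_zero_origin[OF a pa t] by (cases n) auto
    have fact_fin: "(fact n :: ennreal) < top" for n
      by (metis ennreal_less_top of_nat_fact ennreal_of_nat_eq_real_of_nat)
    show "fact n * kac 0 p n t 0 < top" for n
      using fin[of n] fact_fin[of n] by (simp add: ennreal_mult_less_top)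
    show "(\<lambda>k. \<integral>\<^sup>+\<omega>. Z k \<omega> ^ n \<partial>M) \<longlonglongrightarrow> fact n * kac 0 p n t 0" for n
      unfolding Z_mom using fin[of n] fact_fin[of n]
      by (intro tendsto_mult_ennreal tendsto_const kac_tendsto_0) auto
  qed (auto intro: prob_space_axioms)
  also have "\<dots> = ennreal (fact (Suc n)
    * (2 * moment_coeff a n * t powr ((real n + 1) / 2) / (real n + 1)))"
  proof -
    have "(fact (Suc n) :: ennreal) = ennreal (fact (Suc n))"
      by (metis of_nat_fact ennreal_of_nat_eq_real_of_nat)
    then show ?thesis
      unfolding kac_zero_origin[OF a pa t] by (simp only: ennreal_mult' fact_ge_zero)
  qed
  also have "fact (Suc n) * (2 * moment_coeff a n * t powr ((real n + 1) / 2) / (real n + 1))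
      = ?m"
    by (simp add: field_simps)
  finally have nn: "(\<integral>\<^sup>+\<omega>. ennreal (L \<omega>) ^ Suc n \<partial>M) = ennreal ?m" .
  show "has_bochner_integral M (\<lambda>\<omega>. L \<omega> ^ Suc n) ?m"
  proof (rule has_bochner_integral_nn_integral)
    show "AE \<omega> in M. 0 \<le> L \<omega> ^ Suc n"
      using nonneg by eventually_elim simp
    show "0 \<le> ?m"
      using moment_coeff_pos[OF a, of n] by simp
    have "(\<integral>\<^sup>+\<omega>. ennreal (L \<omega> ^ Suc n) \<partial>M) = (\<integral>\<^sup>+\<omega>. ennreal (L \<omega>) ^ Suc n \<partial>M)"
      using nonneg by (intro nn_integral_cong_AE)
        (auto elim!: eventually_mono simp: ennreal_power simp del: power_Suc)
    with nn show "(\<integral>\<^sup>+\<omega>. ennreal (L \<omega> ^ Suc n) \<partial>M) = ennreal ?m"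
      by simp
  qed measurable
qed

text \<open>\<open>sqrt pi\<close> cancels, and \<open>1 - 2 * p\<close> contributes
  \<open>sqrt (2 * a)\<close>. The result is the scale whose \<open>n\<close>-th power occurs in the
  tilted \<open>n\<close>-th moment of the local time.\<close>

lemma kappa_half:
  assumes a: "a > 0" and t: "t > 0" and pa: "1 - 2 * p = 1 / (2 * a)"
  shows "kappa (1 / 2) p t = sqrt (a * t)"
proof -
  have half: "(1 / 2 :: real) \<notin> \<int>\<^sub>\<le>\<^sub>0"
    by (auto elim!: nonpos_Ints_cases simp: field_simps)
  have G: "Gamma (1 + 1 / 2 :: real) = 1 / 2 * sqrt pi"
    using Gamma_plus1[of "1 / 2 :: real"] half by (simp add: Gamma_one_half_real add.commute)
  have "kappa (1 / 2) p t = sqrt (2 * t) * (1 / 2 * sqrt pi) / (sqrt (1 / (2 * a)) * sqrt pi)"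
    unfolding kappa_def pa G using a t by (simp add: powr_half_sqrt Gamma_one_half_real)
  also have "\<dots> = 1 / 2 * (sqrt (2 * t) / sqrt (1 / (2 * a)))"
    by simp
  also have "sqrt (2 * t) / sqrt (1 / (2 * a)) = sqrt (4 * (a * t))"
    by (simp add: real_sqrt_divide[symmetric] ac_simps)
  also have "1 / 2 * \<dots> = sqrt (a * t)"
    by (simp add: real_sqrt_mult)
  finally show ?thesis .
qed

text \<open>Tilting shifts the moments by one: up to scale the \<open>n\<close>-th moment is
  \<open>E n / E 0\<close>, in which the prefactor
  \<open>2 * moment_coeff a 0 * t powr (1 / 2)\<close> cancels. What remains carries
  \<open>sqrt (a * t) ^ n\<close>, which \<open>kappa\<close> removes, and \<open>1 / sqrt 2\<close>
  supplies \<open>2 powr (- n / 2)\<close>. Hence the law is the same for all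
  \<open>t\<close>.\<close>

lemma tilted_local_time_law:
  fixes M :: "'a measure" and a p t :: real
  assumes R: "noise_reinforced_bessel1 M p R" and t: "t > 0" and L: "local_time_at_0 M R t L"
    and a: "a > 0" and pa: "1 - 2 * p = 1 / (2 * a)"
    and N: "prob_space N" "Y \<in> borel_measurable N" "AE \<omega> in N. 0 \<le> Y \<omega>"
      "\<And>n. n \<ge> 1 \<Longrightarrow> has_bochner_integral N (\<lambda>\<omega>. Y \<omega> ^ n) (cost_moment a n)"
  shows "distr N borel Y =
    distr (tilt1 (distr M borel (\<lambda>\<omega>. L \<omega> / kappa (1 / 2) p t))) borel (\<lambda>x. 1 / sqrt 2 * x)"
    (is "_ = ?\<nu>")
proof (rule distr_eqI_cost_moment[OF a N])
  interpret prob_space M by (rule local_time_moments(1)[OF R t L a pa])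
  define k where "k = kappa (1 / 2) p t"
  have k: "k = sqrt (a * t)" unfolding k_def by (rule kappa_half[OF a t pa])
  have k_pos: "0 < k" using a t by (simp add: k)
  have [measurable]: "L \<in> borel_measurable M"
    using L by (simp add: local_time_at_0_def)
  note nonneg = local_time_moments(2)[OF R t L a pa]
  \<comment> \<open>Indexed so that \<open>E n\<close> is the moment of \<open>L\<close> of order
    \<open>n + 1\<close>, and \<open>E 0\<close> is the mean.\<close>
  define E where "E n = 2 * fact n * moment_coeff a n * t powr ((real n + 1) / 2)" for n
  have E: "has_bochner_integral M (\<lambda>\<omega>. L \<omega> ^ Suc n) (E n)" for n
    unfolding E_def by (rule local_time_moments(3)[OF R t L a pa])
  have E_pos: "0 < E n" for n
    using moment_coeff_pos[OF a, of n] t by (simp add: E_def)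
  let ?\<mu> = "distr M borel (\<lambda>\<omega>. L \<omega> / k)"
  have mean: "(\<integral>x. x \<partial>?\<mu>) = E 0 / k"
    using E[of 0] by (subst integral_distr) (auto simp: has_bochner_integral_iff)
  have ae: "AE x in ?\<mu>. 0 \<le> x"
    using nonneg k_pos by (subst AE_distr_iff) (auto elim!: eventually_mono)
  have tilt: "tilt1 ?\<mu> = density ?\<mu> (\<lambda>x. ennreal (x * k / E 0))"
    unfolding tilt1_def mean by simp
  have mom: "has_bochner_integral (tilt1 ?\<mu>) (\<lambda>x. (1 / sqrt 2 * x) ^ n) (E n / E 0 / (k
    * sqrt 2) ^ n)" for n
    unfolding tilt
  proof (rule has_bochner_integral_density)
    show "AE x in ?\<mu>. 0 \<le> x * k / E 0"
      using ae k_pos E_pos[of 0] by (auto elim!: eventually_mono)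
    show "has_bochner_integral ?\<mu> (\<lambda>x. (x * k / E 0) *\<^sub>R (1 / sqrt 2 * x) ^ n) (E n / E 0 / (k
      * sqrt 2) ^ n)"
    proof (rule has_bochner_integral_distr)
      have "has_bochner_integral M (\<lambda>\<omega>. 1 / (E 0 * (k * sqrt 2) ^ n)
        * L \<omega> ^ Suc n) (1 / (E 0 * (k * sqrt 2) ^ n) * E n)"
        by (intro has_bochner_integral_mult_right E)
      also have "(\<lambda>\<omega>. 1 / (E 0 * (k * sqrt 2) ^ n) * L \<omega> ^ Suc n)
        = (\<lambda>\<omega>. (L \<omega> / k * k / E 0) *\<^sub>R (1 / sqrt 2 * (L \<omega> / k)) ^ n)"
        using k_pos by (simp add: fun_eq_iff power_mult_distrib power_divide field_simps)
      finally show "has_bochner_integral M (\<lambda>\<omega>. (L \<omega> / k * k / E 0) *\<^sub>R (1 / sqrt 2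
        * (L \<omega> / k)) ^ n) (E n / E 0 / (k * sqrt 2) ^ n)"
        by (simp add: mult.commute)
    qed measurable
  qed measurable
  have mom_eq: "E n / E 0 / (k * sqrt 2) ^ n = cost_moment a n" for n
  proof -
    let ?P = "\<Prod>k=1..n. Gamma_half_ratio (real k * a)"
    have "t powr ((real n + 1) / 2) = t powr (1 / 2) * sqrt t ^ n"
    proof -
      have "sqrt t ^ n = t powr (real n / 2)"
        using powr_half_real_of_nat[OF t] by simp
      then show ?thesis by (simp add: powr_add[symmetric] add_divide_distrib add.commute)
    qed
    moreover have "moment_coeff a n = moment_coeff a 0 * sqrt a ^ n * ?P"
      by (simp add: moment_coeff_def)
    ultimately have "E n = E 0 * (fact n * ?P * (sqrt a * sqrt t) ^ n)"
      by (simp add: E_def power_mult_distrib)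
    then have "E n / E 0 / (k * sqrt 2) ^ n = fact n * ?P * (k ^ n / (k * sqrt 2) ^ n)"
      using E_pos[of 0] by (simp add: k real_sqrt_mult)
    also have "k ^ n / (k * sqrt 2) ^ n = 1 / sqrt 2 ^ n"
      using k_pos by (simp add: power_mult_distrib)
    also have "sqrt 2 ^ n = 2 powr (real n / 2)"
      by (rule powr_half_real_of_nat[symmetric]) simp
    finally show ?thesis by (simp add: cost_moment_def)
  qed
  \<comment> \<open>The tilted moment of order 0 is the total mass, and it equals 1.\<close>
  have "prob_space (tilt1 ?\<mu>)"
  proof (rule prob_spaceI)
    have "has_bochner_integral (tilt1 ?\<mu>) (\<lambda>x. 1 :: real) 1"
      using mom[of 0] E_pos[of 0] by simp
    then have "(\<integral>\<^sup>+x. ennreal 1 \<partial>tilt1 ?\<mu>) = ennreal 1"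
      by (subst nn_integral_eq_integral) (auto simp: has_bochner_integral_iff)
    then show "emeasure (tilt1 ?\<mu>) (space (tilt1 ?\<mu>)) = 1" by simp
  qed
  then interpret T: prob_space "tilt1 ?\<mu>" .
  have [measurable_cong]: "sets (tilt1 ?\<mu>) = sets borel" by (simp add: tilt1_def)
  show "real_distribution ?\<nu>"
    unfolding k_def[symmetric] by (intro T.real_distribution_distr) measurable
  show "AE x in ?\<nu>. 0 \<le> x"
    unfolding k_def[symmetric]
  proof (subst AE_distr_iff)
    have "AE x in tilt1 ?\<mu>. 0 \<le> x"
      unfolding tilt using ae by (subst AE_density) (auto elim!: eventually_mono)
    then show "AE x in tilt1 ?\<mu>. 0 \<le> 1 / sqrt 2 * x" by (auto elim!: eventually_mono)
  qed measurable
  show "has_bochner_integral ?\<nu> (\<lambda>x. x ^ n) (cost_moment a n)" for n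
    unfolding k_def[symmetric]
  proof (rule has_bochner_integral_distr)
    show "has_bochner_integral (tilt1 ?\<mu>) (\<lambda>x. (1 / sqrt 2 * x) ^ n) (cost_moment a n)"
      using mom[of n] unfolding mom_eq .
  qed measurable
qed

subsection \<open>The exponential functional of the subordinator\<close>

lemma (in prob_space) indep_var_nn_integral_mult:
  fixes X Y :: "'a \<Rightarrow> real" and F G :: "real \<Rightarrow> ennreal"
  assumes XY: "indep_var borel X borel Y"
    and [measurable]: "F \<in> borel_measurable borel" "G \<in> borel_measurable borel"
  shows "(\<integral>\<^sup>+\<omega>. F (X \<omega>) * G (Y \<omega>) \<partial>M) = (\<integral>\<^sup>+\<omega>. F (X \<omega>) \<partial>M) * (\<integral>\<^sup>+\<omega>. G (Y \<omega>) \<partial>M)"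
proof -
  have [measurable]: "X \<in> borel_measurable M" "Y \<in> borel_measurable M"
    and D: "distr M borel X \<Otimes>\<^sub>M distr M borel Y = distr M (borel \<Otimes>\<^sub>M borel) (\<lambda>x. (X x, Y x))"
    using XY unfolding indep_var_distribution_eq by auto
  interpret X: prob_space "distr M borel X" by (rule prob_space_distr) measurable
  interpret Y: prob_space "distr M borel Y" by (rule prob_space_distr) measurable
  have "(\<integral>\<^sup>+\<omega>. F (X \<omega>) * G (Y \<omega>) \<partial>M)
    = (\<integral>\<^sup>+z. F (fst z) * G (snd z) \<partial>distr M (borel \<Otimes>\<^sub>M borel) (\<lambda>x. (X x, Y x)))"
    by (subst nn_integral_distr) auto
  also have "\<dots> = (\<integral>\<^sup>+x. (\<integral>\<^sup>+y. F x * G y \<partial>distr M borel Y) \<partial>distr M borel X)"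
    unfolding D[symmetric] by (subst Y.nn_integral_fst[symmetric]) auto
  also have "\<dots> = (\<integral>\<^sup>+x. F x \<partial>distr M borel X) * (\<integral>\<^sup>+y. G y \<partial>distr M borel Y)"
    by (simp add: nn_integral_cmult nn_integral_multc)
  finally show ?thesis
    by (simp add: nn_integral_distr)
qed

lemma nn_integral_exp_decay:
  fixes c t :: real
  assumes "c > 0"
  shows "(\<integral>\<^sup>+s. (if t < s then 1 else 0) * ennreal (exp (- (s - t) * c)) \<partial>lborel) = ennreal (1 / c)"
proof -
  have "(\<integral>\<^sup>+s. (if t < s then 1 else 0) * ennreal (exp (- (s - t) * c)) \<partial>lborel)
      = (\<integral>\<^sup>+s. ennreal (exp (- (s - t) * c)) * indicator {t..} s \<partial>lborel)"
  proof (rule nn_integral_cong_AE)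
    show "AE s in lborel. (if t < s then 1 else 0) * ennreal (exp (- (s - t) * c))
      = ennreal (exp (- (s - t) * c)) * indicator {t..} s"
      using AE_lborel_singleton[of t] by eventually_elim (auto simp: indicator_def)
  qed
  also have "\<dots> = ennreal (0 - (- exp (- (t - t) * c) / c))"
  proof (rule nn_integral_FTC_atLeast[where F = "\<lambda>s. - exp (- (s - t) * c) / c"])
    show "((\<lambda>s. - exp (- (s - t) * c) / c) has_real_derivative exp (- (s - t) * c)) (at s)" for s
      using assms by (auto intro!: derivative_eq_intros)
    show "((\<lambda>s. - exp (- (s - t) * c) / c) \<longlongrightarrow> 0) at_top"
      using assms by real_asymp
  qed auto
  finally show ?thesis by simp
qed

text \<open>Moving the largest time from \<open>s\<close> down to \<open>t\<close> splits off an
  increment that is independent of the rest and, by stationarity, distributed like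
  \<open>\<xi> (s - t)\<close>.\<close>

lemma laplace_lincomb_step:
  fixes P :: "'a measure"
  assumes levy: "levy_process P \<xi>" and lap: "has_laplace_exponent P \<xi> \<Phi>"
    and X: "\<And>s. X s \<in> borel_measurable P" "AE \<omega> in P. \<forall>t\<ge>0. X t \<omega> = \<xi> t \<omega>"
    and l: "\<And>x. x \<in> set l \<Longrightarrow> 0 \<le> snd x \<and> snd x \<le> t" and t: "0 \<le> t" "t \<le> s" and r: "r > 0"
  shows "(\<integral>\<^sup>+\<omega>. ennreal (exp (- lincomb (\<lambda>u. X u \<omega>) ((r, s) # l))) \<partial>P)
    = ennreal (exp (- (s - t) * \<Phi> r))
      * (\<integral>\<^sup>+\<omega>. ennreal (exp (- lincomb (\<lambda>u. X u \<omega>) ((r, t) # l))) \<partial>P)"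
proof -
  interpret prob_space P
    using levy by (simp add: levy_process_def process_def)
  have \<xi>m: "\<xi> u \<in> borel_measurable P" if "0 \<le> u" for u
    using levy that by (simp add: levy_process_def process_def)
  have \<xi>0: "AE \<omega> in P. \<xi> 0 \<omega> = 0"
    using levy by (simp add: levy_process_def)
  let ?l = "(r, t) # l"
  have [measurable]: "\<xi> s \<in> borel_measurable P" "\<xi> t \<in> borel_measurable P" "\<xi> (s - t)
    \<in> borel_measurable P"
    using t by (auto intro: \<xi>m)
  have "indep_var borel (\<lambda>\<omega>. \<xi> s \<omega> - \<xi> t \<omega>) borel (\<lambda>\<omega>. lincomb (\<lambda>u. \<xi> u \<omega> - \<xi> 0 \<omega>) ?l)"
    using levy l t by (intro indep_var_increment_past) (force simp: levy_process_def)+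
  then have "(\<integral>\<^sup>+\<omega>. ennreal (exp (- r * (\<xi> s \<omega> - \<xi> t \<omega>)))
    * ennreal (exp (- lincomb (\<lambda>u. \<xi> u \<omega> - \<xi> 0 \<omega>) ?l)) \<partial>P)
      = (\<integral>\<^sup>+\<omega>. ennreal (exp (- r * (\<xi> s \<omega> - \<xi> t \<omega>))) \<partial>P)
        * (\<integral>\<^sup>+\<omega>. ennreal (exp (- lincomb (\<lambda>u. \<xi> u \<omega> - \<xi> 0 \<omega>) ?l)) \<partial>P)"
    by (rule indep_var_nn_integral_mult[where F = "\<lambda>x. ennreal (exp (- r * x))" and G
      = "\<lambda>x. ennreal (exp (- x))"]) auto
  also have "(\<integral>\<^sup>+\<omega>. ennreal (exp (- r * (\<xi> s \<omega> - \<xi> t \<omega>))) \<partial>P) = ennreal (exp (- (s - t) * \<Phi> r))"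
  proof -
    have "distr P borel (\<lambda>\<omega>. \<xi> (t + (s - t)) \<omega> - \<xi> t \<omega>) = distr P borel (\<xi> (s - t))"
      using levy t unfolding levy_process_def by (metis diff_ge_0_iff_ge)
    then have D: "distr P borel (\<lambda>\<omega>. \<xi> s \<omega> - \<xi> t \<omega>) = distr P borel (\<xi> (s - t))" by simp
    have "(\<integral>\<^sup>+\<omega>. ennreal (exp (- r * (\<xi> s \<omega> - \<xi> t \<omega>))) \<partial>P)
      = (\<integral>\<^sup>+x. ennreal (exp (- r * x)) \<partial>distr P borel (\<lambda>\<omega>. \<xi> s \<omega> - \<xi> t \<omega>))"
      by (subst nn_integral_distr) auto
    also have "\<dots> = (\<integral>\<^sup>+\<omega>. ennreal (exp (- r * \<xi> (s - t) \<omega>)) \<partial>P)"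
      unfolding D by (subst nn_integral_distr) auto
    also have "\<dots> = ennreal (\<integral>\<omega>. exp (- r * \<xi> (s - t) \<omega>) \<partial>P)"
    proof (rule nn_integral_eq_integral)
      \<comment> \<open>A Bochner integral that does not exist has the default value 0, whereas this
        one is an exponential; hence integrability.\<close>
      have "(\<integral>\<omega>. exp (- r * \<xi> (s - t) \<omega>) \<partial>P) = exp (- (s - t) * \<Phi> r)"
        using lap[unfolded has_laplace_exponent_def, rule_format, OF r, of "s - t"] t by simp
      then have "(\<integral>\<omega>. exp (- r * \<xi> (s - t) \<omega>) \<partial>P) \<noteq> 0" by simp
      then show "integrable P (\<lambda>\<omega>. exp (- r * \<xi> (s - t) \<omega>))"
        using not_integrable_integral_eq by blast
    qed auto
    also have "(\<integral>\<omega>. exp (- r * \<xi> (s - t) \<omega>) \<partial>P) = exp (- (s - t) * \<Phi> r)"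
      using lap[unfolded has_laplace_exponent_def, rule_format, OF r, of "s - t"] t by simp
    finally show ?thesis .
  qed
  finally have main: "(\<integral>\<^sup>+\<omega>. ennreal (exp (- r * (\<xi> s \<omega> - \<xi> t \<omega>)))
    * ennreal (exp (- lincomb (\<lambda>u. \<xi> u \<omega> - \<xi> 0 \<omega>) ?l)) \<partial>P)
      = ennreal (exp (- (s - t) * \<Phi> r))
        * (\<integral>\<^sup>+\<omega>. ennreal (exp (- lincomb (\<lambda>u. \<xi> u \<omega> - \<xi> 0 \<omega>) ?l)) \<partial>P)" .
  have eq: "AE \<omega> in P. lincomb (\<lambda>u. \<xi> u \<omega> - \<xi> 0 \<omega>) ?l = lincomb (\<lambda>u. X u \<omega>) ?l
      \<and> \<xi> s \<omega> = X s \<omega> \<and> \<xi> t \<omega> = X t \<omega>"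
    using \<xi>0 X(2)
  proof eventually_elim
    case (elim \<omega>)
    then have "lincomb (\<lambda>u. \<xi> u \<omega> - \<xi> 0 \<omega>) ?l = lincomb (\<lambda>u. X u \<omega>) ?l"
      using l t by (intro lincomb_cong) auto
    with elim t show ?case by simp
  qed
  have "(\<integral>\<^sup>+\<omega>. ennreal (exp (- lincomb (\<lambda>u. X u \<omega>) ((r, s) # l))) \<partial>P)
      = (\<integral>\<^sup>+\<omega>. ennreal (exp (- r * (\<xi> s \<omega> - \<xi> t \<omega>)))
        * ennreal (exp (- lincomb (\<lambda>u. \<xi> u \<omega> - \<xi> 0 \<omega>) ?l)) \<partial>P)"
  proof (rule nn_integral_cong_AE)
    show "AE \<omega> in P. ennreal (exp (- lincomb (\<lambda>u. X u \<omega>) ((r, s) # l)))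
        = ennreal (exp (- r * (\<xi> s \<omega> - \<xi> t \<omega>))) * ennreal (exp (- lincomb (\<lambda>u. \<xi> u \<omega> - \<xi> 0 \<omega>) ?l))"
      using eq
    proof eventually_elim
      case (elim \<omega>)
      then have eqs: "lincomb (\<lambda>u. \<xi> u \<omega> - \<xi> 0 \<omega>) ?l = lincomb (\<lambda>u. X u \<omega>) ?l"
        "\<xi> s \<omega> = X s \<omega>" "\<xi> t \<omega> = X t \<omega>" by blast+
      have "lincomb (\<lambda>u. X u \<omega>) ((r, s) # l) = r * (\<xi> s \<omega> - \<xi> t \<omega>) + lincomb (\<lambda>u. \<xi> u \<omega> - \<xi> 0 \<omega>) ?l"
        unfolding eqs by (simp add: algebra_simps)
      then have "exp (- lincomb (\<lambda>u. X u \<omega>) ((r, s) # l))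
        = exp (- r * (\<xi> s \<omega> - \<xi> t \<omega>)) * exp (- lincomb (\<lambda>u. \<xi> u \<omega> - \<xi> 0 \<omega>) ?l)"
        by (simp only: exp_add[symmetric]) simp
      then show ?case by (simp only: ennreal_mult exp_ge_zero)
    qed
  qed
  moreover have "(\<integral>\<^sup>+\<omega>. ennreal (exp (- lincomb (\<lambda>u. \<xi> u \<omega> - \<xi> 0 \<omega>) ?l)) \<partial>P)
    = (\<integral>\<^sup>+\<omega>. ennreal (exp (- lincomb (\<lambda>u. X u \<omega>) ?l)) \<partial>P)"
  proof (rule nn_integral_cong_AE)
    show "AE \<omega> in P. ennreal (exp (- lincomb (\<lambda>u. \<xi> u \<omega> - \<xi> 0 \<omega>) ?l))
      = ennreal (exp (- lincomb (\<lambda>u. X u \<omega>) ?l))"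
      using eq by eventually_elim (simp only:)
  qed
  ultimately show ?thesis using main by simp
qed

text \<open>The induction hypothesis at the earliest time \<open>s\<close> collects the
  \<open>n\<close> later exponents into \<open>n / 2\<close> at \<open>s\<close>; with the exponent
  of \<open>s\<close> itself this is \<open>Suc n / 2\<close>. Moving it down to \<open>t\<close>
  costs \<open>exp (- (s - t) * \<Phi> (Suc n / 2))\<close>, and integration over
  \<open>s > t\<close> gives the factor \<open>1 / \<Phi> (Suc n / 2)\<close>.\<close>

lemma laplace_ordered_integral:
  fixes P :: "'a measure"
  assumes levy: "levy_process P \<xi>" and lap: "has_laplace_exponent P \<xi> \<Phi>"
    and \<Phi>: "\<And>r. r > 0 \<Longrightarrow> \<Phi> r > 0"
    and X: "(\<lambda>(\<omega>, t). X t \<omega>) \<in> borel_measurable (P \<Otimes>\<^sub>M borel)" "AE \<omega> in P. \<forall>t\<ge>0. X t \<omega> = \<xi> t \<omega>"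
    and l: "\<And>x. x \<in> set l \<Longrightarrow> 0 \<le> snd x \<and> snd x \<le> t" and t: "0 \<le> t"
  defines "f \<equiv> \<lambda>\<omega> s. ennreal (exp (- (1 / 2) * X s \<omega>))"
  shows "(\<integral>\<^sup>+\<omega>. ennreal (exp (- lincomb (\<lambda>u. X u \<omega>) l)) * ordered_integral 1 (f \<omega>) n t \<partial>P)
    = ennreal (\<Prod>k=1..n. 1 / \<Phi> (real k / 2))
      * (\<integral>\<^sup>+\<omega>. ennreal (exp (- lincomb (\<lambda>u. X u \<omega>) ((real n / 2, t) # l))) \<partial>P)"
  using l t
proof (induction n arbitrary: t l)
  case 0
  then show ?case by simp
next
  case (Suc n)
  interpret prob_space P
    using levy by (simp add: levy_process_def process_def)
  note X(1) [measurable]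
  have Xm [measurable]: "X s \<in> borel_measurable P" for s
    using measurable_compose[OF measurable_Pair2'[of s borel P] X(1)] by simp
  have Lm [measurable]: "(\<lambda>\<omega>. lincomb (\<lambda>u. X u \<omega>) m) \<in> borel_measurable P" for m
    by (intro measurable_lincomb Xm)
  have f [measurable]: "(\<lambda>(\<omega>, s). f \<omega> s) \<in> borel_measurable (P \<Otimes>\<^sub>M borel)"
    unfolding f_def by measurable
  have [measurable]: "(\<lambda>(\<omega>, s). ordered_integral 1 (f \<omega>) n s) \<in> borel_measurable (P \<Otimes>\<^sub>M borel)"
    by (rule measurable_ordered_integral_param[OF f])
  let ?J = "\<lambda>\<omega> s. ordered_integral 1 (f \<omega>) n s" and ?S = "\<lambda>\<omega>. lincomb (\<lambda>u. X u \<omega>) l"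
  let ?c = "real (Suc n) / 2" and ?Pr = "\<lambda>n. \<Prod>k=1..n. 1 / \<Phi> (real k / 2)"
  let ?R = "\<integral>\<^sup>+\<omega>. ennreal (exp (- lincomb (\<lambda>u. X u \<omega>) ((?c, t) # l))) \<partial>P"
  have Pr: "0 \<le> ?Pr n" for n
    by (intro prod_nonneg) (auto intro!: less_imp_le[OF \<Phi>])
  have "(\<integral>\<^sup>+\<omega>. ennreal (exp (- ?S \<omega>)) * ordered_integral 1 (f \<omega>) (Suc n) t \<partial>P)
      = (\<integral>\<^sup>+\<omega>. (\<integral>\<^sup>+s. ennreal (exp (- ?S \<omega>))
        * ((if 1 * t < 1 * s then 1 else 0) * (f \<omega> s * ?J \<omega> s)) \<partial>lborel) \<partial>P)"
    unfolding ordered_integral.simps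
  proof (intro nn_integral_cong nn_integral_cmult[symmetric])
    fix \<omega> assume \<omega>: "\<omega> \<in> space P"
    have fm [measurable]: "f \<omega> \<in> borel_measurable borel"
      using measurable_compose[OF measurable_Pair1'[OF \<omega>] f] by simp
    show "(\<lambda>s. (if 1 * t < 1 * s then 1 else 0) * (f \<omega> s * ?J \<omega> s)) \<in> borel_measurable lborel"
      by measurable
  qed
  also have "\<dots> = (\<integral>\<^sup>+s. (\<integral>\<^sup>+\<omega>. ennreal (exp (- ?S \<omega>))
    * ((if 1 * t < 1 * s then 1 else 0) * (f \<omega> s * ?J \<omega> s)) \<partial>P) \<partial>lborel)"
  proof -
    interpret PL: pair_sigma_finite P lborel ..
    show ?thesis by (rule PL.Fubini'[symmetric]) measurable
  qed
  also have "\<dots> = (\<integral>\<^sup>+s. ennreal (?Pr n) * ?R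
    * ((if t < s then 1 else 0) * ennreal (exp (- (s - t) * \<Phi> ?c))) \<partial>lborel)"
  proof (intro nn_integral_cong)
    fix s
    have "(\<integral>\<^sup>+\<omega>. ennreal (exp (- ?S \<omega>)) * (f \<omega> s * ?J \<omega> s) \<partial>P)
      = ennreal (?Pr n) * ?R * ennreal (exp (- (s - t) * \<Phi> ?c))" if s: "t < s"
    proof -
      have "(\<integral>\<^sup>+\<omega>. ennreal (exp (- ?S \<omega>)) * (f \<omega> s * ?J \<omega> s) \<partial>P)
          = (\<integral>\<^sup>+\<omega>. ennreal (exp (- lincomb (\<lambda>u. X u \<omega>) ((1 / 2, s) # l))) * ?J \<omega> s \<partial>P)"
        by (intro nn_integral_cong)
          (simp add: f_def mult.assoc[symmetric] add.commute flip: ennreal_mult exp_add)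
      also have "\<dots> = ennreal (?Pr n)
        * (\<integral>\<^sup>+\<omega>. ennreal (exp (- lincomb (\<lambda>u. X u \<omega>) ((real n / 2, s) # (1 / 2, s) # l))) \<partial>P)"
        using s Suc.prems by (intro Suc.IH) force+
      also have "(\<integral>\<^sup>+\<omega>. ennreal (exp (- lincomb (\<lambda>u. X u \<omega>) ((real n / 2, s) # (1 / 2, s) # l))) \<partial>P)
          = (\<integral>\<^sup>+\<omega>. ennreal (exp (- lincomb (\<lambda>u. X u \<omega>) ((?c, s) # l))) \<partial>P)"
        by (simp add: add_divide_distrib distrib_right add.assoc add.commute add.left_commute)
      also have "\<dots> = ennreal (exp (- (s - t) * \<Phi> ?c)) * ?R"
        using s Suc.prems by (intro laplace_lincomb_step[OF levy lap Xm X(2)]) auto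
      finally show ?thesis by (simp only: ac_simps)
    qed
    then show "(\<integral>\<^sup>+\<omega>. ennreal (exp (- ?S \<omega>))
      * ((if 1 * t < 1 * s then 1 else 0) * (f \<omega> s * ?J \<omega> s)) \<partial>P)
        = ennreal (?Pr n) * ?R * ((if t < s then 1 else 0) * ennreal (exp (- (s - t) * \<Phi> ?c)))"
      by (cases "t < s") simp_all
  qed
  also have "\<dots> = ennreal (?Pr n) * ?R * ennreal (1 / \<Phi> ?c)"
  proof -
    have "(\<integral>\<^sup>+s. (if t < s then 1 else 0) * ennreal (exp (- (s - t) * \<Phi> ?c)) \<partial>lborel)
      = ennreal (1 / \<Phi> ?c)"
      by (intro nn_integral_exp_decay \<Phi>) simp
    moreover have "(\<integral>\<^sup>+s. ennreal (?Pr n) * ?R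
      * ((if t < s then 1 else 0) * ennreal (exp (- (s - t) * \<Phi> ?c))) \<partial>lborel)
        = ennreal (?Pr n) * ?R * (\<integral>\<^sup>+s. (if t < s then 1 else 0)
          * ennreal (exp (- (s - t) * \<Phi> ?c)) \<partial>lborel)"
      by (rule nn_integral_cmult) measurable
    ultimately show ?thesis by (simp only:)
  qed
  also have "\<dots> = ennreal (?Pr (Suc n)) * ?R"
  proof -
    have "ennreal (?Pr (Suc n)) = ennreal (?Pr n) * ennreal (1 / \<Phi> ?c)"
      using Pr[of n] by (subst ennreal_mult'[symmetric]) simp_all
    then show ?thesis by (simp only: ac_simps)
  qed
  finally show ?case .
qed

text \<open>Taken at \<open>t = 0\<close> with an empty list, where the leftover exponential is 1
  because \<open>\<xi> 0\<close> vanishes almost surely. \<open>I\<close> is extended real valued,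
  so convergence of the integral is not presupposed.\<close>

lemma subordinator_exponential_functional_moments:
  fixes P :: "'a measure" and I :: "'a \<Rightarrow> ennreal"
  assumes sub: "subordinator P \<xi>" and lap: "has_laplace_exponent P \<xi> \<Phi>"
    and \<Phi>: "\<And>r. r > 0 \<Longrightarrow> \<Phi> r > 0"
    and I: "AE \<omega> in P. I \<omega> = (\<integral>\<^sup>+t\<in>{0..}. ennreal (exp (- 1 / 2 * \<xi> t \<omega>)) \<partial>lborel)"
  shows "(\<integral>\<^sup>+\<omega>. I \<omega> ^ n \<partial>P) = ennreal (fact n * (\<Prod>k=1..n. 1 / \<Phi> (real k / 2)))"
proof -
  have levy: "levy_process P \<xi>" using sub by (simp add: subordinator_def)
  interpret prob_space P
    using levy by (simp add: levy_process_def process_def)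
  have \<xi>m: "\<xi> u \<in> borel_measurable P" if "0 \<le> u" for u
    using levy that by (simp add: levy_process_def process_def)
  have "AE \<omega> in P. \<forall>t\<ge>0. ((\<lambda>s. \<xi> s \<omega>) \<longlongrightarrow> \<xi> t \<omega>) (at_right t)"
    using levy unfolding levy_process_def by (auto elim: eventually_mono)
  from right_continuous_modification[OF \<xi>m this] obtain X
    where X: "(\<lambda>(\<omega>, t). X t \<omega>) \<in> borel_measurable (P \<Otimes>\<^sub>M borel)"
    and X_eq: "AE \<omega> in P. \<forall>t\<ge>0. X t \<omega> = \<xi> t \<omega>" by blast
  note X [measurable]
  define f where "f \<omega> s = ennreal (exp (- (1 / 2) * X s \<omega>))" for \<omega> s
  have f: "(\<lambda>(\<omega>, s). f \<omega> s) \<in> borel_measurable (P \<Otimes>\<^sub>M borel)"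
    unfolding f_def by measurable
  have [measurable]: "(\<lambda>\<omega>. ordered_integral 1 (f \<omega>) n 0) \<in> borel_measurable P"
    using measurable_compose[OF measurable_Pair2'[of 0 borel P]
      measurable_ordered_integral_param[OF f]] by simp
  have "AE \<omega> in P. I \<omega> ^ n = fact n * ordered_integral 1 (f \<omega>) n 0"
    using I X_eq AE_space
  proof eventually_elim
    case (elim \<omega>)
    have "I \<omega> = (\<integral>\<^sup>+s. (if 1 * 0 < 1 * s then 1 else 0) * f \<omega> s \<partial>lborel)"
      unfolding elim(1)
    proof (rule nn_integral_cong_AE)
      show "AE s in lborel. ennreal (exp (- 1 / 2 * \<xi> s \<omega>)) * indicator {0..} s
        = (if 1 * 0 < 1 * s then 1 else 0) * f \<omega> s"
        using AE_lborel_singleton[of 0]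
          by eventually_elim (use elim(2) in \<open>auto simp: f_def indicator_def\<close>)
    qed
    moreover have "f \<omega> \<in> borel_measurable borel"
      using measurable_compose[OF measurable_Pair1'[OF elim(3)] f] by simp
    ultimately show ?case
      using ordered_integral_power[of "f \<omega>" 1 0 n] by simp
  qed
  then have "(\<integral>\<^sup>+\<omega>. I \<omega> ^ n \<partial>P) = (\<integral>\<^sup>+\<omega>. fact n * ordered_integral 1 (f \<omega>) n 0 \<partial>P)"
    by (rule nn_integral_cong_AE)
  also have "\<dots> = fact n * (\<integral>\<^sup>+\<omega>. ordered_integral 1 (f \<omega>) n 0 \<partial>P)"
    by (rule nn_integral_cmult) measurable
  also have "(\<integral>\<^sup>+\<omega>. ordered_integral 1 (f \<omega>) n 0 \<partial>P)
      = ennreal (\<Prod>k=1..n. 1 / \<Phi> (real k / 2)) * (\<integral>\<^sup>+\<omega>. ennreal (exp (- (real n / 2 * X 0 \<omega>))) \<partial>P)"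
    using laplace_ordered_integral[OF levy lap \<Phi> X X_eq, of "[]" 0 n] by (simp add: f_def[abs_def])
  also have "(\<integral>\<^sup>+\<omega>. ennreal (exp (- (real n / 2 * X 0 \<omega>))) \<partial>P) = (\<integral>\<^sup>+\<omega>. 1 \<partial>P)"
  proof (rule nn_integral_cong_AE)
    have "AE \<omega> in P. \<xi> 0 \<omega> = 0" using levy by (simp add: levy_process_def)
    then show "AE \<omega> in P. ennreal (exp (- (real n / 2 * X 0 \<omega>))) = 1"
      using X_eq by eventually_elim simp
  qed
  also have "\<dots> = 1" by (simp add: emeasure_space_1)
  also have "(fact n :: ennreal) = ennreal (fact n)"
    by (metis of_nat_fact ennreal_of_nat_eq_real_of_nat)
  also have "ennreal (fact n) * (ennreal (\<Prod>k=1..n. 1 / \<Phi> (real k / 2)) * 1)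
    = ennreal (fact n * (\<Prod>k=1..n. 1 / \<Phi> (real k / 2)))"
    by (simp add: ennreal_mult')
  finally show ?thesis .
qed

text \<open>The second Beta argument is \<open>2 * a * (k / 2) = k * a\<close>, so the Gamma ratio
  of the local-time moments appears again; \<open>sqrt pi\<close> cancels against
  \<open>Gamma (1 / 2)\<close>.\<close>

lemma Phi_hat_half:
  assumes a: "a > 0" and k: "k \<ge> 1"
  shows "1 / Phi_hat a (real k / 2) = sqrt a * Gamma_half_ratio (real k * a)"
proof -
  have ka: "0 < real k * a" using a k by simp
  have pos: "Gamma (real k * a) > 0" "Gamma (real k * a + 1 / 2) > 0"
    using ka by (auto intro!: Gamma_real_pos)
  have "2 powr (- 1 / 2) * (1 / (2 * a)) powr (1 / 2) = 1 / (2 * sqrt a)"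
  proof -
    have "2 powr (- 1 / 2) = 1 / sqrt 2"
      using powr_minus_divide[of "2 :: real" "1 / 2"] by (simp add: powr_half_sqrt)
    moreover have "(1 / (2 * a)) powr (1 / 2) = 1 / (sqrt 2 * sqrt a)"
      using a by (simp add: powr_half_sqrt real_sqrt_divide real_sqrt_mult)
    ultimately show ?thesis by simp
  qed
  moreover have "Beta (1 / 2) (2 * a * (real k / 2)) = sqrt pi * Gamma_half_ratio (real k * a)"
    by (simp add: Beta_def Gamma_one_half_real mult.commute add.commute)
  ultimately show ?thesis
    using pos a by (simp add: Phi_hat_def Gamma_one_half_real field_simps)
qed

lemma Phi_hat_pos:
  assumes "a > 0" "r > 0"
  shows "Phi_hat a r > 0"
proof -
  have "0 < Beta (1 / 2) (2 * a * r)"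
    using assms by (auto simp: Beta_def intro!: divide_pos_pos mult_pos_pos Gamma_real_pos
      add_pos_pos)
  then show ?thesis
    using assms by (simp add: Phi_hat_def Gamma_one_half_real)
qed

text \<open>Each factor \<open>1 / \<Phi>\<close> contributes \<open>sqrt a\<close>, which the
  constant cancels because \<open>kappa\<close> at \<open>t = 1\<close> is \<open>sqrt a\<close>.
  The moments are compared for the real variable \<open>enn2real (I \<omega>)\<close>, and both laws
  are then pushed to the extended reals.\<close>

lemma exponential_functional_law:
  fixes P :: "'a measure" and I :: "'a \<Rightarrow> ennreal" and a p :: real
  assumes sub: "subordinator P \<xi>" and lap: "has_laplace_exponent P \<xi> (Phi_hat a)"
    and I [measurable]: "I \<in> borel_measurable P"
    and I_eq: "AE \<omega> in P. I \<omega> = (\<integral>\<^sup>+t\<in>{0..}. ennreal (exp (- 1 / 2 * \<xi> t \<omega>)) \<partial>lborel)"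
    and a: "a > 0" and pa: "1 - 2 * p = 1 / (2 * a)"
    and N: "prob_space N" "Y \<in> borel_measurable N" "AE \<omega> in N. 0 \<le> Y \<omega>"
      "\<And>n. n \<ge> 1 \<Longrightarrow> has_bochner_integral N (\<lambda>\<omega>. Y \<omega> ^ n) (cost_moment a n)"
  shows "distr N borel (\<lambda>\<omega>. ennreal (Y \<omega>))
    = distr P borel (\<lambda>\<omega>. ennreal (1 / (kappa (1 / 2) p 1 * sqrt 2)) * I \<omega>)"
proof -
  interpret prob_space P
    using sub by (simp add: subordinator_def levy_process_def process_def)
  define c where "c = 1 / (kappa (1 / 2) p 1 * sqrt 2)"
  have c: "c = 1 / (sqrt a * sqrt 2)"
    unfolding c_def kappa_half[OF a zero_less_one pa] by simp
  have c_pos: "0 < c" using a by (simp add: c)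
  have mom: "(\<integral>\<^sup>+\<omega>. I \<omega> ^ n \<partial>P) = ennreal (fact n * (\<Prod>k=1..n. 1 / Phi_hat a (real k / 2)))" for n
    by (rule subordinator_exponential_functional_moments[OF sub lap Phi_hat_pos[OF a] I_eq])
  \<comment> \<open>The first moment is finite, hence so is \<open>I\<close> almost surely, and
    \<open>enn2real\<close> loses nothing.\<close>
  have fin: "AE \<omega> in P. I \<omega> \<noteq> \<infinity>"
    using mom[of 1] by (intro nn_integral_PInf_AE) auto
  have scaled: "c ^ n * (fact n * (\<Prod>k=1..n. 1 / Phi_hat a (real k / 2))) = cost_moment a n" for n
  proof -
    have "(\<Prod>k=1..n. 1 / Phi_hat a (real k / 2)) = (\<Prod>k=1..n. sqrt a * Gamma_half_ratio (real k * a))"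
      by (intro prod.cong refl Phi_hat_half[OF a]) simp
    also have "\<dots> = sqrt a ^ n * (\<Prod>k=1..n. Gamma_half_ratio (real k * a))"
      unfolding prod.distrib by simp
    finally have "(\<Prod>k=1..n. 1 / Phi_hat a (real k / 2)) = \<dots>" .
    moreover have "2 powr (real n / 2) = sqrt 2 ^ n"
      by (rule powr_half_real_of_nat) simp
    ultimately show ?thesis
      using a by (simp add: c cost_moment_def power_mult_distrib power_divide)
  qed
  have "distr N borel Y = distr P borel (\<lambda>\<omega>. c * enn2real (I \<omega>))"
  proof (rule distr_eqI_cost_moment[OF a N])
    show "real_distribution (distr P borel (\<lambda>\<omega>. c * enn2real (I \<omega>)))"
      by (intro real_distribution_distr) measurable
    show "AE x in distr P borel (\<lambda>\<omega>. c * enn2real (I \<omega>)). 0 \<le> x"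
      using c_pos by (subst AE_distr_iff) auto
    show "has_bochner_integral (distr P borel (\<lambda>\<omega>. c
      * enn2real (I \<omega>))) (\<lambda>x. x ^ n) (cost_moment a n)" for n
    proof (rule has_bochner_integral_distr)
      have "has_bochner_integral P (\<lambda>\<omega>. enn2real (I \<omega>) ^ n) (fact n
        * (\<Prod>k=1..n. 1 / Phi_hat a (real k / 2)))"
      proof (rule has_bochner_integral_nn_integral)
        show "0 \<le> fact n * (\<Prod>k=1..n. 1 / Phi_hat a (real k / 2))"
          by (intro mult_nonneg_nonneg prod_nonneg) (auto intro!: less_imp_le[OF Phi_hat_pos[OF a]])
        have "(\<integral>\<^sup>+\<omega>. ennreal (enn2real (I \<omega>) ^ n) \<partial>P) = (\<integral>\<^sup>+\<omega>. I \<omega> ^ n \<partial>P)"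
        proof (rule nn_integral_cong_AE)
          show "AE \<omega> in P. ennreal (enn2real (I \<omega>) ^ n) = I \<omega> ^ n"
            using fin by eventually_elim (simp add: ennreal_power[symmetric] less_top)
        qed
        then show "(\<integral>\<^sup>+\<omega>. ennreal (enn2real (I \<omega>) ^ n) \<partial>P)
          = ennreal (fact n * (\<Prod>k=1..n. 1 / Phi_hat a (real k / 2)))"
          unfolding mom .
      qed auto
      from has_bochner_integral_mult_right[OF this, of "c ^ n"]
      show "has_bochner_integral P (\<lambda>\<omega>. (c * enn2real (I \<omega>)) ^ n) (cost_moment a n)"
        unfolding scaled power_mult_distrib by simp
    qed measurable
  qed
  then have "distr (distr N borel Y) borel ennreal
    = distr (distr P borel (\<lambda>\<omega>. c * enn2real (I \<omega>))) borel ennreal"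
    by simp
  then have "distr N borel (\<lambda>\<omega>. ennreal (Y \<omega>)) = distr P borel (\<lambda>\<omega>. ennreal (c * enn2real (I \<omega>)))"
    using N(2) by (simp add: distr_distr comp_def)
  also have "\<dots> = distr P borel (\<lambda>\<omega>. ennreal c * I \<omega>)"
  proof (rule distr_cong_AE)
    show "AE \<omega> in P. ennreal (c * enn2real (I \<omega>)) = ennreal c * I \<omega>"
      using fin by eventually_elim (use c_pos in \<open>simp add: ennreal_mult less_top\<close>)
  qed auto
  finally show ?thesis unfolding c_def .
qed

text \<open>Both parts range over every realisation of the processes, since only laws matter. The
  identity on the extended reals in the second part includes that the integral is finite almost
  surely.\<close>

theorem corollary1:
  fixes a a' d \<alpha> p :: real and N :: "'n measure" and Y :: "'n \<Rightarrow> real"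
  assumes "a \<ge> 0" and "a' = a + 1 / 2"
    and "prob_space N" and "Y \<in> borel_measurable N" and "AE \<omega> in N. 0 \<le> Y \<omega>"
    and "\<And>s::nat. s \<ge> 1 \<Longrightarrow>
      has_bochner_integral N (\<lambda>\<omega>. Y \<omega> ^ s)
        (fact s / 2 powr (real s / 2) *
          (\<Prod>k=1..s. Gamma (real k * a') / Gamma (real k * a' + 1 / 2)))"
    and "d = 1" and "\<alpha> = 1 - d / 2" and "p = 1 / 2 - 1 / (4 * a')"
  shows "(\<forall>(M :: 'm measure) R t L.
            noise_reinforced_bessel1 M p R \<longrightarrow> t > 0 \<longrightarrow> local_time_at_0 M R t L \<longrightarrow>
            distr N borel Y =
              distr (tilt1 (distr M borel (\<lambda>\<omega>. L \<omega> / kappa \<alpha> p t))) borel (\<lambda>x. 1 / sqrt 2 * x))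
       \<and> (\<forall>(P :: 'p measure) \<xi> (I :: 'p \<Rightarrow> ennreal).
            subordinator P \<xi> \<longrightarrow> has_laplace_exponent P \<xi> (Phi_hat a') \<longrightarrow>
            I \<in> borel_measurable P \<longrightarrow>
            (AE \<omega> in P. I \<omega> = (\<integral>\<^sup>+t\<in>{0..}. ennreal (exp (- 1 / 2 * \<xi> t \<omega>)) \<partial>lborel)) \<longrightarrow>
            distr N borel (\<lambda>\<omega>. ennreal (Y \<omega>)) =
              distr P borel (\<lambda>\<omega>. ennreal (1 / (kappa \<alpha> p 1 * sqrt 2)) * I \<omega>))"
proof -
  have a': "a' > 0" using assms(1,2) by simp
  have \<alpha>: "\<alpha> = 1 / 2" using assms(7,8) by simp
  have pa: "1 - 2 * p = 1 / (2 * a')" using assms(9) by simp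
  have moments: "has_bochner_integral N (\<lambda>\<omega>. Y \<omega> ^ n) (cost_moment a' n)" if "n \<ge> 1" for n
    unfolding cost_moment_def by (rule assms(6)[OF that])
  show ?thesis
    unfolding \<alpha>
    using tilted_local_time_law[OF _ _ _ a' pa assms(3-5) moments]
      exponential_functional_law[OF _ _ _ _ a' pa assms(3-5) moments]
    by blast
qed

end
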